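(* Let $G$ be a non-archimedean second-countable topological group together with a right-invariant compatible metric $d$, and let $(\mu_n)_{n\in\mathbb{N}}$ be a sequence of Borel probability measures on $G$ with compact supports $K_n:=\operatorname{spt}\mu_n$ $(n\in\mathbb{N})$. Suppose that $(\mu_n)_{n\in\mathbb{N}}$ UEB-converges to invariance over $G$. Then either (1) $G$ is precompact, and then the sequence of $mm$-spaces $(K_n,d|_{K_n\times K_n},\mu_n|_{K_n})_{n\in\mathbb{N}}$ concentrates to $(\kappa G,d_{\kappa G},\mu_{\kappa G})$, or (2) $G$ is not precompact, and then $(K_n,d|_{K_n\times K_n},\mu_n|_{K_n})_{n\in\mathbb{N}}$ dissipates.
   Context: All topological groups are assumed Hausdorff. A topological group is non-archimedean if its neutral element has a neighborhood basis consisting of open subgroups. A compatible metric is one generating the topology. $G$ carries its right uniformity, with basic entourages $\{(x,y)\mid yx^{-1}\in U\}$ for $U$ a neighborhood of the neutral element. $G$ is precompact if for every neighborhood $U$ of the neutral element there is a finite $F\subseteq G$ with $G=UF$. A set $H$ of real-valued functions on $G$ belongs to $\mathrm{RUEB}(G)$ if it consists of bounded functions uniformly continuous for the right uniformity, is bounded in the supremum norm, and is uniformly equicontinuous (for every $\epsilon>0$ there is an entourage $V$ of the right uniformity with $|f(x)-f(y)|\le\epsilon$ for all $f\in H$, $(x,y)\in V$). With $\lambda_g(x)=gx$, a net $(\mu_i)_{i\in I}$ of Borel probability measures on $G$ UEB-converges to invariance (over $G$) if $\sup_{f\in H}|\int f\circ\lambda_g\,d\mu_i-\int f\,d\mu_i|\to0$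 for all $g\in G$, $H\in\mathrm{RUEB}(G)$. The support $\operatorname{spt}\nu$ of a Borel probability measure is the closed set of points all of whose open neighborhoods have positive measure; $\mu|_B$, for $\mu(B)=1$, denotes the restriction of $\mu$ to Borel subsets of $B$. Bohr compactification: $\kappa G$ is the Gelfand spectrum of the $C^*$-algebra $\mathrm{AP}(G)$ of all almost periodic continuous bounded complex-valued functions on $G$, a compact group under $(\mu\nu)(f)=\mu(g\mapsto\nu(f\circ\lambda_g))$ for $\mu,\nu\in\kappa G$, $f\in\mathrm{AP}(G)$, and $\kappa_G\colon G\to\kappa G$, $\kappa_G(x)(f)=f(x)$, is a continuous homomorphism with dense image. It is known that if $G$ is metrizable and precompact and $d$ is a right-invariant compatible metric on $G$, then there is a unique compatible metric $d_{\kappa G}$ on $\kappa G$ with $d_{\kappa G}(\kappa_G(x),\kappa_G(y))=d(x,y)$ for all $x,y\in G$. $\mu_{\kappa G}$ denotes the normalized Haar measure on $\kappa G$. An $mm$-space is a triple $\mathcal{X}=(X,d,\mu)$ where $(X,d)$ is a separable complete metric space and $\mu$ is a Borel probability measure on $X$. For $m\in\mathbb{N}\setminus\{0\}$ and $\kappa_0,\ldots,\kappa_m>0$, $\mathrm{Sep}(\mathcal{X};\kappa_0,\ldots,\kappa_m)$ is the supremum, over all tuples $(B_0,\ldots,B_m)$ of Borel subsets of $X$ with $\mu(B_i)\ge\kappa_i$ for each $i$, of $\inf\{d(x,y)\mid i\ne j,\ x\in B_i,\ y\in B_j\}$ (infima and suprema in $[0,\infty)$, so the supremum of the empty set is $0$).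 For $\delta>0$, a sequence $(\mathcal{X}_n)_{n\in\mathbb{N}}$ of $mm$-spaces $\delta$-dissipates if $\liminf_{n\to\infty}\mathrm{Sep}(\mathcal{X}_n;\kappa_0,\ldots,\kappa_m)\ge\delta$ for all $m\in\mathbb{N}\setminus\{0\}$ and all $\kappa_0,\ldots,\kappa_m>0$ with $\sum_{i=0}^m\kappa_i<1$; it dissipates if it $\delta$-dissipates for some $\delta>0$. Let $\lambda$ be Lebesgue measure on $[0,1]$ and $\mathrm{me}_\lambda(f,g)=\inf\{\epsilon>0\mid\lambda(\{|f-g|>\epsilon\})\le\epsilon\}$ for measurable $f,g\colon[0,1]\to\mathbb{R}$. A parametrization of $\mathcal{X}$ is a Borel map $\phi\colon[0,1]\to X$ with $\phi_*(\lambda)=\mu$ (one always exists); $\mathrm{Lip}_1(\mathcal{X})\circ\phi=\{f\circ\phi\mid f\colon X\to\mathbb{R}\ 1\text{-Lipschitz}\}$. The observable distance $d_{\mathrm{conc}}(\mathcal{X},\mathcal{Y})$ is the infimum of $\mathrm{H}_{\mathrm{me}_\lambda}(\mathrm{Lip}_1(\mathcal{X})\circ\phi,\mathrm{Lip}_1(\mathcal{Y})\circ\psi)$ over all parametrizations $\phi$ of $\mathcal{X}$ and $\psi$ of $\mathcal{Y}$, where $\mathrm{H}_{\mathrm{me}_\lambda}$ is the Hausdorff distance for the pseudo-metric $\mathrm{me}_\lambda$. A sequence $(\mathcal{X}_n)$ concentrates to $\mathcal{X}$ if $d_{\mathrm{conc}}(\mathcal{X}_n,\mathcal{X})\to0$.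 *)

theory Defs
  imports "HOL-Probability.Probability"
begin

text \<open>
  Topological groups are modelled by the type class \<^class>\<open>topological_group_add\<close>, which is written
  additively but does not assume commutativity: \<open>x + y\<close>, \<open>- x\<close>, \<open>0\<close> stand for the product, the
  inverse and the neutral element; \<open>y - x\<close> is \<open>y + (- x)\<close>, i.e. \<open>y\<close> times the inverse of \<open>x\<close>.
\<close>

section \<open>Topological groups\<close>

definition add_subgroup :: "'g::group_add set \<Rightarrow> bool" where
  "add_subgroup H \<longleftrightarrow> 0 \<in> H \<and> (\<forall>x\<in>H. \<forall>y\<in>H. x + y \<in> H) \<and> (\<forall>x\<in>H. - x \<in> H)"

definition non_archimedean :: "'g::topological_group_add itself \<Rightarrow> bool" where
  "non_archimedean _ \<longleftrightarrow>
     (\<forall>U::'g set. 0 \<in> interior U \<longrightarrow> (\<exists>H. open H \<and> add_subgroup H \<and> H \<subseteq> U))"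

definition precompact :: "'g::topological_group_add itself \<Rightarrow> bool" where
  "precompact _ \<longleftrightarrow>
     (\<forall>U::'g set. 0 \<in> interior U \<longrightarrow> (\<exists>F. finite F \<and> UNIV = {u + x |u x. u \<in> U \<and> x \<in> F}))"

definition right_uniformity :: "('g::topological_group_add \<times> 'g) filter" where
  "right_uniformity = filtercomap (\<lambda>(x, y). y - x) (nhds 0)"

definition right_uniformly_continuous :: "('g::topological_group_add \<Rightarrow> real) \<Rightarrow> bool" where
  "right_uniformly_continuous f \<longleftrightarrow>
     filterlim (\<lambda>(x, y). (f x, f y)) uniformity right_uniformity"

definition RUEB :: "('g::topological_group_add \<Rightarrow> real) set set" where
  "RUEB = {H.
     (\<forall>f\<in>H. bounded (range f) \<and> right_uniformly_continuous f) \<and>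
     (\<exists>C. \<forall>f\<in>H. \<forall>x. \<bar>f x\<bar> \<le> C) \<and>
     (\<forall>\<epsilon>>0. eventually (\<lambda>(x, y). \<forall>f\<in>H. \<bar>f x - f y\<bar> \<le> \<epsilon>) right_uniformity)}"

definition borel_probability :: "'a::topological_space measure \<Rightarrow> bool" where
  "borel_probability \<mu> \<longleftrightarrow> prob_space \<mu> \<and> sets \<mu> = sets borel"

text \<open>
  A net is given by an indexed family together with its filter of tails. The supremum is taken in
  \<open>[0,\<infinity>]\<close> so that it is \<open>0\<close> for the empty \<open>H\<close>; it is always finite.
\<close>

definition UEB_converges_to_invariance ::
    "('i \<Rightarrow> 'g::topological_group_add measure) \<Rightarrow> 'i filter \<Rightarrow> bool" where
  "UEB_converges_to_invariance \<mu> F \<longleftrightarrow>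
     (\<forall>g. \<forall>H\<in>RUEB.
        ((\<lambda>i. SUP f\<in>H. ennreal \<bar>(\<integral>x. f (g + x) \<partial>\<mu> i) - (\<integral>x. f x \<partial>\<mu> i)\<bar>) \<longlongrightarrow> 0) F)"

definition spt :: "'a::topological_space measure \<Rightarrow> 'a set" where
  "spt \<nu> = {x. \<forall>U. open U \<and> x \<in> U \<longrightarrow> emeasure \<nu> U > 0}"

definition right_invariant :: "'g::group_add metric \<Rightarrow> bool" where
  "right_invariant d \<longleftrightarrow> (\<forall>x y g. mdist d (x + g) (y + g) = mdist d x y)"

definition compatible_metric :: "'a topology \<Rightarrow> 'a metric \<Rightarrow> bool" where
  "compatible_metric T d \<longleftrightarrow> mtopology_of d = T"


section \<open>Bohr compactification\<close>

text \<open>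
  \<open>f\<close> is almost periodic if its orbit under translations is relatively compact in the Banach space
  of bounded continuous functions with the supremum norm.
\<close>

definition AP :: "('g::topological_group_add \<Rightarrow> complex) set" where
  "AP = {f \<in> bcontfun. compact (closure (range (\<lambda>g. Bcontfun (\<lambda>x. f (g + x)))))}"

text \<open>
  The Gelfand spectrum consists of the nonzero multiplicative linear functionals with the topology
  of pointwise convergence on \<open>AP\<close> (the weak-* topology). Functionals on \<open>AP\<close> are represented by
  functions which are \<^const>\<open>undefined\<close> outside \<open>AP\<close>.
\<close>

definition bohr :: "(('g::topological_group_add \<Rightarrow> complex) \<Rightarrow> complex) set" where
  "bohr = {\<phi> \<in> extensional AP.
     (\<forall>f\<in>AP. \<forall>h\<in>AP. \<phi> (\<lambda>x. f x + h x) = \<phi> f + \<phi> h) \<and>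
     (\<forall>c. \<forall>f\<in>AP. \<phi> (\<lambda>x. c * f x) = c * \<phi> f) \<and>
     (\<forall>f\<in>AP. \<forall>h\<in>AP. \<phi> (\<lambda>x. f x * h x) = \<phi> f * \<phi> h) \<and>
     (\<exists>f\<in>AP. \<phi> f \<noteq> 0)}"

definition bohr_topology :: "(('g::topological_group_add \<Rightarrow> complex) \<Rightarrow> complex) topology" where
  "bohr_topology = subtopology (product_topology (\<lambda>_. euclidean) AP) bohr"

definition bohr_mult ::
    "(('g::topological_group_add \<Rightarrow> complex) \<Rightarrow> complex) \<Rightarrow>
     (('g \<Rightarrow> complex) \<Rightarrow> complex) \<Rightarrow> (('g \<Rightarrow> complex) \<Rightarrow> complex)" where
  "bohr_mult \<phi> \<psi> = (\<lambda>f\<in>AP. \<phi> (\<lambda>g. \<psi> (\<lambda>x. f (g + x))))"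

definition bohr_map :: "'g::topological_group_add \<Rightarrow> (('g \<Rightarrow> complex) \<Rightarrow> complex)" where
  "bohr_map x = (\<lambda>f\<in>AP. f x)"

text \<open>
  For metrizable precompact \<open>G\<close> and a right-invariant compatible metric \<open>d\<close> on \<open>G\<close>, such a \<open>d\<^sub>\<kappa>\<close>
  exists, and its values on \<^const>\<open>bohr\<close> are uniquely determined; values of \<^const>\<open>mdist\<close> outside
  \<^const>\<open>mspace\<close> are irrelevant throughout.
\<close>

definition is_bohr_metric ::
    "'g::topological_group_add metric \<Rightarrow> (('g \<Rightarrow> complex) \<Rightarrow> complex) metric \<Rightarrow> bool" where
  "is_bohr_metric d d\<^sub>\<kappa> \<longleftrightarrow>
     compatible_metric bohr_topology d\<^sub>\<kappa> \<and>
     (\<forall>x y. mdist d\<^sub>\<kappa> (bohr_map x) (bohr_map y) = mdist d x y)"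

definition borel_of :: "'a topology \<Rightarrow> 'a measure" where
  "borel_of T = sigma (topspace T) {U. openin T U}"

text \<open>
  Normalized Haar measure of a compact group with topology \<open>T\<close> and multiplication \<open>m\<close>. Regularity is
  not demanded: it is automatic when \<open>T\<close> is metrizable, the only case in which the notion is used.
\<close>

definition is_normalized_haar ::
    "'a topology \<Rightarrow> ('a \<Rightarrow> 'a \<Rightarrow> 'a) \<Rightarrow> 'a measure \<Rightarrow> bool" where
  "is_normalized_haar T m \<mu> \<longleftrightarrow>
     prob_space \<mu> \<and> sets \<mu> = sets (borel_of T) \<and>
     (\<forall>a\<in>topspace T. \<forall>A\<in>sets \<mu>. emeasure \<mu> (m a ` A) = emeasure \<mu> A)"


section \<open>Metric measure spaces\<close>

type_synonym 'a mm = "'a metric \<times> 'a measure"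

fun mm_space :: "'a mm \<Rightarrow> bool" where
  "mm_space (d, \<mu>) \<longleftrightarrow>
     separable_space (mtopology_of d) \<and> mcomplete_of d \<and>
     prob_space \<mu> \<and> sets \<mu> = sets (borel_of (mtopology_of d))"

text \<open>
  Only the values \<open>\<kappa> 0, \<dots>, \<kappa> m\<close> and \<open>B 0, \<dots>, B m\<close> matter. Infima and suprema are taken in
  \<open>[0,\<infinity>]\<close>; for \<open>m \<ge> 1\<close>, positive \<open>\<kappa> i\<close> and an \<open>mm\<close>-space they are finite.
\<close>

fun Sep :: "'a mm \<Rightarrow> nat \<Rightarrow> (nat \<Rightarrow> real) \<Rightarrow> ennreal" where
  "Sep (d, \<mu>) m \<kappa> =
     (SUP B \<in> {B. \<forall>i\<le>m. B i \<in> sets \<mu> \<and> measure \<mu> (B i) \<ge> \<kappa> i}.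
        Inf {ennreal (mdist d x y) |x y i j. i \<le> m \<and> j \<le> m \<and> i \<noteq> j \<and> x \<in> B i \<and> y \<in> B j})"

definition delta_dissipates :: "real \<Rightarrow> (nat \<Rightarrow> 'a mm) \<Rightarrow> bool" where
  "delta_dissipates \<delta> X \<longleftrightarrow>
     (\<forall>m \<kappa>. m \<noteq> 0 \<and> (\<forall>i\<le>m. \<kappa> i > 0) \<and> (\<Sum>i\<le>m. \<kappa> i) < 1 \<longrightarrow>
        liminf (\<lambda>n. Sep (X n) m \<kappa>) \<ge> ennreal \<delta>)"

definition dissipates :: "(nat \<Rightarrow> 'a mm) \<Rightarrow> bool" where
  "dissipates X \<longleftrightarrow> (\<forall>n. mm_space (X n)) \<and> (\<exists>\<delta>>0. delta_dissipates \<delta> X)"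

abbreviation unit_lebesgue :: "real measure" where
  "unit_lebesgue \<equiv> restrict_space lborel {0..1}"

definition me :: "(real \<Rightarrow> real) \<Rightarrow> (real \<Rightarrow> real) \<Rightarrow> real" where
  "me f g = Inf {\<epsilon>. \<epsilon> > 0 \<and> measure unit_lebesgue {t\<in>{0..1}. \<bar>f t - g t\<bar> > \<epsilon>} \<le> \<epsilon>}"

text \<open>Only used for \<open>\<rho> = me\<close>, which is bounded by \<open>1\<close>, so that the infimum is over a nonempty set.\<close>

definition hausdorff_distance :: "('a \<Rightarrow> 'a \<Rightarrow> real) \<Rightarrow> 'a set \<Rightarrow> 'a set \<Rightarrow> real" where
  "hausdorff_distance \<rho> A B =
     Inf {\<epsilon>. \<epsilon> > 0 \<and> (\<forall>a\<in>A. \<exists>b\<in>B. \<rho> a b < \<epsilon>) \<and> (\<forall>b\<in>B. \<exists>a\<in>A. \<rho> a b < \<epsilon>)}"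

fun is_parametrization :: "'a mm \<Rightarrow> (real \<Rightarrow> 'a) \<Rightarrow> bool" where
  "is_parametrization (d, \<mu>) \<phi> \<longleftrightarrow>
     \<phi> \<in> measurable unit_lebesgue \<mu> \<and> distr unit_lebesgue \<mu> \<phi> = \<mu>"

fun Lip1 :: "'a mm \<Rightarrow> ('a \<Rightarrow> real) set" where
  "Lip1 (d, \<mu>) = {f. \<forall>x\<in>mspace d. \<forall>y\<in>mspace d. \<bar>f x - f y\<bar> \<le> mdist d x y}"

definition observable_distance :: "'a mm \<Rightarrow> 'b mm \<Rightarrow> real" where
  "observable_distance X Y =
     Inf {hausdorff_distance me ((\<lambda>f. f \<circ> \<phi>) ` Lip1 X) ((\<lambda>f. f \<circ> \<psi>) ` Lip1 Y) |\<phi> \<psi>.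
            is_parametrization X \<phi> \<and> is_parametrization Y \<psi>}"

definition concentrates :: "(nat \<Rightarrow> 'a mm) \<Rightarrow> 'b mm \<Rightarrow> bool" where
  "concentrates X Y \<longleftrightarrow>
     (\<forall>n. mm_space (X n)) \<and> mm_space Y \<and>
     (\<lambda>n. observable_distance (X n) Y) \<longlonglongrightarrow> 0"

end

theory Submission
  imports Defs
begin

text \<open>
  Open subgroups \<open>H\<close> of \<open>G\<close> turn the statement into one about finite or countable partitions. The
  indicator functions of all right cosets of \<open>H\<close> form one uniformly equicontinuous family, so
  convergence to invariance yields that \<open>\<mu>\<^sub>n (- g + H + x) - \<mu>\<^sub>n (H + x)\<close> tends to \<open>0\<close>, uniformly
  in \<open>x\<close> (\<open>UEB_cosets\<close>).

  If \<open>G\<close> is not precompact, some \<open>H\<close> has infinitely many right cosets. The translates \<open>- g + H + x\<close> for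
  \<open>g\<close> in different right cosets are disjoint, and hence the masses of all cosets tend to \<open>0\<close>
  uniformly (\<open>small_cosets\<close>). Since distinct cosets have distance at least some fixed \<open>\<delta>\<close>, grouping the
  countably many cosets greedily into blocks of prescribed mass shows that the sequence
  \<open>\<delta>\<close>-dissipates (\<open>dissipates_if_not_precompact\<close>).

  If \<open>G\<close> is precompact, there are arbitrarily small open normal subgroups \<open>N\<close>, and these have finite
  index. The almost periodic functions are those which are constant on cosets of such \<open>N\<close> up to
  small errors (\<open>AP_iff\<close>). Therefore the cosets of \<open>N\<close> induce a partition of the Bohr
  compactification into clopen sets which are as small as the cosets themselves
  (\<open>bohr_coset_diam\<close>), and which all have the same Haar measure. The cosets of \<open>N\<close> in \<open>G\<close> are
  asymptotically equidistributed for \<open>\<mu>\<^sub>n\<close> (\<open>equidistributed_cosets\<close>). It remains to find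
  parametrizations that visit corresponding classes at the same time, up to a small set of times:
  then a 1-Lipschitz function on one side is matched by one on the other side that has almost the
  same values at corresponding class representatives (\<open>observable_distance_transfer\<close>). Such
  parametrizations are quantile functions: a compact zero-dimensional space embeds continuously
  into the real line, and the embedding can be chosen so that the classes come one after the other
  (\<open>exists_ordered_parametrization\<close>). As corresponding classes have almost the same measure, the
  two quantile functions change classes at almost the same times (\<open>misaligned_set_small\<close>).
\<close>

section \<open>Cosets of open subgroups\<close>

definition right_coset :: "'g::group_add set \<Rightarrow> 'g \<Rightarrow> 'g set" where
  "right_coset H x = {y. y - x \<in> H}"

lemma diff_mem_sym:
  assumes "add_subgroup H" "x - y \<in> H" shows "y - x \<in> H"
  using assms unfolding add_subgroup_def by (metis minus_diff_eq)

lemma diff_mem_trans: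
  assumes "add_subgroup H" "x - y \<in> H" "y - z \<in> H" shows "x - z \<in> H"
proof -
  have "x - z = (x - y) + (y - z)"
    by (simp add: diff_conv_add_uminus add.assoc del: add_uminus_conv_diff)
  then show ?thesis using assms unfolding add_subgroup_def by metis
qed

lemma self_mem_right_coset: "add_subgroup H \<Longrightarrow> x \<in> right_coset H x"
  by (simp add: right_coset_def add_subgroup_def)

lemma right_coset_eqI:
  assumes "add_subgroup H" "y \<in> right_coset H x" shows "right_coset H y = right_coset H x"
  using assms diff_mem_sym[OF assms(1)] diff_mem_trans[OF assms(1)]
  unfolding right_coset_def by blast

lemma right_coset_eq_iff:
  assumes "add_subgroup H" shows "right_coset H y = right_coset H x \<longleftrightarrow> y - x \<in> H"
  using right_coset_eqI[OF assms] self_mem_right_coset[OF assms]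
  by (metis mem_Collect_eq right_coset_def)

lemma right_cosets_disjoint:
  assumes "add_subgroup H" "right_coset H x \<noteq> right_coset H y"
  shows "right_coset H x \<inter> right_coset H y = {}"
  using right_coset_eqI[OF assms(1)] assms(2) by blast

lemma continuous_on_translate:
  fixes a b :: "'g::topological_group_add"
  shows "continuous_on UNIV (\<lambda>x. a + x + b)"
  by (intro continuous_on_add continuous_on_const continuous_on_id)

lemma open_right_coset:
  fixes H :: "'g::topological_group_add set"
  assumes "open H" shows "open (right_coset H x)"
proof -
  have "right_coset H x = (\<lambda>y. 0 + y + (- x)) -` H" by (auto simp: right_coset_def)
  then show ?thesis using open_vimage[OF assms continuous_on_translate] by metis
qed

lemma open_left_translate:
  fixes H :: "'g::topological_group_add set"
  assumes "open H" shows "open {y. g + y \<in> H}"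
proof -
  have "{y. g + y \<in> H} = (\<lambda>y. g + y + 0) -` H" by auto
  then show ?thesis using open_vimage[OF assms continuous_on_translate] by metis
qed

text \<open>The complement of a coset is a union of cosets, each of which is open.\<close>

lemma closed_right_coset:
  fixes H :: "'g::topological_group_add set"
  assumes "open H" "add_subgroup H" shows "closed (right_coset H x)"
proof -
  have "- right_coset H x = \<Union> (right_coset H ` (- right_coset H x))"
    using right_cosets_disjoint[OF assms(2)] self_mem_right_coset[OF assms(2)] by blast
  also have "open \<dots>" using open_right_coset[OF assms(1)] by blast
  finally show ?thesis by (simp add: closed_def)
qed

lemma eventually_right_uniformity_subgroup:
  fixes H :: "'g::topological_group_add set"
  assumes "open H" "add_subgroup H"
  shows "eventually (\<lambda>(x, y). y - x \<in> H) right_uniformity"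
proof -
  have "eventually (\<lambda>z. z \<in> H) (nhds (0::'g))"
    using assms by (intro eventually_nhds_in_open) (auto simp: add_subgroup_def)
  then show ?thesis
    unfolding right_uniformity_def eventually_filtercomap by fastforce
qed

lemma coset_indicators_RUEB:
  fixes H :: "'g::topological_group_add set"
  assumes "open H" "add_subgroup H"
  shows "range (\<lambda>z. indicator (right_coset H z)) \<in> RUEB"
proof -
  have eq: "indicator (right_coset H z) x = (indicator (right_coset H z) y :: real)"
    if "y - x \<in> H" for x y z
  proof -
    have "right_coset H y = right_coset H x" using right_coset_eq_iff[OF assms(2)] that by blast
    then have "x \<in> right_coset H z \<longleftrightarrow> y \<in> right_coset H z"
      using right_coset_eqI[OF assms(2)] self_mem_right_coset[OF assms(2)] by blast
    then show ?thesis by (simp add: indicator_def)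
  qed
  have ev: "eventually (\<lambda>(x, y). \<forall>z. indicator (right_coset H z) x = (indicator (right_coset H z) y :: real))
      right_uniformity"
    by (rule eventually_mono[OF eventually_right_uniformity_subgroup[OF assms]]) (auto intro: eq)
  have uc: "right_uniformly_continuous (indicator (right_coset H z) :: _ \<Rightarrow> real)" for z
    unfolding right_uniformly_continuous_def filterlim_iff
  proof (intro allI impI)
    fix P :: "real \<times> real \<Rightarrow> bool" assume P: "eventually P uniformity"
    show "eventually (\<lambda>x. P (case x of (x, y) \<Rightarrow> (indicator (right_coset H z) x, indicator (right_coset H z) y)))
        right_uniformity"
      by (rule eventually_mono[OF ev]) (use P eventually_uniformity_metric uniformity_refl in force)
  qed
  show ?thesis
    unfolding RUEB_def mem_Collect_eq
  proof (intro conjI ballI allI impI)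
    fix f :: "'g \<Rightarrow> real" assume "f \<in> range (\<lambda>z. indicator (right_coset H z))"
    then show "bounded (range f)" "right_uniformly_continuous f"
      using uc by (auto intro!: boundedI[of _ 1] simp: indicator_def)
  next
    show "\<exists>C. \<forall>f\<in>range (\<lambda>z. indicator (right_coset H z)). \<forall>x. \<bar>f x :: real\<bar> \<le> C"
      by (auto intro!: exI[of _ 1] simp: indicator_def)
  next
    fix e :: real assume "e > 0"
    then show "eventually (\<lambda>(x, y). \<forall>f\<in>range (\<lambda>z. indicator (right_coset H z)). \<bar>f x - f y :: real\<bar> \<le> e) right_uniformity"
      by (intro eventually_mono[OF ev]) auto
  qed
qed

text \<open>
  The estimate is uniform in \<open>x\<close> because the indicator functions of all right cosets form a single
  uniformly equicontinuous family.
\<close>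

lemma UEB_cosets:
  fixes H :: "'g::topological_group_add set" and \<mu> :: "nat \<Rightarrow> 'g measure"
  assumes H: "open H" "add_subgroup H"
    and \<mu>: "\<And>n. borel_probability (\<mu> n)"
    and UEB: "UEB_converges_to_invariance \<mu> sequentially"
    and "\<eta> > 0"
  shows "\<forall>\<^sub>F n in sequentially. \<forall>x.
    \<bar>measure (\<mu> n) {y. g + y \<in> right_coset H x} - measure (\<mu> n) (right_coset H x)\<bar> < \<eta>"
proof -
  let ?F = "range (\<lambda>z. indicator (right_coset H z)) :: ('g \<Rightarrow> real) set"
  have "((\<lambda>n. SUP f\<in>?F. ennreal \<bar>(\<integral>x. f (g + x) \<partial>\<mu> n) - (\<integral>x. f x \<partial>\<mu> n)\<bar>) \<longlongrightarrow> 0) sequentially"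
    using UEB coset_indicators_RUEB[OF H] unfolding UEB_converges_to_invariance_def by blast
  then have "\<forall>\<^sub>F n in sequentially. (SUP f\<in>?F. ennreal \<bar>(\<integral>x. f (g + x) \<partial>\<mu> n) - (\<integral>x. f x \<partial>\<mu> n)\<bar>) < ennreal \<eta>"
    by (rule order_tendstoD) (use \<open>\<eta> > 0\<close> in simp)
  then show ?thesis
  proof eventually_elim
    case (elim n)
    have sp: "space (\<mu> n) = UNIV" and st: "sets (\<mu> n) = sets borel"
      using \<mu>[of n] sets_eq_imp_space_eq[of "\<mu> n" borel] by (auto simp: borel_probability_def)
    show ?case
    proof
      fix x
      let ?i = "indicator (right_coset H x) :: 'g \<Rightarrow> real"
      have 1: "(\<integral>y. ?i y \<partial>\<mu> n) = measure (\<mu> n) (right_coset H x)"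
        by (simp add: sp)
      have "(\<lambda>y. ?i (g + y)) = indicator {y. g + y \<in> right_coset H x}"
        by (auto simp: indicator_def)
      then have 2: "(\<integral>y. ?i (g + y) \<partial>\<mu> n) = measure (\<mu> n) {y. g + y \<in> right_coset H x}"
        by (simp add: sp)
      have "ennreal \<bar>(\<integral>y. ?i (g + y) \<partial>\<mu> n) - (\<integral>y. ?i y \<partial>\<mu> n)\<bar>
          \<le> (SUP f\<in>?F. ennreal \<bar>(\<integral>x. f (g + x) \<partial>\<mu> n) - (\<integral>x. f x \<partial>\<mu> n)\<bar>)"
        by (rule SUP_upper) blast
      also note elim
      finally show "\<bar>measure (\<mu> n) {y. g + y \<in> right_coset H x} - measure (\<mu> n) (right_coset H x)\<bar> < \<eta>"
        unfolding 1 2 by (simp add: ennreal_less_iff)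
    qed
  qed
qed

section \<open>Metric measure spaces\<close>

lemma sets_borel_of: "sets (borel_of T) = sigma_sets (topspace T) {U. openin T U}"
  unfolding borel_of_def by (rule sets_measure_of) (use openin_subset in blast)

lemma space_borel_of [simp]: "space (borel_of T) = topspace T"
  by (simp add: borel_of_def openin_subset subset_iff space_measure_of_conv)

lemma sets_restrict_space_borel:
  assumes "K \<in> sets borel"
  shows "sets (restrict_space borel K) = sets (borel_of (subtopology euclidean K))"
proof -
  have "sets (restrict_space borel K) = sigma_sets K ((\<lambda>A. K \<inter> A) ` {S. open S})"
    using assms unfolding sets_restrict_space borel_def by (simp add: sigma_sets_Int)
  also have "((\<lambda>A. K \<inter> A) ` {S. open S}) = {U. openin (subtopology euclidean K) U}"
    by (auto simp: openin_open)
  finally show ?thesis by (simp add: sets_borel_of)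
qed

text \<open>
  By second countability the complement of the support is a union of countably many null sets.
\<close>

lemma borel_probability_spt:
  fixes \<mu> :: "'a::second_countable_topology measure"
  assumes "borel_probability \<mu>"
  shows "spt \<mu> \<in> sets \<mu>" "emeasure \<mu> (spt \<mu>) = 1"
proof -
  interpret prob_space \<mu> using assms by (simp add: borel_probability_def)
  have st: "sets \<mu> = sets borel" and sp: "space \<mu> = UNIV"
    using assms sets_eq_imp_space_eq[of \<mu> borel] by (auto simp: borel_probability_def)
  obtain B :: "'a set set" where B: "countable B" "topological_basis B"
    using ex_countable_basis by blast
  define N where "N = {U\<in>B. emeasure \<mu> U = 0}"
  have c: "- spt \<mu> = \<Union>N"
  proof (intro set_eqI iffI)
    fix x assume "x \<in> - spt \<mu>"
    then obtain U where "open U" "x \<in> U" "emeasure \<mu> U = 0"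
      by (auto simp: spt_def)
    moreover obtain V where V: "V \<in> B" "x \<in> V" "V \<subseteq> U"
      using \<open>open U\<close> \<open>x \<in> U\<close> topological_basisE[OF B(2)] by metis
    moreover have "emeasure \<mu> V \<le> emeasure \<mu> U"
      by (intro emeasure_mono V) (simp add: st \<open>open U\<close>)
    ultimately show "x \<in> \<Union>N" by (auto simp: N_def)
  next
    fix x assume "x \<in> \<Union>N"
    then show "x \<in> - spt \<mu>"
      using topological_basis_open[OF B(2)] by (fastforce simp: N_def spt_def)
  qed
  have "open (\<Union>N)" using topological_basis_open[OF B(2)] by (auto simp: N_def)
  then have "closed (spt \<mu>)" using c by (metis closed_def)
  then show m: "spt \<mu> \<in> sets \<mu>" by (simp add: st)
  have "(\<Union>V\<in>N. V) \<in> null_sets \<mu>"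
    by (rule null_sets_UN') (use B topological_basis_open[OF B(2)] in \<open>auto simp: N_def st null_sets_def\<close>)
  then have "emeasure \<mu> (space \<mu> - spt \<mu>) = 0" by (auto simp: sp c simp flip: Compl_eq_Diff_UNIV)
  then show "emeasure \<mu> (spt \<mu>) = 1"
    using m prob_compl[of "spt \<mu>"] by (auto simp: emeasure_eq_measure)
qed

lemma measure_restrict_spt:
  fixes \<nu> :: "'a::second_countable_topology measure"
  assumes "borel_probability \<nu>" "A \<in> sets \<nu>"
  shows "A \<inter> spt \<nu> \<in> sets (restrict_space \<nu> (spt \<nu>))"
    and "measure (restrict_space \<nu> (spt \<nu>)) (A \<inter> spt \<nu>) = measure \<nu> A"
proof -
  interpret prob_space \<nu> using assms(1) by (simp add: borel_probability_def)
  have sp: "space \<nu> = UNIV"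
    using assms(1) sets_eq_imp_space_eq[of \<nu> borel] by (auto simp: borel_probability_def)
  have K: "spt \<nu> \<in> events" "prob (spt \<nu>) = 1"
    using borel_probability_spt[OF assms(1)] by (auto simp: measure_def)
  show "A \<inter> spt \<nu> \<in> sets (restrict_space \<nu> (spt \<nu>))"
    by (subst sets_restrict_space) (use assms(2) in blast)
  have "measure (restrict_space \<nu> (spt \<nu>)) (A \<inter> spt \<nu>) = prob (A \<inter> spt \<nu>)"
    using K by (intro measure_restrict_space) (auto simp: sp)
  also have "\<dots> = prob A"
  proof (rule finite_measure_eq_AE)
    show "AE x in \<nu>. x \<in> A \<inter> spt \<nu> \<longleftrightarrow> x \<in> A"
      using AE_prob_1[OF K(2)] by eventually_elim auto
  qed (use K assms(2) in auto)
  finally show "measure (restrict_space \<nu> (spt \<nu>)) (A \<inter> spt \<nu>) = measure \<nu> A" .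
qed

lemma mspace_eq_UNIV: "compatible_metric euclidean d \<Longrightarrow> mspace d = UNIV"
  by (metis compatible_metric_def topspace_euclidean topspace_mtopology_of)

lemma mm_space_support:
  fixes \<mu> :: "'a::{second_countable_topology} measure"
  assumes "borel_probability \<mu>" "compact (spt \<mu>)" "compatible_metric euclidean d"
  shows "mm_space (submetric d (spt \<mu>), restrict_space \<mu> (spt \<mu>))"
proof -
  let ?K = "spt \<mu>"
  interpret D: Metric_space "mspace d" "mdist d" by simp
  have top: "mtopology_of (submetric d ?K) = subtopology euclidean ?K"
    using assms(3) by (simp add: mtopology_of_submetric compatible_metric_def)
  have st: "sets \<mu> = sets borel" and sp: "space \<mu> = UNIV"
    using assms sets_eq_imp_space_eq[of \<mu> borel] by (auto simp: borel_probability_def)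
  obtain B :: "'a set set" where B: "countable B" "topological_basis B"
    using ex_countable_basis by blast
  have "second_countable (euclidean :: 'a topology)"
    unfolding second_countable_def
    using B topological_basis_open[OF B(2)] topological_basisE[OF B(2)]
    by (metis open_openin)
  then have "second_countable (subtopology (euclidean :: 'a topology) ?K)"
    by (rule second_countable_subtopology)
  then have 1: "separable_space (subtopology euclidean ?K)"
    by (rule second_countable_imp_separable_space)
  have 2: "mcomplete_of (submetric d ?K)"
  proof -
    interpret S: Metric_space "mspace (submetric d ?K)" "mdist (submetric d ?K)" by (rule Metric_space_mspace_mdist)
    have "compact_space S.mtopology"
      using top assms(2) by (simp add: mtopology_of_def compact_space_subtopology)
    then show ?thesis unfolding mcomplete_of_def by (rule S.compact_space_imp_mcomplete)
  qed
  have 3: "prob_space (restrict_space \<mu> ?K)"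
    using borel_probability_spt[OF assms(1)]
    by (intro prob_space_restrict_space) (auto simp: sp)
  have 4: "sets (restrict_space \<mu> ?K) = sets (borel_of (subtopology euclidean ?K))"
    using sets_restrict_space_borel[of ?K] borel_probability_spt(1)[OF assms(1)]
    by (simp add: sets_restrict_space st)
  show ?thesis using 1 2 3 4 by (simp add: top)
qed

section \<open>Dissipation\<close>

text \<open>
  Greedy splitting: if no \<open>p k\<close> exceeds \<open>\<eta>\<close>, then stopping as soon as the partial sums reach a given
  level overshoots that level by at most \<open>\<eta>\<close>. The \<open>i\<close>-th level reserves \<open>\<kappa> j + \<eta>\<close> for each earlier
  block \<open>j < i\<close>.
\<close>

lemma split_nat_blocks:
  fixes p \<kappa> :: "nat \<Rightarrow> real"
  assumes p: "\<And>k. 0 \<le> p k" "\<And>k. p k \<le> \<eta>" "p sums 1"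
    and \<kappa>: "\<And>i. i \<le> m \<Longrightarrow> 0 \<le> \<kappa> i" and less: "(\<Sum>i\<le>m. \<kappa> i + \<eta>) < 1"
  obtains L :: "nat \<Rightarrow> nat" where
    "\<And>i. i \<le> m \<Longrightarrow> L i \<le> L (Suc i)" "\<And>i. i \<le> m \<Longrightarrow> \<kappa> i \<le> (\<Sum>k=L i..<L (Suc i). p k)"
proof -
  define F where "F N = (\<Sum>k<N. p k)" for N
  define s where "s i = (\<Sum>j<i. \<kappa> j + \<eta>)" for i
  define L where "L i = (LEAST N. s i \<le> F N)" for i
  have "0 \<le> \<eta>" using p order_trans by blast
  have s_mono: "s i \<le> s (Suc i)" if "i \<le> m" for i
    using \<kappa>[OF that] \<open>0 \<le> \<eta>\<close> by (simp add: s_def)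
  have s_less: "s i < 1" if "i \<le> Suc m" for i
  proof -
    have "s i \<le> s (Suc m)" unfolding s_def
      by (rule sum_mono2) (use that \<kappa> \<open>0 \<le> \<eta>\<close> in auto)
    also have "\<dots> < 1" using less by (simp add: s_def lessThan_Suc_atMost)
    finally show ?thesis .
  qed
  have "F \<longlonglongrightarrow> 1" using p(3) by (simp add: sums_def F_def[abs_def])
  have ex: "\<exists>N. s i \<le> F N" if "i \<le> Suc m" for i
    using order_tendstoD(1)[OF \<open>F \<longlonglongrightarrow> 1\<close> s_less[OF that]] by (auto simp: eventually_sequentially intro: less_imp_le)
  have lower: "s i \<le> F (L i)" if "i \<le> Suc m" for i
    unfolding L_def using ex[OF that] by (rule LeastI_ex)
  have upper: "F (L i) \<le> s i + \<eta>" if "i \<le> Suc m" for i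
  proof (cases "L i")
    case 0
    have "0 \<le> s i" unfolding s_def using that \<kappa> \<open>0 \<le> \<eta>\<close> by (intro sum_nonneg) auto
    then show ?thesis using 0 \<open>0 \<le> \<eta>\<close> by (simp add: F_def)
  next
    case (Suc N)
    then have "\<not> s i \<le> F N" unfolding L_def using not_less_Least by (metis lessI)
    then show ?thesis using Suc p(2)[of N] by (simp add: F_def)
  qed
  have L_mono: "L i \<le> L (Suc i)" if "i \<le> m" for i
    unfolding L_def[of i] by (rule Least_le) (use lower[of "Suc i"] s_mono[OF that] that in auto)
  show ?thesis
  proof (rule that)
    show "L i \<le> L (Suc i)" if "i \<le> m" for i using L_mono[OF that] .
    fix i assume i: "i \<le> m"
    have "(\<Sum>k=L i..<L (Suc i). p k) = F (L (Suc i)) - F (L i)"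
      using sum_diff_nat_ivl[of 0 "L i" "L (Suc i)" p] L_mono[OF i] by (simp add: F_def lessThan_atLeast0)
    also have "\<dots> \<ge> s (Suc i) - (s i + \<eta>)" using lower[of "Suc i"] upper[of i] i by simp
    finally show "\<kappa> i \<le> (\<Sum>k=L i..<L (Suc i). p k)" by (simp add: s_def)
  qed
qed

lemma exists_infinite_index_subgroup:
  assumes "non_archimedean TYPE('g::topological_group_add)" "\<not> precompact TYPE('g::topological_group_add)"
  obtains H :: "'g::topological_group_add set" where "open H" "add_subgroup H" "infinite (range (right_coset H))"
proof -
  obtain U :: "'g set" where U: "0 \<in> interior U" "\<And>F. finite F \<Longrightarrow> UNIV \<noteq> {u + x |u x. u \<in> U \<and> x \<in> F}"
    using assms(2) unfolding precompact_def by blast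
  obtain H where H: "open H" "add_subgroup H" "H \<subseteq> U"
    using assms(1) U(1) unfolding non_archimedean_def by blast
  have "infinite (range (right_coset H))"
  proof
    assume "finite (range (right_coset H))"
    then obtain F where F: "finite F" "range (right_coset H) = right_coset H ` F"
      using finite_subset_image[of "range (right_coset H)" "right_coset H" UNIV] by auto
    have "z \<in> {u + x |u x. u \<in> U \<and> x \<in> F}" for z
    proof -
      obtain x where "x \<in> F" "right_coset H z = right_coset H x"
        using F(2) by (metis imageE rangeI)
      then have "z - x \<in> U" using right_coset_eq_iff[OF H(2)] H(3) by blast
      moreover have "z = (z - x) + x" by simp
      ultimately show ?thesis using \<open>x \<in> F\<close> by blast
    qed
    then have "UNIV = {u + x |u x. u \<in> U \<and> x \<in> F}" by (intro equalityI subsetI UNIV_I)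
    with U(2)[OF F(1)] show False by (rule notE)
  qed
  then show ?thesis by (rule that[OF H(1,2)])
qed

text \<open>
  The sets \<open>{y. g + y \<in> right_coset H x}\<close> are disjoint when \<open>g\<close> runs through different right cosets,
  whatever \<open>x\<close> is, and each has almost the mass of \<open>right_coset H x\<close>. So \<open>N\<close> of them fit into total
  mass \<open>1\<close> only if the coset has mass at most about \<open>1 / N\<close>.
\<close>

lemma small_cosets:
  fixes H :: "'g::topological_group_add set" and \<mu> :: "nat \<Rightarrow> 'g measure"
  assumes H: "open H" "add_subgroup H" "infinite (range (right_coset H))"
    and \<mu>: "\<And>n. borel_probability (\<mu> n)"
    and UEB: "UEB_converges_to_invariance \<mu> sequentially"
    and "\<eta> > 0"
  shows "\<forall>\<^sub>F n in sequentially. \<forall>x. measure (\<mu> n) (right_coset H x) \<le> \<eta>"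
proof -
  obtain k where "inverse (real (Suc k)) < \<eta> / 2"
    using \<open>\<eta> > 0\<close> reals_Archimedean[of "\<eta> / 2"] by auto
  then obtain N :: nat where N: "N > 0" "1 / real N < \<eta> / 2"
    by (metis inverse_eq_divide zero_less_Suc)
  obtain S where S: "finite S" "card S = N" "S \<subseteq> range (right_coset H)"
    using infinite_arbitrarily_large[OF H(3)] by blast
  obtain G where G: "G \<subseteq> UNIV" "inj_on (right_coset H) G" "S = right_coset H ` G"
    using subset_image_inj[THEN iffD1, OF S(3)] by blast
  have fin: "finite G" "card G = N" using S G by (auto simp: card_image finite_image_iff)
  have "\<forall>\<^sub>F n in sequentially. \<forall>g\<in>G. \<forall>x.
    \<bar>measure (\<mu> n) {y. g + y \<in> right_coset H x} - measure (\<mu> n) (right_coset H x)\<bar> < \<eta> / 2"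
    by (intro eventually_ball_finite fin ballI UEB_cosets[OF H(1,2) \<mu> UEB]) (use \<open>\<eta> > 0\<close> in simp)
  then show ?thesis
  proof eventually_elim
    case (elim n)
    interpret prob_space "\<mu> n" using \<mu> by (simp add: borel_probability_def)
    have st: "sets (\<mu> n) = sets borel" using \<mu> by (simp add: borel_probability_def)
    show ?case
    proof
      fix x
      let ?A = "\<lambda>g. {y. g + y \<in> right_coset H x}"
      have disj: "disjoint_family_on ?A G"
      proof (unfold disjoint_family_on_def, intro ballI impI)
        fix g h assume gh: "g \<in> G" "h \<in> G" "g \<noteq> h"
        have False if "g + y - x \<in> H" "h + y - x \<in> H" for y
        proof -
          have "(g + y - x) - (h + y - x) = g - h"
            by (simp add: diff_conv_add_uminus add.assoc minus_add del: add_uminus_conv_diff)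
          then have "g - h \<in> H"
            using diff_mem_trans[OF H(2), of "g + y - x" 0 "h + y - x"] diff_mem_sym[OF H(2), of "h + y - x" 0] that
            by simp
          then have "right_coset H g = right_coset H h" using right_coset_eq_iff[OF H(2)] by blast
          then show False using gh G(2) by (auto dest: inj_onD)
        qed
        then show "?A g \<inter> ?A h = {}" by (auto simp: right_coset_def)
      qed
      have "(\<Sum>g\<in>G. measure (\<mu> n) (right_coset H x) - \<eta> / 2) \<le> (\<Sum>g\<in>G. measure (\<mu> n) (?A g))"
      proof (rule sum_mono)
        fix g assume "g \<in> G"
        then have "\<bar>measure (\<mu> n) (?A g) - measure (\<mu> n) (right_coset H x)\<bar> < \<eta> / 2"
          using elim by blast
        then show "measure (\<mu> n) (right_coset H x) - \<eta> / 2 \<le> measure (\<mu> n) (?A g)" by linarith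
      qed
      also have "\<dots> = measure (\<mu> n) (\<Union>g\<in>G. ?A g)"
        by (rule finite_measure_finite_Union[symmetric, OF fin(1) _ disj])
          (use open_left_translate[OF open_right_coset[OF H(1)]] in \<open>auto simp: st\<close>)
      also have "\<dots> \<le> 1" by (rule prob_le_1)
      finally have "real N * (measure (\<mu> n) (right_coset H x) - \<eta> / 2) \<le> 1" by (simp add: fin)
      then have "measure (\<mu> n) (right_coset H x) - \<eta> / 2 \<le> 1 / real N"
        using N(1) by (simp add: field_simps)
      then show "measure (\<mu> n) (right_coset H x) \<le> \<eta>" using N(2) by linarith
    qed
  qed
qed

lemma exists_mball_subset:
  assumes "compatible_metric euclidean d" "open U" "x \<in> U"
  obtains r where "r > 0" "\<And>y. mdist d x y < r \<Longrightarrow> y \<in> U"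
proof -
  interpret D: Metric_space "mspace d" "mdist d" by (rule Metric_space_mspace_mdist)
  have "openin (mtopology_of d) U" using assms by (simp add: compatible_metric_def)
  then obtain r where r: "r > 0" "D.mball x r \<subseteq> U"
    using assms(3) unfolding mtopology_of_def D.openin_mtopology by blast
  show ?thesis
  proof (rule that[OF r(1)])
    fix y assume "mdist d x y < r"
    moreover have "x \<in> mspace d" "y \<in> mspace d" using mspace_eq_UNIV[OF assms(1)] by auto
    ultimately have "y \<in> D.mball x r" by (simp only: D.in_mball)
    then show "y \<in> U" using r(2) by blast
  qed
qed

lemma mdist_right_invariant:
  assumes "right_invariant d" shows "mdist d x y = mdist d 0 (y - x)"
  using assms unfolding right_invariant_def
  by (metis add_diff_cancel diff_conv_add_uminus right_minus)

theorem dissipates_if_not_precompact: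
  fixes d :: "'g::{topological_group_add, t2_space, second_countable_topology} metric"
    and \<mu> :: "nat \<Rightarrow> 'g measure"
  assumes nonarch: "non_archimedean TYPE('g)" and npc: "\<not> precompact TYPE('g)"
    and d_compatible: "compatible_metric euclidean d"
    and d_invariant: "right_invariant d"
    and \<mu>: "\<And>n. borel_probability (\<mu> n)"
    and compact: "\<And>n. compact (spt (\<mu> n))"
    and UEB: "UEB_converges_to_invariance \<mu> sequentially"
  shows "dissipates (\<lambda>n. (submetric d (spt (\<mu> n)), restrict_space (\<mu> n) (spt (\<mu> n))))"
proof -
  obtain H :: "'g set" where H: "open H" "add_subgroup H" "infinite (range (right_coset H))"
    using exists_infinite_index_subgroup[OF nonarch npc] .
  have "0 \<in> H" using H(2) by (simp add: add_subgroup_def)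
  then obtain \<delta> where \<delta>: "\<delta> > 0" "\<And>y. mdist d 0 y < \<delta> \<Longrightarrow> y \<in> H"
    using exists_mball_subset[OF d_compatible H(1)] by blast
  have far: "\<delta> \<le> mdist d x y" if "right_coset H x \<noteq> right_coset H y" for x y
    using \<delta>(2)[of "y - x"] mdist_right_invariant[OF d_invariant] that right_coset_eq_iff[OF H(2)]
    by (metis not_le)
  define C where "C = from_nat_into (range (right_coset H))"
  have "countable (range (right_coset H))"
    using open_right_coset[OF H(1)] right_cosets_disjoint[OF H(2)]
    by (intro countable_disjoint_open_subsets) (auto simp: pairwise_def disjnt_def)
  then have C: "bij_betw C UNIV (range (right_coset H))"
    unfolding C_def using H(3) by (rule bij_betw_from_nat_into)
  then have C_coset: "\<exists>x. C k = right_coset H x" for k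
    by (metis bij_betw_def rangeI rangeE)
  have C_open: "open (C k)" for k
    using C_coset open_right_coset[OF H(1)] by metis
  have C_disj: "disjoint_family C"
  proof (unfold disjoint_family_on_def, intro ballI impI)
    fix i j :: nat assume "i \<noteq> j"
    then have "C i \<noteq> C j" using C by (auto simp: bij_betw_def dest: injD)
    then show "C i \<inter> C j = {}" using C_coset right_cosets_disjoint[OF H(2)] by metis
  qed
  have C_UN: "(\<Union>k. C k) = UNIV"
    using C self_mem_right_coset[OF H(2)] unfolding bij_betw_def by blast
  have C_far: "\<delta> \<le> mdist d x y" if "x \<in> C k" "y \<in> C l" "k \<noteq> l" for x y k l
  proof (rule far)
    have "C k \<noteq> C l" using C that(3) by (auto simp: bij_betw_def dest: injD)
    then show "right_coset H x \<noteq> right_coset H y"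
      using C_coset[of k] C_coset[of l] that right_coset_eqI[OF H(2)] by metis
  qed
  show ?thesis
    unfolding dissipates_def delta_dissipates_def
  proof (intro conjI allI impI exI[of _ \<delta>])
    show "mm_space (submetric d (spt (\<mu> n)), restrict_space (\<mu> n) (spt (\<mu> n)))" for n
      using mm_space_support[OF \<mu> compact d_compatible] .
    show "0 < \<delta>" by fact
    fix m :: nat and \<kappa> assume asm: "m \<noteq> 0 \<and> (\<forall>i\<le>m. 0 < \<kappa> i) \<and> sum \<kappa> {..m} < (1::real)"
    \<comment> \<open>The slack \<open>1 - \<Sum>\<kappa>\<close> pays for one overshoot \<open>\<eta>\<close> in each of the \<open>m + 1\<close> blocks, and half of it
      is left over.\<close>
    define \<eta> where "\<eta> = (1 - sum \<kappa> {..m}) / (2 * (real m + 1))"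
    have "\<eta> > 0" using asm by (auto simp: \<eta>_def)
    have "(\<Sum>i\<le>m. \<kappa> i + \<eta>) = sum \<kappa> {..m} + (real m + 1) * \<eta>" by (simp add: sum.distrib algebra_simps)
    also have "(real m + 1) * \<eta> = (1 - sum \<kappa> {..m}) / 2"
      using of_nat_0_le_iff[of m, where ?'a = real] unfolding \<eta>_def by (simp add: divide_simps)
    finally have less: "(\<Sum>i\<le>m. \<kappa> i + \<eta>) < 1" using asm by (auto simp: field_simps)
    have "\<forall>\<^sub>F n in sequentially. ennreal \<delta> \<le> Sep (submetric d (spt (\<mu> n)), restrict_space (\<mu> n) (spt (\<mu> n))) m \<kappa>"
      using small_cosets[OF H \<mu> UEB \<open>\<eta> > 0\<close>]
    proof eventually_elim
      case (elim n)
      interpret prob_space "\<mu> n" using \<mu> by (simp add: borel_probability_def)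
      have st: "sets (\<mu> n) = sets borel" and sp: "space (\<mu> n) = UNIV"
        using \<mu>[of n] sets_eq_imp_space_eq[of "\<mu> n" borel] by (auto simp: borel_probability_def)
      let ?K = "spt (\<mu> n)"
      define p where "p k = prob (C k)" for k
      have "p sums prob (\<Union>k. C k)"
        unfolding p_def by (rule finite_measure_UNION) (use C_open C_disj in \<open>auto simp: st\<close>)
      then have p1: "p sums 1" using prob_space by (simp add: C_UN sp)
      have p2: "p k \<le> \<eta>" for k using elim C_coset[of k] by (auto simp: p_def)
      obtain L where L: "\<And>i. i \<le> m \<Longrightarrow> L i \<le> L (Suc i)" "\<And>i. i \<le> m \<Longrightarrow> \<kappa> i \<le> (\<Sum>k=L i..<L (Suc i). p k)"
        using split_nat_blocks[of p \<eta> m \<kappa>] p1 p2 less asm by (auto simp: p_def less_imp_le)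
      have L_mono: "L i \<le> L j" if "i \<le> j" "j \<le> Suc m" for i j
        using that
      proof (induction rule: dec_induct)
        case (step k)
        then show ?case using L(1)[of k] by simp
      qed simp
      define A where "A i = (\<Union>k\<in>{L i..<L (Suc i)}. C k)" for i
      have A_meas: "A i \<in> events" for i using C_open by (auto simp: A_def st)
      have A_prob: "\<kappa> i \<le> prob (A i)" if "i \<le> m" for i
      proof -
        have "prob (A i) = (\<Sum>k=L i..<L (Suc i). p k)"
          unfolding A_def p_def
        proof (rule finite_measure_finite_Union)
          show "C ` {L i..<L (Suc i)} \<subseteq> events" using C_open by (auto simp: st)
          show "disjoint_family_on C {L i..<L (Suc i)}" by (rule disjoint_family_on_mono[OF _ C_disj]) simp
        qed simp
        then show ?thesis using L(2)[OF that] by simp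
      qed
      have A_far: "\<delta> \<le> mdist d x y" if "x \<in> A i" "y \<in> A j" "i \<le> m" "j \<le> m" "i < j" for x y i j
      proof -
        obtain k l where "k < L (Suc i)" "x \<in> C k" "L j \<le> l" "y \<in> C l"
          using \<open>x \<in> A i\<close> \<open>y \<in> A j\<close> by (auto simp: A_def)
        then show ?thesis using L_mono[of "Suc i" j] that by (intro C_far) auto
      qed
      define B where "B i = A i \<inter> ?K" for i
      have B_meas: "B i \<in> sets (restrict_space (\<mu> n) ?K)" for i
        unfolding B_def by (rule measure_restrict_spt(1)[OF \<mu> A_meas])
      have B_prob: "\<kappa> i \<le> measure (restrict_space (\<mu> n) ?K) (B i)" if "i \<le> m" for i
        unfolding B_def measure_restrict_spt(2)[OF \<mu> A_meas] by (rule A_prob[OF that])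
      have "ennreal \<delta> \<le> Inf {ennreal (mdist (submetric d ?K) x y) |x y i j.
          i \<le> m \<and> j \<le> m \<and> i \<noteq> j \<and> x \<in> B i \<and> y \<in> B j}"
      proof (rule Inf_greatest, safe)
        fix x y i j assume ij: "i \<le> m" "j \<le> m" "i \<noteq> j" "x \<in> B i" "y \<in> B j"
        have "\<delta> \<le> mdist d x y"
          using A_far[of x i y j] A_far[of y j x i] ij by (cases "i < j") (auto simp: B_def mdist_commute)
        then show "ennreal \<delta> \<le> ennreal (mdist (submetric d ?K) x y)"
          by (simp add: ennreal_leI)
      qed
      also have "\<dots> \<le> Sep (submetric d ?K, restrict_space (\<mu> n) ?K) m \<kappa>"
        unfolding Sep.simps by (rule SUP_upper) (simp add: B_meas B_prob)
      finally show ?case .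
    qed
    then show "ennreal \<delta> \<le> liminf (\<lambda>n. Sep (submetric d (spt (\<mu> n)), restrict_space (\<mu> n) (spt (\<mu> n))) m \<kappa>)"
      by (rule Liminf_bounded)
  qed
qed

section \<open>Precompact non-archimedean groups\<close>

definition open_normal_subgroup :: "'g::topological_group_add set \<Rightarrow> bool" where
  "open_normal_subgroup N \<longleftrightarrow> open N \<and> add_subgroup N \<and> (\<forall>x\<in>N. \<forall>g. g + x - g \<in> N)"

lemma open_normal_subgroup_Int:
  "open_normal_subgroup N \<Longrightarrow> open_normal_subgroup M \<Longrightarrow> open_normal_subgroup (N \<inter> M)"
  by (auto simp: open_normal_subgroup_def add_subgroup_def)

lemma left_translate_diff: "(g + y) - (g + x) = g + (y - x) - g" for g :: "'g::group_add"
  by (simp add: diff_conv_add_uminus add.assoc minus_add del: add_uminus_conv_diff)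

lemma cancel_right_diff: "(y + z) - (x + z) = y - x" for z :: "'g::group_add"
  by (simp add: diff_conv_add_uminus add.assoc minus_add del: add_uminus_conv_diff)

locale precompact_group =
  fixes d :: "'g::{topological_group_add, t2_space, second_countable_topology} metric"
  assumes nonarch: "non_archimedean TYPE('g)"
    and precompact: "precompact TYPE('g)"
    and d_compatible: "compatible_metric euclidean d"
    and d_invariant: "right_invariant d"
begin

lemma finite_cosets:
  fixes H :: "'g set"
  assumes "open H" "add_subgroup H"
  obtains F where "finite F" "\<forall>z. \<exists>x\<in>F. z - x \<in> H"
proof -
  have "0 \<in> interior H" using assms by (simp add: interior_open add_subgroup_def)
  then obtain F where F: "finite F" "UNIV = {u + x |u x. u \<in> H \<and> x \<in> F}"
    using precompact unfolding precompact_def by blast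
  have "\<exists>x\<in>F. z - x \<in> H" for z
  proof -
    have "z \<in> {u + x |u x. u \<in> H \<and> x \<in> F}" using F(2) by blast
    then obtain u x where "u \<in> H" "x \<in> F" "z = u + x" by blast
    then show ?thesis by (intro bexI[of _ x]) simp_all
  qed
  then show ?thesis using F(1) by (intro that[of F] allI)
qed

text \<open>
  The normal core of an open subgroup \<open>H\<close> is open, since the conjugate of \<open>H\<close> by \<open>g\<close> depends only on
  the coset of \<open>g\<close>: it is an intersection of finitely many open subgroups.
\<close>

lemma exists_open_normal_subgroup:
  fixes U :: "'g set"
  assumes "open U" "0 \<in> U"
  obtains N where "open_normal_subgroup N" "N \<subseteq> U"
proof -
  obtain H where H: "open H" "add_subgroup H" "H \<subseteq> U"
    using nonarch assms unfolding non_archimedean_def by (metis interior_open)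
  obtain F where F: "finite F" "\<forall>z. \<exists>x\<in>F. z - x \<in> H" by (rule finite_cosets[OF H(1,2)])
  define N where "N = {x. \<forall>g. g + x - g \<in> H}"
  have "N = (\<Inter>f\<in>F. {x. f + x - f \<in> H})"
  proof (intro equalityI subsetI)
    fix x assume x: "x \<in> (\<Inter>f\<in>F. {x. f + x - f \<in> H})"
    have "g + x - g \<in> H" for g
    proof -
      obtain f where f: "f \<in> F" "g - f \<in> H" using F(2) by blast
      have eq: "g + x - g = (g - f) + (f + x - f) + (- (g - f))"
        by (simp add: diff_conv_add_uminus add.assoc minus_add del: add_uminus_conv_diff)
      show ?thesis unfolding eq using f x H(2) unfolding add_subgroup_def by blast
    qed
    then show "x \<in> N" by (simp add: N_def)
  qed (auto simp: N_def)
  moreover have "open {x. f + x - f \<in> H}" for f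
  proof -
    have "{x. f + x - f \<in> H} = (\<lambda>x. f + x + (- f)) -` H" by auto
    then show ?thesis using open_vimage[OF H(1) continuous_on_translate] by metis
  qed
  ultimately have "open N" using F(1) by auto
  moreover have "add_subgroup N"
    unfolding add_subgroup_def N_def
  proof (intro conjI ballI CollectI allI)
    show "g + 0 - g \<in> H" for g using H(2) by (simp add: add_subgroup_def)
    fix x g assume x: "x \<in> {x. \<forall>g. g + x - g \<in> H}"
    have inv: "g + - x - g = - (g + x - g)"
      by (simp add: diff_conv_add_uminus add.assoc minus_add del: add_uminus_conv_diff)
    show "g + - x - g \<in> H" unfolding inv using x H(2) unfolding add_subgroup_def by blast
    fix y assume y: "y \<in> {x. \<forall>g. g + x - g \<in> H}"
    have sum: "g + (x + y) - g = (g + x - g) + (g + y - g)"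
      by (simp add: diff_conv_add_uminus add.assoc minus_add del: add_uminus_conv_diff)
    show "g + (x + y) - g \<in> H" unfolding sum using x y H(2) unfolding add_subgroup_def by blast
  qed
  moreover have "h + (g + x - g) - h \<in> H" if "x \<in> N" for x g h
  proof -
    have eq: "h + (g + x - g) - h = (h + g) + x - (h + g)"
      by (simp add: diff_conv_add_uminus add.assoc minus_add del: add_uminus_conv_diff)
    show ?thesis unfolding eq using that unfolding N_def by blast
  qed
  then have "\<forall>x\<in>N. \<forall>g. g + x - g \<in> N" by (auto simp: N_def)
  ultimately have "open_normal_subgroup N" by (simp add: open_normal_subgroup_def)
  moreover have "N \<subseteq> U"
  proof
    fix x assume "x \<in> N"
    then have "0 + x - 0 \<in> H" unfolding N_def by blast
    then show "x \<in> U" using H(3) by auto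
  qed
  ultimately show ?thesis using that by blast
qed

lemma exists_open_normal_subgroup_mball:
  assumes "r > 0"
  obtains N :: "'g set" where "open_normal_subgroup N" "\<forall>x y. y - x \<in> N \<longrightarrow> mdist d x y < r"
proof -
  interpret D: Metric_space "mspace d" "mdist d" by (rule Metric_space_mspace_mdist)
  have sp: "mspace d = UNIV" using mspace_eq_UNIV[OF d_compatible] .
  have "D.mtopology = euclidean"
    using d_compatible by (simp add: compatible_metric_def mtopology_of_def)
  then have "open (D.mball 0 r)" using D.openin_mball[of 0 r] by simp
  moreover have "0 \<in> D.mball 0 r" using assms sp by (metis D.centre_in_mball_iff UNIV_I)
  ultimately obtain N where N: "open_normal_subgroup N" "N \<subseteq> D.mball 0 r"
    by (rule exists_open_normal_subgroup)
  have "mdist d x y < r" if "y - x \<in> N" for x y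
  proof -
    have "y - x \<in> D.mball 0 r" using that N(2) by blast
    then show ?thesis using mdist_right_invariant[OF d_invariant, of x y] by (simp only: D.in_mball)
  qed
  with N(1) show ?thesis by (intro that[of N]) blast+
qed

section \<open>Almost periodic functions\<close>

text \<open>
  This is uniform continuity, stated by means of open normal subgroups; the left and the right
  uniformity agree here.
\<close>

definition coset_continuous :: "('g \<Rightarrow> complex) \<Rightarrow> bool" where
  "coset_continuous f \<longleftrightarrow>
    (\<forall>\<epsilon>>0. \<exists>N. open_normal_subgroup N \<and> (\<forall>x y. y - x \<in> N \<longrightarrow> cmod (f x - f y) \<le> \<epsilon>))"

lemma coset_continuousD:
  assumes "coset_continuous f" "\<epsilon> > 0"
  obtains N where "open_normal_subgroup N" "\<And>x y. y - x \<in> N \<Longrightarrow> cmod (f x - f y) \<le> \<epsilon>"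
  using assms unfolding coset_continuous_def by blast

lemma coset_continuous_translate:
  assumes "coset_continuous f" shows "coset_continuous (\<lambda>x. f (g + x))"
  unfolding coset_continuous_def
proof (intro allI impI)
  fix \<epsilon> :: real assume "\<epsilon> > 0"
  then obtain N where N: "open_normal_subgroup N" "\<And>x y. y - x \<in> N \<Longrightarrow> cmod (f x - f y) \<le> \<epsilon>"
    using coset_continuousD[OF assms] by blast
  have "cmod (f (g + x) - f (g + y)) \<le> \<epsilon>" if "y - x \<in> N" for x y
    using N that unfolding open_normal_subgroup_def by (simp add: left_translate_diff)
  then show "\<exists>N. open_normal_subgroup N \<and> (\<forall>x y. y - x \<in> N \<longrightarrow> cmod (f (g + x) - f (g + y)) \<le> \<epsilon>)"
    using N(1) by blast
qed

lemma coset_continuous_bounded: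
  assumes "coset_continuous f"
  obtains C where "C > 0" "\<And>x. cmod (f x) \<le> C"
proof -
  obtain N where N: "open_normal_subgroup N" "\<And>x y. y - x \<in> N \<Longrightarrow> cmod (f x - f y) \<le> 1"
    using coset_continuousD[OF assms zero_less_one] by blast
  obtain F where F: "finite F" "\<forall>z. \<exists>x\<in>F. z - x \<in> N"
    using finite_cosets[of N] N(1) by (auto simp: open_normal_subgroup_def)
  have "cmod (f z) \<le> (\<Sum>x\<in>F. cmod (f x)) + 1" for z
  proof -
    obtain x where x: "x \<in> F" "z - x \<in> N" using F(2) by blast
    have "cmod (f z) \<le> cmod (f x) + cmod (f x - f z)" using norm_triangle_ineq4[of "f x" "f x - f z"] by simp
    also have "\<dots> \<le> (\<Sum>x\<in>F. cmod (f x)) + 1"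
      using N(2)[OF x(2)] member_le_sum[OF x(1), of "\<lambda>x. cmod (f x)"] F(1) by fastforce
    finally show ?thesis .
  qed
  moreover have "(\<Sum>x\<in>F. cmod (f x)) + 1 > 0" by (simp add: add_nonneg_pos sum_nonneg)
  ultimately show ?thesis using that by blast
qed

lemma coset_continuous_imp_bcontfun:
  assumes "coset_continuous f" shows "f \<in> bcontfun"
proof -
  obtain C where C: "\<And>x. cmod (f x) \<le> C" using coset_continuous_bounded[OF assms] by blast
  have "isCont f x" for x
    unfolding isCont_def
  proof (rule tendstoI)
    fix \<epsilon> :: real assume "\<epsilon> > 0"
    then obtain N where N: "open_normal_subgroup N" "\<And>x y. y - x \<in> N \<Longrightarrow> cmod (f x - f y) \<le> \<epsilon> / 2"
      using coset_continuousD[OF assms, of "\<epsilon> / 2"] by auto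
    have "open (right_coset N x)" "x \<in> right_coset N x"
      using N(1) open_right_coset self_mem_right_coset by (auto simp: open_normal_subgroup_def)
    moreover have "dist (f y) (f x) < \<epsilon>" if "y \<in> right_coset N x" for y
      using N(2)[of y x] that \<open>\<epsilon> > 0\<close> by (simp add: right_coset_def dist_norm norm_minus_commute)
    ultimately show "\<forall>\<^sub>F y in at x. dist (f y) (f x) < \<epsilon>"
      unfolding eventually_at_topological by blast
  qed
  then show ?thesis
    by (intro bcontfun_normI[of _ C] C continuous_at_imp_continuous_on) auto
qed

end

text \<open>
  Uniform limits of bounded continuous functions are again bounded and continuous, on every
  topological space.
\<close>

lemma bcontfun_Cauchy_convergent:
  fixes f :: "nat \<Rightarrow> ('a::topological_space \<Rightarrow>\<^sub>C 'b::complete_space)"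
  assumes "Cauchy f" shows "convergent f"
proof -
  obtain g where "uniform_limit UNIV f g sequentially"
    using uniformly_convergent_eq_cauchy[of "\<lambda>_. True" f] assms
    unfolding Cauchy_def uniform_limit_sequentially_iff
    by (metis dist_fun_lt_imp_dist_val_lt)
  from uniform_limit_bcontfunE[OF this sequentially_bot]
  obtain l where "g = apply_bcontfun l" "f \<longlonglongrightarrow> l" by metis
  then show ?thesis by (intro convergentI)
qed

context precompact_group
begin

text \<open>
  Translates by elements of the same coset of a small \<open>N\<close> are uniformly close, so finitely many
  translates suffice to approximate the whole orbit.
\<close>

lemma coset_continuous_imp_AP:
  fixes f :: "'g \<Rightarrow> complex"
  assumes f: "coset_continuous f" shows "f \<in> AP"
proof -
  define T where "T g = Bcontfun (\<lambda>x. f (g + x))" for g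
  have T: "apply_bcontfun (T g) x = f (g + x)" for g x
    unfolding T_def using coset_continuous_imp_bcontfun[OF coset_continuous_translate[OF f]]
    by (simp add: Bcontfun_inverse)
  have "compact (closure (range T))"
    unfolding compact_eq_totally_bounded
  proof (intro conjI allI impI)
    show "uniform_space_class.complete (closure (range T))"
      unfolding complete_def
    proof (intro allI impI)
      fix u assume u: "(\<forall>n. u n \<in> closure (range T)) \<and> Cauchy u"
      then obtain l where "u \<longlonglongrightarrow> l" using bcontfun_Cauchy_convergent by (auto simp: convergent_def)
      moreover have "l \<in> closure (range T)"
        by (rule closed_sequentially[OF closed_closure _ \<open>u \<longlonglongrightarrow> l\<close>]) (use u in blast)
      ultimately show "\<exists>l\<in>closure (range T). u \<longlonglongrightarrow> l" by blast
    qed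
    fix \<epsilon> :: real assume "\<epsilon> > 0"
    then obtain N where N: "open_normal_subgroup N" "\<And>x y. y - x \<in> N \<Longrightarrow> cmod (f x - f y) \<le> \<epsilon> / 2"
      using coset_continuousD[OF f, of "\<epsilon> / 2"] by auto
    obtain F where F: "finite F" "\<forall>z. \<exists>x\<in>F. z - x \<in> N"
      using finite_cosets[of N] N(1) by (auto simp: open_normal_subgroup_def)
    have "range T \<subseteq> (\<Union>a\<in>F. cball (T a) (\<epsilon> / 2))"
    proof clarify
      fix g
      obtain a where a: "a \<in> F" "g - a \<in> N" using F(2) by blast
      have "cmod (f (a + x) - f (g + x)) \<le> \<epsilon> / 2" for x
        by (rule N(2)) (use a(2) in \<open>simp only: cancel_right_diff\<close>)
      then have "dist (T a) (T g) \<le> \<epsilon> / 2"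
        by (intro dist_bound) (simp add: T dist_norm)
      then show "T g \<in> (\<Union>a\<in>F. cball (T a) (\<epsilon> / 2))" using a(1) by auto
    qed
    then have "closure (range T) \<subseteq> (\<Union>a\<in>F. cball (T a) (\<epsilon> / 2))"
      by (rule closure_minimal) (use F(1) in auto)
    also have "\<dots> \<subseteq> (\<Union>h\<in>T ` F. ball h \<epsilon>)" using \<open>\<epsilon> > 0\<close> by force
    finally show "\<exists>k. finite k \<and> closure (range T) \<subseteq> (\<Union>h\<in>k. ball h \<epsilon>)"
      using F(1) by blast
  qed
  then show ?thesis
    using coset_continuous_imp_bcontfun[OF f] unfolding AP_def T_def by blast
qed

text \<open>
  Total boundedness of the orbit covers the group by finitely many sets of elements with almost the
  same translate. These sets are closed, because only pointwise inequalities between continuous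
  functions define them; so an element near \<open>0\<close> lies in one that also contains \<open>0\<close>.
\<close>

lemma AP_imp_coset_continuous:
  fixes f :: "'g \<Rightarrow> complex"
  assumes f: "f \<in> AP" shows "coset_continuous f"
  unfolding coset_continuous_def
proof (intro allI impI)
  fix \<epsilon> :: real assume "\<epsilon> > 0"
  define T where "T g = Bcontfun (\<lambda>x. f (g + x))" for g
  have fb: "continuous_on UNIV f" "bounded (range f)" using f by (auto simp: AP_def bcontfun_def)
  have cont: "continuous_on UNIV (\<lambda>x. f (g + x + h))" for g h
    by (rule continuous_on_compose2[OF fb(1) continuous_on_translate]) simp
  have "(\<lambda>x. f (g + x)) \<in> bcontfun" for g
    using cont[of g 0] bounded_subset[OF fb(2), of "range (\<lambda>x. f (g + x))"] by (auto simp: bcontfun_def)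
  then have T: "apply_bcontfun (T g) x = f (g + x)" for g x
    unfolding T_def by (simp add: Bcontfun_inverse)
  have "compact (closure (range T))" using f unfolding AP_def T_def by blast
  then obtain K where K: "finite K" "closure (range T) \<subseteq> (\<Union>h\<in>K. ball h (\<epsilon> / 2))"
    unfolding compact_eq_totally_bounded using \<open>\<epsilon> > 0\<close> by (metis half_gt_zero)
  define A where "A h = {g. \<forall>x. cmod (f (g + x) - apply_bcontfun h x) \<le> \<epsilon> / 2}" for h
  have "closed (A h)" for h
  proof -
    have "A h = (\<Inter>x. {g. cmod (f (0 + g + x) - apply_bcontfun h x) \<le> \<epsilon> / 2})" by (auto simp: A_def)
    also have "closed \<dots>"
      by (rule closed_INT, rule ballI)
        (rule closed_Collect_le[OF continuous_on_norm[OF continuous_on_diff[OF cont continuous_on_const]]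
            continuous_on_const])
    finally show ?thesis .
  qed
  have cover: "\<exists>h\<in>K. g \<in> A h" for g
  proof -
    have "T g \<in> closure (range T)" by (rule subsetD[OF closure_subset rangeI])
    with K(2) have "T g \<in> (\<Union>h\<in>K. ball h (\<epsilon> / 2))" by (rule subsetD)
    then obtain h where h: "h \<in> K" "dist h (T g) < \<epsilon> / 2" by auto
    have "dist (T g x) (h x) \<le> \<epsilon> / 2" for x
      using dist_bounded[of "T g" x h] h(2) by (simp add: dist_commute)
    then show ?thesis using h(1) by (auto simp: A_def dist_norm T)
  qed
  \<comment> \<open>Near the neutral element only those of the finitely many closed sets remain that contain it.\<close>
  define U where "U = (\<Inter>h\<in>{h\<in>K. 0 \<notin> A h}. - A h)"
  have "open U" unfolding U_def using K(1) \<open>\<And>h. closed (A h)\<close> by (intro open_INT) auto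
  moreover have "0 \<in> U" by (auto simp: U_def)
  ultimately obtain N where N: "open_normal_subgroup N" "N \<subseteq> U" by (rule exists_open_normal_subgroup)
  have "cmod (f x - f y) \<le> \<epsilon>" if "y - x \<in> N" for x y
  proof -
    obtain h where h: "h \<in> K" "y - x \<in> A h" using cover by blast
    then have "0 \<in> A h" using that N(2) by (auto simp: U_def)
    then have "cmod (f (0 + x) - h x) \<le> \<epsilon> / 2" "cmod (f (y - x + x) - h x) \<le> \<epsilon> / 2"
      using h(2) unfolding A_def by blast+
    then have "cmod (f x - h x) \<le> \<epsilon> / 2" "cmod (f y - h x) \<le> \<epsilon> / 2" by simp_all
    then show ?thesis
      using norm_triangle_ineq4[of "f x - h x" "f y - h x"] by simp
  qed
  then show "\<exists>N. open_normal_subgroup N \<and> (\<forall>x y. y - x \<in> N \<longrightarrow> cmod (f x - f y) \<le> \<epsilon>)"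
    using N(1) by blast
qed

lemma AP_iff: "f \<in> AP \<longleftrightarrow> coset_continuous f" for f :: "'g \<Rightarrow> complex"
  using AP_imp_coset_continuous coset_continuous_imp_AP by blast

text \<open>One estimate for sums, products and inverses.\<close>

lemma coset_continuous_combine:
  assumes "coset_continuous f" "coset_continuous h"
    and "C > 0" "\<And>x y. cmod (k x - k y) \<le> C * (cmod (f x - f y) + cmod (h x - h y))"
  shows "coset_continuous k"
  unfolding coset_continuous_def
proof (intro allI impI)
  fix \<epsilon> :: real assume "\<epsilon> > 0"
  then have "\<epsilon> / (2 * C) > 0" using \<open>C > 0\<close> by simp
  obtain N where N: "open_normal_subgroup N" "\<And>x y. y - x \<in> N \<Longrightarrow> cmod (f x - f y) \<le> \<epsilon> / (2 * C)"
    using coset_continuousD[OF assms(1) \<open>\<epsilon> / (2 * C) > 0\<close>] by blast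
  obtain M where M: "open_normal_subgroup M" "\<And>x y. y - x \<in> M \<Longrightarrow> cmod (h x - h y) \<le> \<epsilon> / (2 * C)"
    using coset_continuousD[OF assms(2) \<open>\<epsilon> / (2 * C) > 0\<close>] by blast
  have "cmod (k x - k y) \<le> \<epsilon>" if "y - x \<in> N \<inter> M" for x y
  proof -
    have "cmod (k x - k y) \<le> C * (cmod (f x - f y) + cmod (h x - h y))" by (rule assms(4))
    also have "\<dots> \<le> C * (\<epsilon> / (2 * C) + \<epsilon> / (2 * C))"
      by (intro mult_left_mono add_mono N(2) M(2)) (use that \<open>C > 0\<close> in auto)
    also have "\<dots> = \<epsilon>" using \<open>C > 0\<close> by simp
    finally show ?thesis .
  qed
  then show "\<exists>N. open_normal_subgroup N \<and> (\<forall>x y. y - x \<in> N \<longrightarrow> cmod (k x - k y) \<le> \<epsilon>)"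
    using open_normal_subgroup_Int[OF N(1) M(1)] by blast
qed

lemma AP_const: "(\<lambda>x::'g. c) \<in> AP"
proof -
  obtain N :: "'g set" where "open_normal_subgroup N" using exists_open_normal_subgroup[of UNIV] by auto
  then show ?thesis by (auto simp: AP_iff coset_continuous_def)
qed

lemma AP_add:
  fixes f h :: "'g \<Rightarrow> complex"
  assumes "f \<in> AP" "h \<in> AP" shows "(\<lambda>x. f x + h x) \<in> AP"
  using assms unfolding AP_iff
  by (rule coset_continuous_combine[of _ _ 1]) (simp_all, metis norm_diff_triangle_ineq)

lemma AP_mult:
  fixes f h :: "'g \<Rightarrow> complex"
  assumes f: "f \<in> AP" and h: "h \<in> AP" shows "(\<lambda>x. f x * h x) \<in> AP"
proof -
  obtain C where C: "C > 0" "\<And>x. cmod (f x) \<le> C" using f coset_continuous_bounded unfolding AP_iff by blast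
  obtain D where D: "D > 0" "\<And>x. cmod (h x) \<le> D" using h coset_continuous_bounded unfolding AP_iff by blast
  have "cmod (f x * h x - f y * h y) \<le> (C + D) * (cmod (f x - f y) + cmod (h x - h y))" for x y
  proof -
    have "f x * h x - f y * h y = (f x - f y) * h x + f y * (h x - h y)" by (simp add: algebra_simps)
    then have "cmod (f x * h x - f y * h y) \<le> cmod (f x - f y) * cmod (h x) + cmod (f y) * cmod (h x - h y)"
      by (metis norm_mult norm_triangle_ineq)
    also have "\<dots> \<le> cmod (f x - f y) * (C + D) + (C + D) * cmod (h x - h y)"
      using C(1) C(2)[of y] D(1) D(2)[of x] by (intro add_mono mult_left_mono mult_right_mono) auto
    finally show ?thesis by (simp add: algebra_simps)
  qed
  then show ?thesis
    unfolding AP_iff by (rule coset_continuous_combine[OF f[unfolded AP_iff] h[unfolded AP_iff] add_pos_pos[OF C(1) D(1)]])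
qed

lemma AP_cmult: "f \<in> AP \<Longrightarrow> (\<lambda>x. c * f x) \<in> AP" for f :: "'g \<Rightarrow> complex"
  using AP_mult[OF AP_const] by blast

lemma AP_diff:
  fixes f h :: "'g \<Rightarrow> complex"
  assumes "f \<in> AP" "h \<in> AP" shows "(\<lambda>x. f x - h x) \<in> AP"
  using AP_add[OF assms(1) AP_cmult[OF assms(2), of "-1"]] by simp

lemma AP_inverse:
  fixes f :: "'g \<Rightarrow> complex"
  assumes "f \<in> AP" "c > 0" "\<And>x. c \<le> cmod (f x)" shows "(\<lambda>x. inverse (f x)) \<in> AP"
proof -
  have "cmod (inverse (f x) - inverse (f y)) \<le> inverse (c * c) * (cmod (f x - f y) + cmod (f x - f y))" for x y
  proof -
    have nz: "f x \<noteq> 0" "f y \<noteq> 0" using assms(2,3) by (metis norm_zero not_le)+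
    have "inverse (f x) - inverse (f y) = - (inverse (f x) * (f x - f y) * inverse (f y))"
      using inverse_diff_inverse[OF nz] .
    then have "cmod (inverse (f x) - inverse (f y)) = inverse (cmod (f x) * cmod (f y)) * cmod (f x - f y)"
      by (simp add: norm_mult norm_inverse)
    also have "\<dots> \<le> inverse (c * c) * cmod (f x - f y)"
      using assms(2,3) by (intro mult_right_mono le_imp_inverse_le mult_mono) (auto intro: less_imp_le)
    also have "\<dots> \<le> inverse (c * c) * (cmod (f x - f y) + cmod (f x - f y))"
      by (intro mult_left_mono) (use assms(2) in auto)
    finally show ?thesis .
  qed
  moreover have "inverse (c * c) > 0" using assms(2) by simp
  ultimately show ?thesis
    unfolding AP_iff by (intro coset_continuous_combine[OF assms(1)[unfolded AP_iff] assms(1)[unfolded AP_iff]])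
qed

lemma AP_translate: "f \<in> AP \<Longrightarrow> (\<lambda>x. f (g + x)) \<in> AP" for f :: "'g \<Rightarrow> complex"
  using coset_continuous_translate unfolding AP_iff .

lemma AP_coset:
  assumes "open_normal_subgroup N" shows "(indicator (right_coset N a) :: 'g \<Rightarrow> complex) \<in> AP"
proof -
  have sub: "add_subgroup N" using assms by (simp add: open_normal_subgroup_def)
  have "indicator (right_coset N a) x = (indicator (right_coset N a) y :: complex)" if "y - x \<in> N" for x y
  proof -
    have "right_coset N y = right_coset N x" using right_coset_eq_iff[OF sub] that by blast
    then have "x \<in> right_coset N a \<longleftrightarrow> y \<in> right_coset N a"
      using right_coset_eqI[OF sub] self_mem_right_coset[OF sub] by blast
    then show ?thesis by (simp add: indicator_def)
  qed
  then show ?thesis unfolding AP_iff coset_continuous_def using assms by (auto intro!: exI[of _ N])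
qed

end

section \<open>The Bohr compactification\<close>

lemma topspace_bohr: "topspace bohr_topology = bohr"
  by (auto simp: bohr_topology_def bohr_def extensional_def)

lemma bohr_add: "\<phi> \<in> bohr \<Longrightarrow> f \<in> AP \<Longrightarrow> h \<in> AP \<Longrightarrow> \<phi> (\<lambda>x. f x + h x) = \<phi> f + \<phi> h"
  and bohr_cmult: "\<phi> \<in> bohr \<Longrightarrow> f \<in> AP \<Longrightarrow> \<phi> (\<lambda>x. c * f x) = c * \<phi> f"
  and bohr_times: "\<phi> \<in> bohr \<Longrightarrow> f \<in> AP \<Longrightarrow> h \<in> AP \<Longrightarrow> \<phi> (\<lambda>x. f x * h x) = \<phi> f * \<phi> h"
  and bohr_ext: "\<phi> \<in> bohr \<Longrightarrow> \<phi> \<in> extensional AP"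
  unfolding bohr_def by auto

lemma continuous_map_bohr_eval:
  "f \<in> AP \<Longrightarrow> continuous_map bohr_topology euclidean (\<lambda>\<phi>. \<phi> f)"
  unfolding bohr_topology_def
  by (rule continuous_map_from_subtopology) (rule continuous_map_product_projection)

lemma continuous_map_times:
  fixes f g :: "'a \<Rightarrow> 'b::real_normed_algebra"
  shows "continuous_map X euclidean f \<Longrightarrow> continuous_map X euclidean g \<Longrightarrow> continuous_map X euclidean (\<lambda>x. f x * g x)"
  by (simp add: continuous_map_atin tendsto_mult)

context precompact_group
begin

lemma bohr_const:
  fixes \<phi> :: "('g \<Rightarrow> complex) \<Rightarrow> complex"
  assumes "\<phi> \<in> bohr" shows "\<phi> (\<lambda>x. c) = c"
proof -
  obtain f where f: "f \<in> AP" "\<phi> f \<noteq> 0" using assms unfolding bohr_def by blast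
  have "\<phi> f = \<phi> f * \<phi> (\<lambda>x. 1)" using bohr_times[OF assms f(1) AP_const[of 1]] by simp
  then have "\<phi> (\<lambda>x. 1) = 1" using f(2) by simp
  then show ?thesis using bohr_cmult[OF assms AP_const[of 1], of c] by simp
qed

lemma bohr_diff:
  fixes \<phi> :: "('g \<Rightarrow> complex) \<Rightarrow> complex"
  assumes "\<phi> \<in> bohr" "f \<in> AP" "h \<in> AP" shows "\<phi> (\<lambda>x. f x - h x) = \<phi> f - \<phi> h"
  using bohr_add[OF assms(1,2) AP_cmult[OF assms(3), of "-1"]] bohr_cmult[OF assms(1,3), of "-1"] by simp

text \<open>
  If the value \<open>\<phi> f\<close> exceeded \<open>C\<close>, then \<open>f - \<phi> f\<close> would be bounded away from \<open>0\<close> and hence invertible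
  among the almost periodic functions, although \<open>\<phi>\<close> maps it to \<open>0\<close>.
\<close>

lemma bohr_norm_le:
  fixes \<phi> :: "('g \<Rightarrow> complex) \<Rightarrow> complex"
  assumes \<phi>: "\<phi> \<in> bohr" and f: "f \<in> AP" and C: "\<And>x. cmod (f x) \<le> C"
  shows "cmod (\<phi> f) \<le> C"
proof (rule ccontr)
  assume "\<not> cmod (\<phi> f) \<le> C"
  define h where "h x = f x - \<phi> f" for x
  have h: "h \<in> AP" unfolding h_def[abs_def] using AP_diff[OF f AP_const] .
  have low: "cmod (\<phi> f) - C \<le> cmod (h x)" for x
    using norm_triangle_ineq2[of "\<phi> f" "f x"] C[of x] by (simp add: h_def norm_minus_commute)
  have i: "(\<lambda>x. inverse (h x)) \<in> AP"
    using \<open>\<not> cmod (\<phi> f) \<le> C\<close> by (intro AP_inverse[OF h _ low]) simp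
  have "h x \<noteq> 0" for x using low[of x] \<open>\<not> cmod (\<phi> f) \<le> C\<close> by auto
  then have "(\<lambda>x. h x * inverse (h x)) = (\<lambda>x. 1)" by simp
  then have "\<phi> h * \<phi> (\<lambda>x. inverse (h x)) = 1"
    using bohr_times[OF \<phi> h i] bohr_const[OF \<phi>, of 1] by simp
  moreover have "\<phi> h = 0"
    unfolding h_def[abs_def] using bohr_diff[OF \<phi> f AP_const] bohr_const[OF \<phi>] by simp
  ultimately show False by simp
qed

lemma bohr_sum:
  fixes \<phi> :: "('g \<Rightarrow> complex) \<Rightarrow> complex"
  assumes "\<phi> \<in> bohr" "finite S" "\<And>s. s \<in> S \<Longrightarrow> F s \<in> AP"
  shows "(\<lambda>x. \<Sum>s\<in>S. F s x) \<in> AP \<and> \<phi> (\<lambda>x. \<Sum>s\<in>S. F s x) = (\<Sum>s\<in>S. \<phi> (F s))"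
  using assms(2,3)
proof (induction S)
  case empty
  then show ?case using AP_const[of 0] bohr_const[OF assms(1), of 0] by simp
next
  case (insert s S)
  then show ?case using AP_add[of "F s"] bohr_add[OF assms(1), of "F s"] by simp
qed

lemma bohr_map_apply: "f \<in> AP \<Longrightarrow> bohr_map x f = f x" for x :: 'g
  by (simp add: bohr_map_def)

lemma bohr_map_mem: "bohr_map (x::'g) \<in> bohr"
  unfolding bohr_def mem_Collect_eq
proof (intro conjI ballI allI)
  show "bohr_map x \<in> extensional AP" by (simp add: bohr_map_def)
  show "\<exists>f\<in>AP. bohr_map x f \<noteq> 0"
    using AP_const[of 1] by (auto simp: bohr_map_apply intro!: bexI[of _ "\<lambda>x. 1"])
qed (simp_all add: bohr_map_apply AP_add AP_mult AP_cmult)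

text \<open>
  The class of the Bohr compactification that corresponds to the coset \<open>N + a\<close>; it is the closure of
  the image of that coset.
\<close>

definition bohr_coset :: "'g set \<Rightarrow> 'g \<Rightarrow> (('g \<Rightarrow> complex) \<Rightarrow> complex) set" where
  "bohr_coset N a = {\<phi> \<in> bohr. \<phi> (indicator (right_coset N a)) = 1}"

text \<open>
  The indicator functions of the finitely many cosets are idempotents with sum \<open>1\<close>, so \<open>\<phi>\<close> takes the
  value \<open>1\<close> on one of them.
\<close>

lemma bohr_coset_cover:
  assumes N: "open_normal_subgroup N" and \<phi>: "\<phi> \<in> bohr"
  obtains a where "\<phi> \<in> bohr_coset N a"
proof -
  have sub: "open N" "add_subgroup N" using N by (auto simp: open_normal_subgroup_def)
  obtain F where F: "finite F" "\<forall>z. \<exists>x\<in>F. z - x \<in> N" by (rule finite_cosets[OF sub])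
  define Q where "Q = right_coset N ` F"
  have Q: "finite Q" using F(1) by (simp add: Q_def)
  have ap: "indicator c \<in> AP" if "c \<in> Q" for c :: "'g set" using that AP_coset[OF N] by (auto simp: Q_def)
  have "(\<Sum>c\<in>Q. indicator c x) = (1::complex)" for x
  proof -
    obtain a where "a \<in> F" "x - a \<in> N" using F(2) by blast
    then have a: "right_coset N a \<in> Q" "x \<in> right_coset N a" by (auto simp: Q_def right_coset_def)
    have "x \<notin> c" if c: "c \<in> Q - {right_coset N a}" for c
    proof
      assume "x \<in> c"
      obtain b where "c = right_coset N b" using c by (auto simp: Q_def)
      then have "c = right_coset N a" using \<open>x \<in> c\<close> a(2) right_coset_eqI[OF sub(2)] by metis
      then show False using c by simp
    qed
    then have "(\<Sum>c\<in>Q. indicator c x) = (\<Sum>c\<in>Q. if c = right_coset N a then 1 else (0::complex))"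
      using a(2) by (intro sum.cong) (auto simp: indicator_def)
    also have "\<dots> = 1" using Q a(1) by simp
    finally show ?thesis .
  qed
  then have "(\<Sum>c\<in>Q. \<phi> (indicator c)) = 1"
    using bohr_sum[OF \<phi> Q, of indicator] ap bohr_const[OF \<phi>, of 1] by simp
  then obtain c where c: "c \<in> Q" "\<phi> (indicator c) \<noteq> 0" by (metis sum.neutral zero_neq_one)
  have "(\<lambda>x. indicator c x * indicator c x :: complex) = indicator c" by (auto simp: indicator_def)
  then have "\<phi> (indicator c) * \<phi> (indicator c) = \<phi> (indicator c)"
    using bohr_times[OF \<phi> ap[OF c(1)] ap[OF c(1)]] by simp
  then have "\<phi> (indicator c) = 1" using c(2) by simp
  then show ?thesis using c(1) \<phi> that by (auto simp: Q_def bohr_coset_def)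
qed

lemma bohr_coset_disjoint:
  assumes N: "open_normal_subgroup N" and "\<phi> \<in> bohr_coset N a" "\<phi> \<in> bohr_coset N b"
  shows "right_coset N a = right_coset N b"
proof (rule ccontr)
  assume "right_coset N a \<noteq> right_coset N b"
  moreover have sub: "add_subgroup N" using N by (simp add: open_normal_subgroup_def)
  ultimately have "right_coset N a \<inter> right_coset N b = {}" by (intro right_cosets_disjoint)
  then have "(\<lambda>x. indicator (right_coset N a) x * indicator (right_coset N b) x :: complex) = (\<lambda>x. 0)"
    by (auto simp: indicator_def fun_eq_iff)
  moreover have \<phi>: "\<phi> \<in> bohr" using assms(2) by (simp add: bohr_coset_def)
  ultimately have "\<phi> (\<lambda>x. 0) = 1"
    using assms(2,3) bohr_times[OF \<phi> AP_coset[OF N, of a] AP_coset[OF N, of b]]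
    by (simp add: bohr_coset_def)
  then show False using bohr_const[OF \<phi>, of 0] by simp
qed

lemma bohr_map_mem_coset:
  assumes "open_normal_subgroup N"
  shows "bohr_map x \<in> bohr_coset N a \<longleftrightarrow> x \<in> right_coset N a"
  using bohr_map_mem[of x] by (simp add: bohr_coset_def bohr_map_apply AP_coset[OF assms] indicator_def)

text \<open>
  On a class, the value at \<open>f\<close> only sees the restriction of \<open>f\<close> to the coset, since the functional
  takes the value \<open>1\<close> at the indicator function of the coset.
\<close>

lemma bohr_coset_approx:
  assumes N: "open_normal_subgroup N" and \<phi>: "\<phi> \<in> bohr_coset N a" and f: "f \<in> AP"
    and le: "\<And>x. x \<in> right_coset N a \<Longrightarrow> cmod (f x - c) \<le> \<epsilon>" and "0 \<le> \<epsilon>"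
  shows "cmod (\<phi> f - c) \<le> \<epsilon>"
proof -
  have \<phi>': "\<phi> \<in> bohr" "\<phi> (indicator (right_coset N a)) = 1" using \<phi> by (auto simp: bohr_coset_def)
  have fc: "(\<lambda>x. f x - c) \<in> AP" using AP_diff[OF f AP_const] .
  have "\<phi> f - c = \<phi> (\<lambda>x. (f x - c) * indicator (right_coset N a) x)"
    using bohr_times[OF \<phi>'(1) fc AP_coset[OF N]] bohr_diff[OF \<phi>'(1) f AP_const] bohr_const[OF \<phi>'(1)] \<phi>'(2)
    by simp
  also have "cmod \<dots> \<le> \<epsilon>"
    by (rule bohr_norm_le[OF \<phi>'(1) AP_mult[OF fc AP_coset[OF N]]])
      (use le \<open>0 \<le> \<epsilon>\<close> in \<open>auto simp: indicator_def\<close>)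
  finally show ?thesis .
qed

lemma clopen_bohr_coset:
  assumes "open_normal_subgroup N" shows "openin bohr_topology (bohr_coset N a)"
    and "closedin bohr_topology (bohr_coset N a)"
proof -
  let ?i = "indicator (right_coset N a) :: 'g \<Rightarrow> complex"
  have cont: "continuous_map bohr_topology euclidean (\<lambda>\<phi>. \<phi> ?i)"
    by (rule continuous_map_bohr_eval) (rule AP_coset[OF assms])
  have "\<phi> ?i = 1" if "\<phi> \<in> bohr" "dist (\<phi> ?i) 1 < 1" for \<phi>
  proof -
    have "(\<lambda>x. ?i x * ?i x) = ?i" by (auto simp: indicator_def)
    then have "\<phi> ?i * \<phi> ?i = \<phi> ?i" using bohr_times[OF that(1) AP_coset[OF assms, of a] AP_coset[OF assms, of a]] by simp
    then have "\<phi> ?i = 0 \<or> \<phi> ?i = 1" by simp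
    then show ?thesis using that(2) by auto
  qed
  then have "bohr_coset N a = {\<phi> \<in> topspace bohr_topology. \<phi> ?i \<in> ball 1 1}"
    by (auto simp: bohr_coset_def topspace_bohr dist_commute)
  then show "openin bohr_topology (bohr_coset N a)"
    using openin_continuous_map_preimage[OF cont, of "ball 1 1"] by simp
  have "bohr_coset N a = {\<phi> \<in> topspace bohr_topology. \<phi> ?i \<in> {1}}"
    by (auto simp: bohr_coset_def topspace_bohr)
  then show "closedin bohr_topology (bohr_coset N a)"
    using closedin_continuous_map_preimage[OF cont, of "{1}"] by simp
qed

text \<open>
  A basic neighbourhood constrains the values at finitely many almost periodic functions. All of
  them are almost constant on the cosets of a common \<open>N\<close>, and then the whole class of \<open>\<phi>\<close> satisfies
  the constraints.
\<close>

lemma bohr_nhds_coset: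
  fixes W :: "(('g \<Rightarrow> complex) \<Rightarrow> complex) set"
  assumes W: "openin bohr_topology W" and \<phi>: "\<phi> \<in> W"
  obtains N a where "open_normal_subgroup N" "\<phi> \<in> bohr_coset N a" "bohr_coset N a \<subseteq> W"
proof -
  obtain V where V: "openin (product_topology (\<lambda>_. euclidean) AP) V" "W = V \<inter> bohr"
    using W unfolding bohr_topology_def openin_subtopology by blast
  then have \<phi>': "\<phi> \<in> V" "\<phi> \<in> bohr" using \<phi> by auto
  obtain U where U: "finite {f \<in> AP. U f \<noteq> UNIV}" "\<forall>f\<in>AP. open (U f)" "\<phi> \<in> PiE AP U" "PiE AP U \<subseteq> V"
    using V(1) \<phi>'(1) unfolding openin_product_topology_alt by auto
  define S where "S = {f \<in> AP. U f \<noteq> UNIV}"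
  have "\<exists>N. open_normal_subgroup N \<and> (\<forall>a \<psi>. \<phi> \<in> bohr_coset N a \<longrightarrow> \<psi> \<in> bohr_coset N a \<longrightarrow> \<psi> f \<in> U f)"
    if "f \<in> S" for f
  proof -
    have f: "f \<in> AP" using that by (simp add: S_def)
    then have "\<phi> f \<in> U f" "open (U f)" using U by (auto simp: PiE_iff)
    then obtain \<epsilon> where \<epsilon>: "\<epsilon> > 0" "ball (\<phi> f) \<epsilon> \<subseteq> U f" using open_contains_ball by blast
    obtain N where N: "open_normal_subgroup N" "\<And>x y. y - x \<in> N \<Longrightarrow> cmod (f x - f y) \<le> \<epsilon> / 3"
      using coset_continuousD[OF f[unfolded AP_iff], of "\<epsilon> / 3"] \<epsilon>(1) by auto
    have "\<psi> f \<in> U f" if "\<phi> \<in> bohr_coset N a" "\<psi> \<in> bohr_coset N a" for a \<psi>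
    proof -
      have "cmod (f x - f a) \<le> \<epsilon> / 3" if "x \<in> right_coset N a" for x
        using N(2)[of x a] that by (simp add: right_coset_def norm_minus_commute)
      note near = this
      have "cmod (\<phi> f - f a) \<le> \<epsilon> / 3"
        by (rule bohr_coset_approx[OF N(1) that(1) f near]) (use \<epsilon>(1) in auto)
      moreover have "cmod (\<psi> f - f a) \<le> \<epsilon> / 3"
        by (rule bohr_coset_approx[OF N(1) that(2) f near]) (use \<epsilon>(1) in auto)
      ultimately have "cmod ((\<phi> f - f a) - (\<psi> f - f a)) \<le> \<epsilon> / 3 + \<epsilon> / 3" by (rule norm_triangle_le_diff[OF add_mono])
      then have "dist (\<phi> f) (\<psi> f) < \<epsilon>" using \<epsilon>(1) by (simp add: dist_norm)
      then show ?thesis using \<epsilon>(2) by auto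
    qed
    then show ?thesis using N(1) by blast
  qed
  then obtain M where M: "\<And>f. f \<in> S \<Longrightarrow> open_normal_subgroup (M f)"
      "\<And>f a \<psi>. f \<in> S \<Longrightarrow> \<phi> \<in> bohr_coset (M f) a \<Longrightarrow> \<psi> \<in> bohr_coset (M f) a \<Longrightarrow> \<psi> f \<in> U f"
    by metis
  have inter: "\<exists>N. open_normal_subgroup N \<and> (\<forall>f\<in>S'. N \<subseteq> M f)" if "finite S'" "S' \<subseteq> S" for S'
    using that
  proof (induction S')
    case empty
    then show ?case using exists_open_normal_subgroup[of UNIV] by auto
  next
    case (insert f S')
    then obtain N where "open_normal_subgroup N" "\<forall>f\<in>S'. N \<subseteq> M f" by auto
    then show ?case using insert.prems open_normal_subgroup_Int[OF _ M(1)]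
      by (intro exI[of _ "N \<inter> M f"]) auto
  qed
  have "finite S" using U(1) by (simp add: S_def)
  then obtain N where N: "open_normal_subgroup N" "\<forall>f\<in>S. N \<subseteq> M f" using inter[of S] by blast
  obtain a where a: "\<phi> \<in> bohr_coset N a" using bohr_coset_cover[OF N(1) \<phi>'(2)] .
  have larger: "\<psi> \<in> bohr_coset M' a" if "\<psi> \<in> bohr_coset N a" "open_normal_subgroup M'" "N \<subseteq> M'" for \<psi> M'
  proof -
    have "cmod (\<psi> (indicator (right_coset M' a)) - 1) \<le> 0"
      by (rule bohr_coset_approx[OF N(1) that(1) AP_coset[OF that(2)]])
        (use that(3) in \<open>auto simp: right_coset_def\<close>)
    then show ?thesis using that(1) by (simp add: bohr_coset_def)
  qed
  have "\<psi> \<in> W" if "\<psi> \<in> bohr_coset N a" for \<psi>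
  proof -
    have \<psi>: "\<psi> \<in> bohr" using that by (simp add: bohr_coset_def)
    have "\<psi> f \<in> U f" if "f \<in> AP" for f
    proof (cases "f \<in> S")
      case True
      then show ?thesis
        using M(2)[OF True] larger[OF a M(1)[OF True]] larger[OF \<open>\<psi> \<in> bohr_coset N a\<close> M(1)[OF True]] N(2) by blast
    next
      case False
      then show ?thesis using that by (simp add: S_def)
    qed
    then have "\<psi> \<in> PiE AP U" using bohr_ext[OF \<psi>] by (simp add: PiE_iff)
    then show ?thesis using U(4) V(2) \<psi> by blast
  qed
  then show ?thesis using that N(1) a by blast
qed

lemma bohr_map_dense:
  fixes W :: "(('g \<Rightarrow> complex) \<Rightarrow> complex) set"
  assumes "openin bohr_topology W" "\<phi> \<in> W"
  obtains N a where "open_normal_subgroup N" "bohr_map ` right_coset N a \<subseteq> W"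
proof -
  obtain N a where N: "open_normal_subgroup N" "bohr_coset N a \<subseteq> W" using bohr_nhds_coset[OF assms] .
  have "bohr_map ` right_coset N a \<subseteq> W" using N bohr_map_mem_coset[OF N(1)] by blast
  with N(1) show ?thesis by (rule that)
qed

lemma separable_bohr: "separable_space (bohr_topology :: (('g \<Rightarrow> complex) \<Rightarrow> complex) topology)"
proof -
  obtain D :: "'g set" where D: "countable D" "\<And>X. open X \<Longrightarrow> X \<noteq> {} \<Longrightarrow> \<exists>d\<in>D. d \<in> X"
    using countable_dense_exists by metis
  have "bohr_topology closure_of (bohr_map ` D) = topspace bohr_topology"
  proof (rule subset_antisym[OF closure_of_subset_topspace], rule subsetI, unfold in_closure_of, intro conjI allI impI)
    fix \<phi> :: "('g \<Rightarrow> complex) \<Rightarrow> complex" and W assume "\<phi> \<in> W \<and> openin bohr_topology W"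
    then have "openin bohr_topology W" "\<phi> \<in> W" by auto
    then obtain N a where N: "open_normal_subgroup N" "bohr_map ` right_coset N a \<subseteq> W"
      by (rule bohr_map_dense)
    then have "open (right_coset N a)" "a \<in> right_coset N a"
      using open_right_coset self_mem_right_coset by (auto simp: open_normal_subgroup_def)
    then obtain x where "x \<in> D" "x \<in> right_coset N a" using D(2)[of "right_coset N a"] by blast
    then show "\<exists>\<psi>. \<psi> \<in> bohr_map ` D \<and> \<psi> \<in> W" using N(2) by blast
  qed simp
  then show ?thesis
    unfolding separable_space_def using D(1) bohr_map_mem
    by (intro exI[of _ "bohr_map ` D"]) (auto simp: topspace_bohr)
qed

text \<open>
  As for the Gelfand spectrum of any unital Banach algebra: the norm bound puts the functionals into
  a product of compact discs, and the algebraic conditions are closed. Nonvanishing is equivalent to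
  the closed condition that the constant function \<open>1\<close> is mapped to \<open>1\<close>.
\<close>

lemma compact_bohr: "compact_space (bohr_topology :: (('g \<Rightarrow> complex) \<Rightarrow> complex) topology)"
proof -
  let ?P = "product_topology (\<lambda>_::'g \<Rightarrow> complex. euclidean :: complex topology) AP"
  have proj: "continuous_map ?P euclidean (\<lambda>\<phi>. \<phi> f)" if "f \<in> AP" for f
    by (rule continuous_map_product_projection[OF that])
  have top: "topspace ?P = extensional AP" by (simp add: extensional_def PiE_def)
  have c1: "closedin ?P {\<phi> \<in> topspace ?P. \<phi> (\<lambda>x. f x + h x) = \<phi> f + \<phi> h}" if "f \<in> AP" "h \<in> AP" for f h
    by (rule closedin_continuous_maps_eq[OF Hausdorff_space_euclidean]) (intro continuous_map_add proj AP_add that)+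
  have c2: "closedin ?P {\<phi> \<in> topspace ?P. \<phi> (\<lambda>x. c * f x) = c * \<phi> f}" if "f \<in> AP" for f c
    by (rule closedin_continuous_maps_eq[OF Hausdorff_space_euclidean])
      (intro continuous_map_times[OF continuous_map_canonical_const] proj AP_cmult that)+
  have c3: "closedin ?P {\<phi> \<in> topspace ?P. \<phi> (\<lambda>x. f x * h x) = \<phi> f * \<phi> h}" if "f \<in> AP" "h \<in> AP" for f h
    by (rule closedin_continuous_maps_eq[OF Hausdorff_space_euclidean]) (intro continuous_map_times proj AP_mult that)+
  have c4: "closedin ?P {\<phi> \<in> topspace ?P. \<phi> (\<lambda>x. 1) = 1}"
    by (rule closedin_continuous_maps_eq[OF Hausdorff_space_euclidean])
      (rule continuous_map_canonical_const proj AP_const)+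
  let ?A = "\<lambda>f h. {\<phi> \<in> topspace ?P. \<phi> (\<lambda>x. f x + h x) = \<phi> f + \<phi> h}"
  let ?B = "\<lambda>f c. {\<phi> \<in> topspace ?P. \<phi> (\<lambda>x. c * f x) = c * \<phi> f}"
  let ?C = "\<lambda>f h. {\<phi> \<in> topspace ?P. \<phi> (\<lambda>x. f x * h x) = \<phi> f * \<phi> h}"
  let ?D = "{\<phi> \<in> topspace ?P. \<phi> (\<lambda>x. 1) = 1}"
  have ne: "(AP :: ('g \<Rightarrow> complex) set) \<noteq> {}" using AP_const by blast
  have "closedin ?P (((\<Inter>f\<in>AP. \<Inter>h\<in>AP. ?A f h) \<inter> (\<Inter>f\<in>AP. \<Inter>c. ?B f c)) \<inter> ((\<Inter>f\<in>AP. \<Inter>h\<in>AP. ?C f h) \<inter> ?D))"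
    by (intro closedin_Int closedin_INT ne c1 c2 c3 c4 UNIV_not_empty)
  moreover have "bohr = ((\<Inter>f\<in>AP. \<Inter>h\<in>AP. ?A f h) \<inter> (\<Inter>f\<in>AP. \<Inter>c. ?B f c)) \<inter> ((\<Inter>f\<in>AP. \<Inter>h\<in>AP. ?C f h) \<inter> ?D)"
    (is "_ = ?R")
  proof (intro equalityI subsetI)
    fix \<phi> :: "('g \<Rightarrow> complex) \<Rightarrow> complex" assume \<phi>: "\<phi> \<in> bohr"
    then have "\<phi> \<in> topspace ?P" using bohr_ext[OF \<phi>] unfolding top by simp
    then show "\<phi> \<in> ?R"
      by (intro IntI INT_I CollectI conjI bohr_add[OF \<phi>] bohr_cmult[OF \<phi>] bohr_times[OF \<phi>] bohr_const[OF \<phi>])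
  next
    fix \<phi> assume \<phi>: "\<phi> \<in> ?R"
    note a = \<phi>[THEN IntD1, THEN IntD1] and b = \<phi>[THEN IntD1, THEN IntD2]
      and c = \<phi>[THEN IntD2, THEN IntD1] and e = \<phi>[THEN IntD2, THEN IntD2]
    have "\<phi> (\<lambda>x. f x + h x) = \<phi> f + \<phi> h" if "f \<in> AP" "h \<in> AP" for f h
      by (rule CollectD[OF INT_D[OF INT_D[OF a that(1)] that(2)], THEN conjunct2])
    moreover have "\<phi> (\<lambda>x. c * f x) = c * \<phi> f" if "f \<in> AP" for f c
      by (rule CollectD[OF INT_D[OF INT_D[OF b that] UNIV_I], THEN conjunct2])
    moreover have "\<phi> (\<lambda>x. f x * h x) = \<phi> f * \<phi> h" if "f \<in> AP" "h \<in> AP" for f h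
      by (rule CollectD[OF INT_D[OF INT_D[OF c that(1)] that(2)], THEN conjunct2])
    moreover have "\<exists>f\<in>AP. \<phi> f \<noteq> 0"
    proof (rule bexI[OF _ AP_const])
      show "\<phi> (\<lambda>x. 1) \<noteq> 0" using CollectD[OF e] by simp
    qed
    moreover have "\<phi> \<in> extensional AP" using CollectD[OF e] unfolding top by simp
    ultimately show "\<phi> \<in> bohr" unfolding bohr_def by (intro CollectI conjI ballI allI)
  qed
  ultimately have closed: "closedin ?P bohr" by simp
  have "\<exists>C. \<forall>x. cmod (f x) \<le> C" if "f \<in> AP" for f :: "'g \<Rightarrow> complex"
    using coset_continuous_bounded[OF that[unfolded AP_iff]] by blast
  then have "\<forall>f. \<exists>C. f \<in> AP \<longrightarrow> (\<forall>x::'g. cmod (f x) \<le> C)" by blast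
  from choice[OF this] obtain C where C: "\<And>f x. f \<in> AP \<Longrightarrow> cmod (f (x::'g)) \<le> C f" by blast
  have "compactin ?P (PiE AP (\<lambda>f. cball 0 (C f)))"
    by (simp add: compactin_PiE)
  moreover have "bohr \<subseteq> PiE AP (\<lambda>f. cball 0 (C f))"
  proof
    fix \<phi> :: "('g \<Rightarrow> complex) \<Rightarrow> complex" assume \<phi>: "\<phi> \<in> bohr"
    have "cmod (\<phi> f) \<le> C f" if "f \<in> AP" for f by (rule bohr_norm_le[OF \<phi> that C[OF that]])
    then show "\<phi> \<in> PiE AP (\<lambda>f. cball 0 (C f))" using bohr_ext[OF \<phi>] by (simp add: PiE_iff)
  qed
  ultimately have "compactin ?P bohr" using closed by (rule closed_compactin)
  then show ?thesis unfolding bohr_topology_def by (rule compact_space_subtopology)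
qed

section \<open>Haar measure of cosets\<close>

text \<open>
  The image of \<open>g\<close> acts on functionals by translating the argument. In the product, this image is
  evaluated at \<open>g \<mapsto> \<psi> (\<lambda>x. f (g + x))\<close>, and evaluation is as expected only for almost periodic
  functions: hence the need to show that this function is one.
\<close>

lemma bohr_mult_map:
  fixes \<psi> :: "('g \<Rightarrow> complex) \<Rightarrow> complex"
  assumes \<psi>: "\<psi> \<in> bohr" and f: "f \<in> AP"
  shows "bohr_mult (bohr_map g) \<psi> f = \<psi> (\<lambda>x. f (g + x))"
proof -
  have "coset_continuous (\<lambda>g. \<psi> (\<lambda>x. f (g + x)))"
    unfolding coset_continuous_def
  proof (intro allI impI)
    fix \<epsilon> :: real assume "\<epsilon> > 0"
    then obtain N where N: "open_normal_subgroup N" "\<And>x y. y - x \<in> N \<Longrightarrow> cmod (f x - f y) \<le> \<epsilon>"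
      using coset_continuousD[OF f[unfolded AP_iff]] by blast
    have "cmod (\<psi> (\<lambda>z. f (x + z)) - \<psi> (\<lambda>z. f (y + z))) \<le> \<epsilon>" if "y - x \<in> N" for x y
    proof -
      have "cmod (\<psi> (\<lambda>z. f (x + z) - f (y + z))) \<le> \<epsilon>"
        by (rule bohr_norm_le[OF \<psi> AP_diff[OF AP_translate[OF f] AP_translate[OF f]]], rule N(2))
          (use that in \<open>simp only: cancel_right_diff\<close>)
      then show ?thesis using bohr_diff[OF \<psi> AP_translate[OF f] AP_translate[OF f]] by simp
    qed
    then show "\<exists>N. open_normal_subgroup N \<and>
        (\<forall>x y. y - x \<in> N \<longrightarrow> cmod (\<psi> (\<lambda>z. f (x + z)) - \<psi> (\<lambda>z. f (y + z))) \<le> \<epsilon>)"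
      using N(1) by blast
  qed
  then have "(\<lambda>g. \<psi> (\<lambda>x. f (g + x))) \<in> AP" by (simp add: AP_iff)
  then show ?thesis using f by (simp add: bohr_mult_def bohr_map_apply)
qed

lemma bohr_mult_map_mem:
  fixes \<psi> :: "('g \<Rightarrow> complex) \<Rightarrow> complex"
  assumes \<psi>: "\<psi> \<in> bohr" shows "bohr_mult (bohr_map g) \<psi> \<in> bohr"
  unfolding bohr_def mem_Collect_eq
proof (intro conjI ballI allI)
  show "bohr_mult (bohr_map g) \<psi> \<in> extensional AP" by (simp add: bohr_mult_def)
  show "\<exists>f\<in>AP. bohr_mult (bohr_map g) \<psi> f \<noteq> 0"
    using AP_const[of 1] bohr_mult_map[OF \<psi> AP_const[of 1]] bohr_const[OF \<psi>, of 1]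
    by (auto intro!: bexI[of _ "\<lambda>x. 1"])
qed (simp_all add: bohr_mult_map[OF \<psi>] AP_add AP_mult AP_cmult AP_translate
    bohr_add[OF \<psi>] bohr_cmult[OF \<psi>] bohr_times[OF \<psi>])

lemma bohr_mult_map_coset:
  assumes N: "open_normal_subgroup N" and \<psi>: "\<psi> \<in> bohr_coset N a"
  shows "bohr_mult (bohr_map g) \<psi> \<in> bohr_coset N (g + a)"
proof -
  have \<psi>': "\<psi> \<in> bohr" using \<psi> by (simp add: bohr_coset_def)
  have conj: "(g + x) - (g + a) \<in> N \<longleftrightarrow> x - a \<in> N" for x
  proof
    assume "x - a \<in> N"
    then show "(g + x) - (g + a) \<in> N"
      using N unfolding left_translate_diff open_normal_subgroup_def by blast
  next
    assume "(g + x) - (g + a) \<in> N"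
    then have "(- g + (g + x)) - (- g + (g + a)) \<in> N"
      using N unfolding left_translate_diff[of "- g"] open_normal_subgroup_def by blast
    then show "x - a \<in> N" by (simp only: minus_add_cancel)
  qed
  have "(\<lambda>x. indicator (right_coset N (g + a)) (g + x) :: complex) = indicator (right_coset N a)"
    by (auto simp: indicator_def right_coset_def conj simp del: add_diff_cancel_left)
  then show ?thesis
    using bohr_mult_map[OF \<psi>' AP_coset[OF N]] bohr_mult_map_mem[OF \<psi>'] \<psi> by (simp add: bohr_coset_def)
qed

lemma bohr_mult_map_image:
  assumes N: "open_normal_subgroup N"
  shows "bohr_mult (bohr_map g) ` bohr_coset N a = bohr_coset N (g + a)"
proof (intro equalityI subsetI)
  fix \<theta> assume \<theta>: "\<theta> \<in> bohr_coset N (g + a)"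
  then have \<theta>': "\<theta> \<in> bohr" by (simp add: bohr_coset_def)
  let ?\<psi> = "bohr_mult (bohr_map (- g)) \<theta>"
  have "?\<psi> \<in> bohr_coset N (- g + (g + a))" by (rule bohr_mult_map_coset[OF N \<theta>])
  then have "?\<psi> \<in> bohr_coset N a" by (simp only: minus_add_cancel)
  moreover have "bohr_mult (bohr_map g) ?\<psi> = \<theta>"
  proof (rule extensionalityI[of _ AP])
    show "bohr_mult (bohr_map g) ?\<psi> \<in> extensional AP" by (simp add: bohr_mult_def)
    show "\<theta> \<in> extensional AP" by (rule bohr_ext[OF \<theta>'])
    fix f :: "'g \<Rightarrow> complex" assume f: "f \<in> AP"
    show "bohr_mult (bohr_map g) ?\<psi> f = \<theta> f"
      using bohr_mult_map[OF bohr_mult_map_mem[OF \<theta>'] f] bohr_mult_map[OF \<theta>' AP_translate[OF f]]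
      by (simp add: add.assoc[symmetric])
  qed
  ultimately show "\<theta> \<in> bohr_mult (bohr_map g) ` bohr_coset N a" by (metis image_eqI)
qed (use bohr_mult_map_coset[OF N] in blast)

text \<open>Left translations by images of group elements permute the classes transitively.\<close>

lemma haar_bohr_coset:
  fixes \<mu> :: "(('g \<Rightarrow> complex) \<Rightarrow> complex) measure"
  assumes "is_normalized_haar bohr_topology bohr_mult \<mu>" and N: "open_normal_subgroup N"
  shows "bohr_coset N a \<in> sets \<mu>" "measure \<mu> (bohr_coset N a) = measure \<mu> (bohr_coset N b)"
proof -
  show m: "bohr_coset N a \<in> sets \<mu>" for a
    using assms(1) clopen_bohr_coset(1)[OF N] by (auto simp: is_normalized_haar_def sets_borel_of)
  have "emeasure \<mu> (bohr_mult (bohr_map (a - b)) ` bohr_coset N b) = emeasure \<mu> (bohr_coset N b)"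
    using assms(1) m[of b] bohr_map_mem[of "a - b"] unfolding is_normalized_haar_def topspace_bohr by blast
  then show "measure \<mu> (bohr_coset N a) = measure \<mu> (bohr_coset N b)"
    unfolding bohr_mult_map_image[OF N] by (simp add: measure_def)
qed

end

section \<open>Parametrizations of compact zero-dimensional spaces\<close>

lemma continuous_map_locally_constant:
  fixes f :: "'a \<Rightarrow> 'b::topological_space"
  assumes "\<And>c. openin T {x \<in> topspace T. f x = c}"
  shows "continuous_map T euclidean f"
  unfolding continuous_map_def
proof (intro conjI allI impI)
  fix V :: "'b set"
  have "{x \<in> topspace T. f x \<in> V} = (\<Union>c\<in>V. {x \<in> topspace T. f x = c})" by blast
  then show "openin T {x \<in> topspace T. f x \<in> V}" using assms by auto
qed simp

lemma powers_of_third_sums: "(\<lambda>k. (1/3::real) ^ Suc k) sums (1/2)"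
  using sums_mult[OF geometric_sums[of "1/3::real"], of "1/3"] by simp

text \<open>
  The digits of \<open>h x\<close> in base \<open>3\<close> record, using only the digits \<open>0\<close> and \<open>1\<close>, which of the sets \<open>U k\<close>
  contain \<open>x\<close>. At the first digit where two points differ, the difference \<open>(1/3) ^ Suc k\<close> outweighs all
  later digits, which contribute at most half as much.
\<close>

lemma exists_continuous_injection:
  fixes T :: "'a topology" and U :: "nat \<Rightarrow> 'a set"
  assumes U_open: "\<And>k. openin T (U k)" and U_closed: "\<And>k. closedin T (U k)"
    and sep: "\<And>x y. x \<in> topspace T \<Longrightarrow> y \<in> topspace T \<Longrightarrow> x \<noteq> y \<Longrightarrow> \<exists>k. (x \<in> U k) \<noteq> (y \<in> U k)"
  obtains h :: "'a \<Rightarrow> real" where "continuous_map T euclidean h" "inj_on h (topspace T)"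
    "\<And>x. 0 \<le> h x" "\<And>x. h x \<le> 1/2"
proof -
  define a where "a x k = indicator (U k) x * (1/3::real) ^ Suc k" for x k
  define h where "h x = (\<Sum>k. a x k)" for x
  have a_bounds: "0 \<le> a x k" "a x k \<le> (1/3) ^ Suc k" for x k
    by (auto simp: a_def indicator_def)
  have summable: "summable (a x)" for x
    by (rule summable_comparison_test'[OF sums_summable[OF powers_of_third_sums]]) (use a_bounds in auto)
  have "continuous_map T euclidean h"
  proof -
    have ind: "continuous_map T euclideanreal (indicator (U k))" for k
    proof (rule continuous_map_locally_constant)
      fix c :: real
      have "{x \<in> topspace T. indicator (U k) x = c} =
          (if c = 1 then U k else if c = 0 then topspace T - U k else {})"
        using openin_subset[OF U_open[of k]] by (auto simp: indicator_def)
      then show "openin T {x \<in> topspace T. indicator (U k) x = c}"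
        using U_open U_closed by (auto simp: closedin_def)
    qed
    have part: "continuous_map T euclideanreal (\<lambda>x. \<Sum>k<n. a x k)" for n
      unfolding a_def by (intro continuous_map_sum continuous_map_real_mult ind continuous_map_canonical_const) simp
    have unif: "uniform_limit UNIV (\<lambda>n x. \<Sum>k<n. a x k) h sequentially"
      unfolding h_def
      by (rule Weierstrass_m_test[OF _ sums_summable[OF powers_of_third_sums]]) (use a_bounds in \<open>auto simp: abs_of_nonneg\<close>)
    have "\<forall>\<^sub>F n in sequentially. \<forall>x\<in>topspace T. dist (\<Sum>k<n. a x k) (h x) < \<epsilon>" if "\<epsilon> > 0" for \<epsilon>
      using uniform_limitD[OF unif that] by (rule eventually_mono) blast
    then have "continuous_map T Met_TC.mtopology h"
      using part by (intro Met_TC.continuous_map_uniform_limit[of _ "\<lambda>n x. \<Sum>k<n. a x k" sequentially]) auto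
    then show ?thesis by simp
  qed
  moreover have "inj_on h (topspace T)"
  proof (rule inj_onI, rule ccontr)
    have less: "h y < h x" if k: "x \<in> U k" "y \<notin> U k" "\<And>j. j < k \<Longrightarrow> (x \<in> U j) = (y \<in> U j)" for x y k
    proof -
      let ?b = "\<lambda>j. a x j - a y j"
      have b: "summable ?b" using summable by (intro summable_diff)
      have b0: "?b j = 0" if "j < k" for j using k(3)[OF that] by (simp add: a_def indicator_def)
      have "h x - h y = (\<Sum>j. ?b j)" unfolding h_def using summable by (intro suminf_diff)
      also have "\<dots> = (\<Sum>j. ?b (j + Suc k)) + (\<Sum>j<Suc k. ?b j)"
        by (rule suminf_split_initial_segment[OF b])
      also have "(\<Sum>j<Suc k. ?b j) = (1/3) ^ Suc k" using b0 k(1,2) by (simp add: a_def)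
      finally have eq: "h x - h y = (\<Sum>j. ?b (j + Suc k)) + (1/3) ^ Suc k" .
      have s: "(\<lambda>j. (1/3::real) ^ Suc k * (1/3) ^ Suc j) sums ((1/3) ^ Suc k * (1/2))"
        by (rule sums_mult[OF powers_of_third_sums])
      have "- ((1/3::real) ^ Suc k * (1/3) ^ Suc j) \<le> ?b (j + Suc k)" for j
        using a_bounds(1)[of x "j + Suc k"] a_bounds(2)[of y "j + Suc k"] by (simp add: power_add mult_ac)
      then have "- ((1/3::real) ^ Suc k * (1/2)) \<le> (\<Sum>j. ?b (j + Suc k))"
        using sums_minus[OF s] summable_ignore_initial_segment[OF b, of "Suc k"]
        by (intro sums_le[OF _ sums_minus[OF s] summable_sums]) auto
      moreover have "0 < (1/3::real) ^ Suc k" by simp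
      ultimately show "h y < h x" using eq by linarith
    qed
    fix x y assume xy: "x \<in> topspace T" "y \<in> topspace T" "h x = h y" "x \<noteq> y"
    define k where "k = (LEAST k. (x \<in> U k) \<noteq> (y \<in> U k))"
    have "(x \<in> U k) \<noteq> (y \<in> U k)" unfolding k_def using sep[OF xy(1,2,4)] by (rule LeastI_ex)
    moreover have "\<And>j. j < k \<Longrightarrow> (x \<in> U j) = (y \<in> U j)" unfolding k_def using not_less_Least by blast
    ultimately show False using less[of x k y] less[of y k x] xy(3) by (metis less_irrefl)
  qed
  moreover have "0 \<le> h x" for x unfolding h_def by (rule suminf_nonneg[OF summable a_bounds(1)])
  moreover have "h x \<le> 1/2" for x
    unfolding h_def using suminf_le[OF a_bounds(2) summable sums_summable[OF powers_of_third_sums]]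
      sums_unique[OF powers_of_third_sums] by metis
  ultimately show ?thesis using that by blast
qed

text \<open>
  By compactness \<open>e\<close> maps closed sets to closed sets, so preimages of open sets under the inverse are
  differences of closed sets. Outside the range of \<open>e\<close>, the value is an arbitrary fixed point.
\<close>

lemma borel_left_inverse:
  fixes e :: "'a \<Rightarrow> real"
  assumes T: "compact_space T" "topspace T \<noteq> {}"
    and e: "continuous_map T euclidean e" "inj_on e (topspace T)"
  obtains r where "r \<in> measurable borel (borel_of T)" "\<And>x. x \<in> topspace T \<Longrightarrow> r (e x) = x"
proof -
  let ?X = "topspace T"
  obtain x0 where x0: "x0 \<in> ?X" using T(2) by blast
  define r where "r y = (if y \<in> e ` ?X then inv_into ?X e y else x0)" for y
  have closed: "closed (e ` C)" if "closedin T C" for C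
  proof -
    have "compactin T C" using closedin_compact_space[OF T(1) that] .
    then have "compactin euclidean (e ` C)" using image_compactin e(1) by blast
    then show ?thesis by (simp add: compact_imp_closed)
  qed
  have "r \<in> measurable borel (borel_of T)"
    unfolding borel_of_def
  proof (rule measurable_measure_of)
    show "{U. openin T U} \<subseteq> Pow ?X" using openin_subset by blast
    show "r \<in> space borel \<rightarrow> ?X" using x0 by (auto simp: r_def inv_into_into)
    fix W assume "W \<in> {U. openin T U}"
    then have W: "openin T W" by simp
    then have "W \<subseteq> ?X" by (rule openin_subset)
    have "r -` W \<inter> space borel = (e ` ?X - e ` (?X - W)) \<union> (if x0 \<in> W then - e ` ?X else {})"
      using e(2) \<open>W \<subseteq> ?X\<close> by (auto simp: r_def inv_into_f_f inj_on_def split: if_splits)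
    moreover have "closed (e ` ?X)" "closed (e ` (?X - W))" using closed W by auto
    ultimately show "r -` W \<inter> space borel \<in> sets borel" by auto
  qed
  moreover have "r (e x) = x" if "x \<in> ?X" for x using that e(2) by (simp add: r_def)
  ultimately show ?thesis using that by blast
qed

lemma continuous_map_borel_measurable:
  fixes e :: "'a \<Rightarrow> real"
  assumes "continuous_map T euclidean e" "sets M = sets (borel_of T)"
  shows "e \<in> borel_measurable M"
proof -
  have sp: "space M = topspace T" using sets_eq_imp_space_eq[OF assms(2)] by simp
  show ?thesis
  proof (rule borel_measurableI)
    fix S :: "real set" assume "open S"
    then have "openin T {x \<in> topspace T. e x \<in> S}"
      using openin_continuous_map_preimage[OF assms(1)] by simp
    moreover have "e -` S \<inter> space M = {x \<in> topspace T. e x \<in> S}" using sp by auto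
    ultimately show "e -` S \<inter> space M \<in> sets M" by (auto simp: assms(2) sets_borel_of)
  qed
qed

lemma prob_space_unit_lebesgue: "prob_space unit_lebesgue"
  by (rule prob_spaceI) (simp add: emeasure_restrict_space space_restrict_space)

text \<open>
  The quantile function of the image of \<open>M\<close> under \<open>e\<close>, followed by the inverse of \<open>e\<close>. The last property
  is the defining property of quantile functions; it holds almost everywhere only, as the quantile
  function may leave the range of \<open>e\<close> on a null set, and as it is arbitrary at \<open>0\<close> and \<open>1\<close>.
\<close>

lemma quantile_parametrization:
  fixes e :: "'a \<Rightarrow> real"
  assumes T: "compact_space T"
    and e: "continuous_map T euclidean e" "inj_on e (topspace T)"
    and M: "prob_space M" "sets M = sets (borel_of T)"
  obtains \<phi> where "\<phi> \<in> measurable unit_lebesgue M" "distr unit_lebesgue M \<phi> = M"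
    "AE t in unit_lebesgue. \<forall>y. e (\<phi> t) \<le> y \<longleftrightarrow> t \<le> measure M {x \<in> space M. e x \<le> y}"
proof -
  interpret M: prob_space M by fact
  have sp: "space M = topspace T" using sets_eq_imp_space_eq[OF M(2)] by simp
  have "topspace T \<noteq> {}" using M.not_empty sp by simp
  then obtain r where r: "r \<in> measurable borel (borel_of T)" "\<And>x. x \<in> topspace T \<Longrightarrow> r (e x) = x"
    using borel_left_inverse[OF T _ e] by blast
  have r_meas [measurable]: "r \<in> measurable borel M"
    using r(1) measurable_cong_sets[OF refl M(2)] by blast
  have e_meas [measurable]: "e \<in> borel_measurable M" using continuous_map_borel_measurable[OF e(1) M(2)] .
  define \<nu> where "\<nu> = distr M borel e"
  interpret \<nu>: prob_space \<nu> unfolding \<nu>_def by (rule M.prob_space_distr) simp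
  interpret \<nu>: cdf_distribution \<nu> by unfold_locales (simp_all add: \<nu>_def)
  define q where "q t = (if t \<in> {0<..<1} then \<nu>.I t else 0)" for t :: real
  have q_meas: "q \<in> borel_measurable borel"
    unfolding q_def[abs_def]
    using \<nu>.measurable_CI by (subst (asm) measurable_restrict_space_iff[where c=0]) auto
  have q_meas' [measurable]: "q \<in> borel_measurable unit_lebesgue"
    by (rule measurable_restrict_space1) (use q_meas in simp)
  have q_distr: "distr unit_lebesgue borel q = \<nu>"
  proof (rule measure_eqI)
    show "sets (distr unit_lebesgue borel q) = sets \<nu>" by (simp add: \<nu>_def)
    fix A assume "A \<in> sets (distr unit_lebesgue borel q)"
    then have A: "A \<in> sets borel" by simp
    have pre: "q -` A \<in> sets borel" using measurable_sets[OF q_meas A] by simp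
    have "emeasure (distr unit_lebesgue borel q) A = emeasure unit_lebesgue (q -` A \<inter> {0..1})"
      using A by (simp add: emeasure_distr[OF q_meas'] space_restrict_space)
    also have "\<dots> = emeasure lborel (q -` A \<inter> {0..1})"
      by (rule emeasure_restrict_space) auto
    also have "\<dots> = emeasure lborel (q -` A \<inter> {0<..<1})"
    proof (rule emeasure_eq_AE)
      show "AE t in lborel. (t \<in> q -` A \<inter> {0..1}) = (t \<in> q -` A \<inter> {0<..<1})"
        using AE_lborel_singleton[of 0] AE_lborel_singleton[of 1] by eventually_elim auto
    qed (use pre in auto)
    also have "q -` A \<inter> {0<..<1} = \<nu>.I -` A \<inter> {0<..<1}" by (auto simp: q_def)
    also have "emeasure lborel \<dots> = emeasure (restrict_space lborel {0<..<1}) (\<nu>.I -` A \<inter> {0<..<1})"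
      by (rule emeasure_restrict_space[symmetric]) auto
    also have "\<dots> = emeasure (distr (restrict_space lborel {0<..<1}) borel \<nu>.I) A"
      using A \<nu>.measurable_CI by (subst emeasure_distr) (auto simp: space_restrict_space cong: measurable_cong_sets)
    also have "\<dots> = emeasure \<nu> A" by (simp add: \<nu>.distr_I_eq_M)
    finally show "emeasure (distr unit_lebesgue borel q) A = emeasure \<nu> A" .
  qed
  define \<phi> where "\<phi> t = r (q t)" for t
  have "\<phi> \<in> measurable unit_lebesgue M" unfolding \<phi>_def[abs_def] by measurable
  moreover have "distr unit_lebesgue M \<phi> = M"
  proof -
    have "distr unit_lebesgue M \<phi> = distr (distr unit_lebesgue borel q) M r"
      by (subst distr_distr) (auto simp: \<phi>_def[abs_def] comp_def)
    also have "\<dots> = distr M M (r \<circ> e)"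
      unfolding q_distr \<nu>_def by (rule distr_distr) auto
    also have "\<dots> = distr M M (\<lambda>x. x)" by (rule distr_cong) (auto simp: sp r(2))
    finally show ?thesis by simp
  qed
  moreover have "AE t in unit_lebesgue. \<forall>y. e (\<phi> t) \<le> y \<longleftrightarrow> t \<le> measure M {x \<in> space M. e x \<le> y}"
  proof -
    have "AE y in \<nu>. e (r y) = y"
      unfolding \<nu>_def by (subst AE_distr_iff) (auto simp: sp r(2))
    then have 1: "AE t in unit_lebesgue. e (\<phi> t) = q t"
      unfolding q_distr[symmetric] \<phi>_def by (subst (asm) AE_distr_iff) auto
    have 2: "AE t in unit_lebesgue. t \<in> {0<..<1}"
      using AE_lborel_singleton[of "0::real"] AE_lborel_singleton[of "1::real"]
      by (subst AE_restrict_space_iff) (auto elim!: eventually_elim2)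
    have C: "\<nu>.C y = measure M {x \<in> space M. e x \<le> y}" for y
      unfolding \<nu>_def cdf_def by (subst measure_distr) (auto intro!: arg_cong[where f="measure M"])
    from 1 2 show ?thesis
    proof eventually_elim
      case (elim t)
      have qt: "q t = \<nu>.I t" using elim(2) by (simp add: q_def)
      show ?case
      proof
        fix y
        have "t \<le> \<nu>.C y \<longleftrightarrow> \<nu>.I t \<le> y" by (rule \<nu>.pseudoinverse) (use elim(2) in auto)
        then show "e (\<phi> t) \<le> y \<longleftrightarrow> t \<le> measure M {x \<in> space M. e x \<le> y}"
          unfolding elim(1) qt C by (rule sym)
      qed
    qed
  qed
  ultimately show ?thesis using that by blast
qed

text \<open>
  Shifting the injection by the index of the class sorts the classes, so that the quantile function
  runs through them one after the other.
\<close>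

lemma exists_ordered_parametrization:
  fixes T :: "'a topology" and U :: "nat \<Rightarrow> 'a set" and idx :: "'a \<Rightarrow> nat"
  assumes T: "compact_space T"
    and U: "\<And>k. openin T (U k)" "\<And>k. closedin T (U k)"
      "\<And>x y. x \<in> topspace T \<Longrightarrow> y \<in> topspace T \<Longrightarrow> x \<noteq> y \<Longrightarrow> \<exists>k. (x \<in> U k) \<noteq> (y \<in> U k)"
    and idx: "\<And>i. openin T {x \<in> topspace T. idx x = i}"
    and M: "prob_space M" "sets M = sets (borel_of T)"
  obtains \<phi> where "is_parametrization (D, M) \<phi>"
    "AE t in unit_lebesgue. \<forall>i. idx (\<phi> t) < i \<longleftrightarrow> t \<le> measure M {x \<in> space M. idx x < i}"
proof -
  obtain h :: "'a \<Rightarrow> real" where h: "continuous_map T euclidean h" "inj_on h (topspace T)" "\<And>x. 0 \<le> h x" "\<And>x. h x \<le> 1/2"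
    using exists_continuous_injection[of T U] U by metis
  \<comment> \<open>The values on class \<open>i\<close> lie in \<open>{i + 1/2..i + 1}\<close>: points of the class are below \<open>i + 1\<close>, but not below
    \<open>i\<close>, in the weak sense in which quantile functions compare.\<close>
  define e where "e x = real (idx x) + (1/2 + h x)" for x
  have "continuous_map T euclideanreal (\<lambda>x. real (idx x))"
  proof (rule continuous_map_locally_constant)
    fix c :: real
    have "{x \<in> topspace T. real (idx x) = c} = (if \<exists>i. real i = c then {x \<in> topspace T. idx x = (THE i. real i = c)} else {})"
      by auto
    then show "openin T {x \<in> topspace T. real (idx x) = c}" using idx by auto
  qed
  then have e: "continuous_map T euclidean e"
    unfolding e_def by (intro continuous_map_add h(1) continuous_map_canonical_const)
  have e_le: "e x \<le> real i \<longleftrightarrow> idx x < i" for x i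
  proof
    assume "e x \<le> real i" then have "real (idx x) < real i" using h(3)[of x] by (simp add: e_def)
    then show "idx x < i" by simp
  next
    assume "idx x < i" then have "real (idx x) + 1 \<le> real i" by linarith
    then show "e x \<le> real i" using h(4)[of x] by (simp add: e_def)
  qed
  have inj: "inj_on e (topspace T)"
  proof (rule inj_onI)
    fix x y assume xy: "x \<in> topspace T" "y \<in> topspace T" "e x = e y"
    have "idx x < i \<longleftrightarrow> idx y < i" for i using e_le[of x i] e_le[of y i] xy(3) by simp
    then have "idx x = idx y" by (metis linorder_neqE_nat less_irrefl)
    then show "x = y" using xy h(2) by (auto simp: e_def dest: inj_onD)
  qed
  obtain \<phi> where \<phi>: "\<phi> \<in> measurable unit_lebesgue M" "distr unit_lebesgue M \<phi> = M"
    "AE t in unit_lebesgue. \<forall>y. e (\<phi> t) \<le> y \<longleftrightarrow> t \<le> measure M {x \<in> space M. e x \<le> y}"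
    using quantile_parametrization[OF T e inj M] .
  have "AE t in unit_lebesgue. \<forall>i. idx (\<phi> t) < i \<longleftrightarrow> t \<le> measure M {x \<in> space M. idx x < i}"
    using \<phi>(3)
  proof eventually_elim
    case (elim t)
    show ?case
    proof
      fix i show "idx (\<phi> t) < i \<longleftrightarrow> t \<le> measure M {x \<in> space M. idx x < i}"
        using elim[rule_format, of "real i"] by (simp add: e_le)
    qed
  qed
  then show ?thesis using that[of \<phi>] \<phi>(1,2) by simp
qed

text \<open>
  Two step functions differ at a time \<open>t\<close> only if \<open>t\<close> lies between corresponding jump times \<open>F l\<close> and
  \<open>G l\<close>.
\<close>

lemma misaligned_set_small:
  fixes F G :: "nat \<Rightarrow> real" and i j :: "real \<Rightarrow> nat"
  assumes i: "AE t in unit_lebesgue. \<forall>l. i t < l \<longleftrightarrow> t \<le> F l"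
    and j: "AE t in unit_lebesgue. \<forall>l. j t < l \<longleftrightarrow> t \<le> G l"
    and bound: "\<And>t. t \<in> {0..1} \<Longrightarrow> i t < k" "\<And>t. t \<in> {0..1} \<Longrightarrow> j t < k"
  obtains B where "B \<in> sets unit_lebesgue" "measure unit_lebesgue B \<le> (\<Sum>l<k. \<bar>F l - G l\<bar>)"
    "\<forall>t\<in>{0..1} - B. i t = j t"
proof -
  interpret prob_space unit_lebesgue by (rule prob_space_unit_lebesgue)
  have "AE t in unit_lebesgue. (\<forall>l. i t < l \<longleftrightarrow> t \<le> F l) \<and> (\<forall>l. j t < l \<longleftrightarrow> t \<le> G l)"
    using i j by eventually_elim blast
  then obtain Z where Z: "{t \<in> space unit_lebesgue. \<not> ((\<forall>l. i t < l \<longleftrightarrow> t \<le> F l) \<and> (\<forall>l. j t < l \<longleftrightarrow> t \<le> G l))} \<subseteq> Z"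
      "emeasure unit_lebesgue Z = 0" "Z \<in> sets unit_lebesgue"
    by (rule AE_E)
  define C where "C l = {0..1} \<inter> {min (F l) (G l)<..max (F l) (G l)}" for l
  have C: "C l \<in> sets unit_lebesgue" for l
    unfolding C_def sets_restrict_space by auto
  have C_le: "measure unit_lebesgue (C l) \<le> \<bar>F l - G l\<bar>" for l
  proof -
    have "measure unit_lebesgue (C l) = measure lborel (C l)"
      unfolding C_def by (rule measure_restrict_space) auto
    also have "\<dots> \<le> measure lborel {min (F l) (G l)<..max (F l) (G l)}"
      unfolding C_def by (rule measure_mono_fmeasurable) (auto simp: fmeasurable_def)
    also have "\<dots> = \<bar>F l - G l\<bar>" by (auto simp: min_def max_def)
    finally show ?thesis .
  qed
  define B where "B = Z \<union> (\<Union>l<k. C l)"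
  have "B \<in> sets unit_lebesgue" unfolding B_def using Z(3) C by auto
  moreover have "measure unit_lebesgue B \<le> (\<Sum>l<k. \<bar>F l - G l\<bar>)"
  proof -
    have "measure unit_lebesgue B \<le> measure unit_lebesgue Z + measure unit_lebesgue (\<Union>l<k. C l)"
      unfolding B_def using Z(3) C by (intro measure_Un_le) auto
    also have "measure unit_lebesgue Z = 0" using Z(2) by (simp add: measure_def)
    also have "measure unit_lebesgue (\<Union>l<k. C l) \<le> (\<Sum>l<k. measure unit_lebesgue (C l))"
      using C by (intro measure_UNION_le) auto
    also have "\<dots> \<le> (\<Sum>l<k. \<bar>F l - G l\<bar>)" by (rule sum_mono) (rule C_le)
    finally show ?thesis by simp
  qed
  moreover have "i t = j t" if t: "t \<in> {0..1} - B" for t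
  proof (rule ccontr)
    assume ne: "i t \<noteq> j t"
    have good: "\<forall>l. i t < l \<longleftrightarrow> t \<le> F l" "\<forall>l. j t < l \<longleftrightarrow> t \<le> G l"
      using Z(1) t by (auto simp: B_def space_restrict_space)
    define l where "l = max (i t) (j t)"
    have "l < k" using bound[of t] t by (auto simp: l_def)
    moreover have "(i t < l) \<noteq> (j t < l)" using ne by (auto simp: l_def)
    then have "(t \<le> F l) \<noteq> (t \<le> G l)" using good by blast
    then have "t \<in> C l" using t by (auto simp: C_def)
    ultimately show False using t by (auto simp: B_def)
  qed
  ultimately show ?thesis using that by blast
qed

section \<open>Observable distance\<close>

lemma me_le:
  assumes "B \<in> sets unit_lebesgue" "measure unit_lebesgue B \<le> \<delta>" "0 < \<delta>"
    and "\<And>t. t \<in> {0..1} - B \<Longrightarrow> \<bar>f t - g t\<bar> \<le> \<delta>"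
  shows "me f g \<le> \<delta>"
proof -
  interpret prob_space unit_lebesgue by (rule prob_space_unit_lebesgue)
  have "measure unit_lebesgue {t \<in> {0..1}. \<bar>f t - g t\<bar> > \<delta>} \<le> measure unit_lebesgue B"
    by (rule finite_measure_mono) (use assms(1,4) in force)+
  then have "\<delta> \<in> {\<epsilon>. \<epsilon> > 0 \<and> measure unit_lebesgue {t\<in>{0..1}. \<bar>f t - g t\<bar> > \<epsilon>} \<le> \<epsilon>}"
    using assms(2,3) by simp
  then show ?thesis unfolding me_def by (intro cInf_lower) (auto intro!: bdd_belowI[of _ 0])
qed

lemma me_le_1: "me f g \<le> 1"
proof (rule me_le[of "{0..1}"])
  interpret prob_space unit_lebesgue by (rule prob_space_unit_lebesgue)
  show "measure unit_lebesgue {0..1} \<le> 1" by (rule prob_le_1)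
  show "{0..1} \<in> sets unit_lebesgue"
    using sets.top[of unit_lebesgue] by (simp add: space_restrict_space)
qed simp_all

lemma hausdorff_distance_nonneg:
  assumes "A \<noteq> {}" "B \<noteq> {}" shows "0 \<le> hausdorff_distance me A B"
  unfolding hausdorff_distance_def
proof (rule cInf_greatest)
  have "me f g < 2" for f g using me_le_1[of f g] by simp
  then show "{\<epsilon>. \<epsilon> > 0 \<and> (\<forall>a\<in>A. \<exists>b\<in>B. me a b < \<epsilon>) \<and> (\<forall>b\<in>B. \<exists>a\<in>A. me a b < \<epsilon>)} \<noteq> {}"
    using assms by (auto intro!: exI[of _ 2])
qed auto

lemma hausdorff_distance_le:
  assumes "0 < \<epsilon>" "\<And>a. a \<in> A \<Longrightarrow> \<exists>b\<in>B. \<rho> a b < \<epsilon>" "\<And>b. b \<in> B \<Longrightarrow> \<exists>a\<in>A. \<rho> a b < \<epsilon>"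
  shows "hausdorff_distance \<rho> A B \<le> \<epsilon>"
  unfolding hausdorff_distance_def
  by (rule cInf_lower) (use assms in \<open>auto intro!: bdd_belowI[of _ 0]\<close>)

lemma Lip1_nonempty: "Lip1 X \<noteq> {}"
proof (cases X)
  case (Pair d \<mu>)
  have "(\<lambda>_. 0) \<in> Lip1 (d, \<mu>)" by simp
  then show ?thesis unfolding Pair by (rule ex_in_conv[THEN iffD1, OF exI])
qed

lemma observable_distance_bounds:
  assumes "is_parametrization X \<phi>" "is_parametrization Y \<psi>"
    and "hausdorff_distance me ((\<lambda>f. f \<circ> \<phi>) ` Lip1 X) ((\<lambda>f. f \<circ> \<psi>) ` Lip1 Y) \<le> \<epsilon>"
  shows "0 \<le> observable_distance X Y" "observable_distance X Y \<le> \<epsilon>"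
proof -
  let ?S = "{hausdorff_distance me ((\<lambda>f. f \<circ> \<phi>) ` Lip1 X) ((\<lambda>f. f \<circ> \<psi>) ` Lip1 Y) |\<phi> \<psi>.
            is_parametrization X \<phi> \<and> is_parametrization Y \<psi>}"
  have nn: "0 \<le> s" if s_mem: "s \<in> ?S" for s
  proof -
    obtain \<phi>' \<psi>' where s: "s = hausdorff_distance me ((\<lambda>f. f \<circ> \<phi>') ` Lip1 X) ((\<lambda>f. f \<circ> \<psi>') ` Lip1 Y)"
      using CollectD[OF s_mem] by (elim exE conjE)
    show ?thesis unfolding s by (rule hausdorff_distance_nonneg) (simp_all add: Lip1_nonempty)
  qed
  have mem: "hausdorff_distance me ((\<lambda>f. f \<circ> \<phi>) ` Lip1 X) ((\<lambda>f. f \<circ> \<psi>) ` Lip1 Y) \<in> ?S"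
    by (rule CollectI, rule exI[of _ \<phi>], rule exI[of _ \<psi>], intro conjI refl assms(1,2))
  show "0 \<le> observable_distance X Y"
    unfolding observable_distance_def
  proof (rule cInf_greatest)
    show "?S \<noteq> {}" by (rule ex_in_conv[THEN iffD1, OF exI, OF mem])
  qed (rule nn)
  have "observable_distance X Y \<le> hausdorff_distance me ((\<lambda>f. f \<circ> \<phi>) ` Lip1 X) ((\<lambda>f. f \<circ> \<psi>) ` Lip1 Y)"
    unfolding observable_distance_def by (rule cInf_lower[OF mem bdd_belowI[of _ 0]]) (rule nn)
  then show "observable_distance X Y \<le> \<epsilon>" using assms(3) by linarith
qed

text \<open>McShane's extension formula, for a finite set of prescribed values.\<close>

lemma lipschitz_extension:
  fixes m :: "'a metric" and P :: "nat \<Rightarrow> 'a" and v :: "nat \<Rightarrow> real"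
  assumes k: "0 < k" and P: "\<And>i. i < k \<Longrightarrow> P i \<in> mspace m"
    and v: "\<And>i j. i < k \<Longrightarrow> j < k \<Longrightarrow> \<bar>v i - v j\<bar> \<le> mdist m (P i) (P j)"
  obtains g where "\<forall>x\<in>mspace m. \<forall>y\<in>mspace m. \<bar>g x - g y\<bar> \<le> mdist m x y"
    "\<forall>i<k. g (P i) = v i"
proof -
  define S where "S x = (\<lambda>i. v i + mdist m x (P i)) ` {..<k}" for x
  define g where "g x = Min (S x)" for x
  have S: "finite (S x)" "S x \<noteq> {}" for x using k by (auto simp: S_def)
  have g_le: "g x \<le> v i + mdist m x (P i)" if "i < k" for x i
    unfolding g_def using S that by (intro Min_le) (auto simp: S_def)
  have g_eq: "\<exists>i<k. g x = v i + mdist m x (P i)" for x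
    using Min_in[OF S, of x] by (auto simp: S_def g_def)
  have half: "g x \<le> g y + mdist m x y" if "x \<in> mspace m" "y \<in> mspace m" for x y
  proof -
    obtain i where i: "i < k" "g y = v i + mdist m y (P i)" using g_eq by blast
    then show ?thesis using g_le[OF i(1), of x] mdist_triangle[OF that P[OF i(1)]] by linarith
  qed
  have lip: "\<bar>g x - g y\<bar> \<le> mdist m x y" if "x \<in> mspace m" "y \<in> mspace m" for x y
    using half[OF that] half[OF that(2,1)] mdist_commute[of m x y] by linarith
  have val: "g (P i) = v i" if i: "i < k" for i
  proof -
    obtain j where j: "j < k" "g (P i) = v j + mdist m (P i) (P j)" using g_eq by blast
    have "mdist m (P i) (P i) = 0" using P[OF i] by simp
    then have "g (P i) \<le> v i" using g_le[OF i, of "P i"] by simp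
    moreover have "v i \<le> g (P i)" using j v[OF i j(1)] by linarith
    ultimately show ?thesis by simp
  qed
  show ?thesis by (rule that[of g]) (simp_all add: lip val)
qed

lemma partition_index:
  fixes P :: "nat \<Rightarrow> 'a set"
  assumes cover: "\<And>x. x \<in> X \<Longrightarrow> \<exists>i<k. x \<in> P i"
    and disj: "\<And>i j. i < k \<Longrightarrow> j < k \<Longrightarrow> i \<noteq> j \<Longrightarrow> P i \<inter> P j = {}"
  obtains idx :: "'a \<Rightarrow> nat" where "\<forall>x\<in>X. idx x < k" "\<forall>x\<in>X. \<forall>i<k. idx x = i \<longleftrightarrow> x \<in> P i"
proof -
  have "\<forall>x. \<exists>i. x \<in> X \<longrightarrow> i < k \<and> x \<in> P i" using cover by blast
  from choice[OF this] obtain idx where idx: "\<forall>x. x \<in> X \<longrightarrow> idx x < k \<and> x \<in> P (idx x)" by blast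
  show ?thesis
  proof (rule that)
    show "\<forall>x\<in>X. idx x < k" using idx by blast
    show "\<forall>x\<in>X. \<forall>i<k. idx x = i \<longleftrightarrow> x \<in> P i"
    proof (intro ballI allI impI)
      fix x i assume "x \<in> X" "i < k"
      then show "idx x = i \<longleftrightarrow> x \<in> P i" using idx disj[of "idx x" i] by blast
    qed
  qed
qed

lemma measure_index_less:
  fixes idx :: "'a \<Rightarrow> nat" and P :: "nat \<Rightarrow> 'a set"
  assumes "finite_measure M" "i \<le> k"
    and P: "\<And>l. l < k \<Longrightarrow> P l \<in> sets M"
    and disj: "\<And>i j. i < k \<Longrightarrow> j < k \<Longrightarrow> i \<noteq> j \<Longrightarrow> P i \<inter> P j = {}"
    and idx: "\<And>x l. x \<in> space M \<Longrightarrow> l < k \<Longrightarrow> idx x = l \<longleftrightarrow> x \<in> P l"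
  shows "measure M {x \<in> space M. idx x < i} = (\<Sum>l<i. measure M (P l))"
proof -
  interpret finite_measure M by fact
  have "{x \<in> space M. idx x < i} = (\<Union>l<i. P l)"
  proof (intro set_eqI iffI)
    fix x assume x: "x \<in> {x \<in> space M. idx x < i}"
    then have "x \<in> space M" "idx x < k" using assms(2) by auto
    then have "x \<in> P (idx x)" using idx[of x "idx x"] by blast
    then show "x \<in> (\<Union>l<i. P l)" using x by blast
  next
    fix x assume "x \<in> (\<Union>l<i. P l)"
    then obtain l where l: "l < i" "x \<in> P l" by blast
    then have "x \<in> space M" using P[of l] sets.sets_into_space assms(2) by fastforce
    then show "x \<in> {x \<in> space M. idx x < i}" using idx[of x l] l assms(2) by auto
  qed
  also have "measure M \<dots> = (\<Sum>l<i. measure M (P l))"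
    by (rule finite_measure_finite_Union)
      (use P assms(2) disj in \<open>auto simp: disjoint_family_on_def\<close>)
  finally show ?thesis .
qed

section \<open>Concentration\<close>

context precompact_group
begin

lemma enumerate_cosets:
  assumes N: "open_normal_subgroup N"
  obtains k and a :: "nat \<Rightarrow> 'g" where "0 < k" "\<forall>z. \<exists>i<k. right_coset N z = right_coset N (a i)"
    "inj_on (\<lambda>i. right_coset N (a i)) {..<k}"
proof -
  have sub: "open N" "add_subgroup N" using N by (auto simp: open_normal_subgroup_def)
  obtain F where F: "finite F" "\<forall>z. \<exists>x\<in>F. z - x \<in> N" by (rule finite_cosets[OF sub])
  let ?Q = "range (right_coset N)"
  have "?Q \<subseteq> right_coset N ` F"
  proof
    fix c assume "c \<in> ?Q"
    then obtain z where "c = right_coset N z" by blast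
    moreover obtain x where "x \<in> F" "z - x \<in> N" using F(2) by blast
    ultimately show "c \<in> right_coset N ` F" using right_coset_eq_iff[OF sub(2)] by blast
  qed
  then have fin: "finite ?Q" using F(1) finite_surj by blast
  then obtain h where h: "bij_betw h {0..<card ?Q} ?Q" using ex_bij_betw_nat_finite by blast
  have "\<forall>i. \<exists>x. i < card ?Q \<longrightarrow> h i = right_coset N x"
    using bij_betw_apply[OF h] by fastforce
  from choice[OF this] obtain a where a: "\<forall>i. i < card ?Q \<longrightarrow> h i = right_coset N (a i)" by blast
  show ?thesis
  proof (rule that[of "card ?Q" a])
    show "0 < card ?Q" using fin by (simp add: card_gt_0_iff)
    show "\<forall>z. \<exists>i<card ?Q. right_coset N z = right_coset N (a i)"
    proof
      fix z
      have "right_coset N z \<in> h ` {0..<card ?Q}" using h by (simp add: bij_betw_def)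
      then show "\<exists>i<card ?Q. right_coset N z = right_coset N (a i)" using a by auto
    qed
    have "inj_on h {..<card ?Q}" using h by (simp add: bij_betw_def atLeast0LessThan)
    then show "inj_on (\<lambda>i. right_coset N (a i)) {..<card ?Q}"
      by (rule inj_on_cong[THEN iffD1, rotated]) (use a in auto)
  qed
qed

text \<open>
  By normality, every coset of \<open>N\<close> is a left translate of every other one. So their masses become
  equal in the limit, and they sum up to \<open>1\<close>.
\<close>

lemma equidistributed_cosets:
  fixes \<mu> :: "nat \<Rightarrow> 'g measure"
  assumes N: "open_normal_subgroup N"
    and a: "0 < k" "\<forall>z. \<exists>i<k. right_coset N z = right_coset N (a i)"
      "inj_on (\<lambda>i. right_coset N (a i)) {..<k}"
    and \<mu>: "\<And>n. borel_probability (\<mu> n)"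
    and UEB: "UEB_converges_to_invariance \<mu> sequentially"
    and "0 < \<eta>"
  shows "\<forall>\<^sub>F n in sequentially. \<forall>l<k. \<bar>measure (\<mu> n) (right_coset N (a l)) - 1 / real k\<bar> < \<eta>"
proof -
  have sub: "open N" "add_subgroup N" and normal: "\<And>x g. x \<in> N \<Longrightarrow> g + x - g \<in> N"
    using N by (auto simp: open_normal_subgroup_def)
  have shift: "{y. (b - c) + y \<in> right_coset N b} = right_coset N c" for b c
  proof -
    have "(b - c) + y - b \<in> N \<longleftrightarrow> y - c \<in> N" for y
    proof
      assume "(b - c) + y - b \<in> N"
      then have "(c - b) + ((b - c) + y - b) - (c - b) \<in> N" by (rule normal)
      moreover have "(c - b) + ((b - c) + y - b) - (c - b) = y - c"
        by (simp add: diff_conv_add_uminus add.assoc minus_add del: add_uminus_conv_diff)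
      ultimately show "y - c \<in> N" by simp
    next
      assume "y - c \<in> N"
      then have "(b - c) + (y - c) - (b - c) \<in> N" by (rule normal)
      moreover have "(b - c) + (y - c) - (b - c) = (b - c) + y - b"
        by (simp add: diff_conv_add_uminus add.assoc minus_add del: add_uminus_conv_diff)
      ultimately show "(b - c) + y - b \<in> N" by simp
    qed
    then show ?thesis by (simp add: right_coset_def)
  qed
  have "\<forall>\<^sub>F n in sequentially. \<forall>i\<in>{..<k}. \<forall>l\<in>{..<k}.
      \<bar>measure (\<mu> n) (right_coset N (a l)) - measure (\<mu> n) (right_coset N (a i))\<bar> < \<eta>"
  proof (rule eventually_ball_finite[OF finite_lessThan], rule ballI, rule eventually_ball_finite[OF finite_lessThan], rule ballI)
    fix i l
    show "\<forall>\<^sub>F n in sequentially. \<bar>measure (\<mu> n) (right_coset N (a l)) - measure (\<mu> n) (right_coset N (a i))\<bar> < \<eta>"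
      using UEB_cosets[OF sub \<mu> UEB \<open>0 < \<eta>\<close>, of "a i - a l"]
    proof eventually_elim
      case (elim n)
      show ?case using elim[rule_format, of "a i"] unfolding shift .
    qed
  qed
  then show ?thesis
  proof eventually_elim
    case (elim n)
    interpret prob_space "\<mu> n" using \<mu> by (simp add: borel_probability_def)
    have st: "sets (\<mu> n) = sets borel" and sp: "space (\<mu> n) = UNIV"
      using \<mu>[of n] sets_eq_imp_space_eq[of "\<mu> n" borel] by (auto simp: borel_probability_def)
    let ?p = "\<lambda>l. prob (right_coset N (a l))"
    have "(\<Sum>i<k. ?p i) = prob (\<Union>i<k. right_coset N (a i))"
    proof (rule finite_measure_finite_Union[symmetric])
      show "disjoint_family_on (\<lambda>i. right_coset N (a i)) {..<k}"
        unfolding disjoint_family_on_def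
        by (intro ballI impI right_cosets_disjoint[OF sub(2)]) (auto dest: inj_onD[OF a(3)])
      show "(\<lambda>i. right_coset N (a i)) ` {..<k} \<subseteq> events" using open_right_coset[OF sub(1)] by (auto simp: st)
    qed simp
    also have "(\<Union>i<k. right_coset N (a i)) = space (\<mu> n)"
    proof -
      have "z \<in> (\<Union>i<k. right_coset N (a i))" for z
        using a(2) self_mem_right_coset[OF sub(2), of z] by blast
      then show ?thesis unfolding sp by blast
    qed
    finally have sum: "(\<Sum>i<k. ?p i) = 1" by (simp add: prob_space)
    show ?case
    proof (intro allI impI)
      fix l assume l: "l < k"
      have "real k * \<bar>?p l - 1 / real k\<bar> = \<bar>real k * (?p l - 1 / real k)\<bar>"
        by (simp only: abs_mult abs_of_nat)
      also have "real k * (?p l - 1 / real k) = real k * ?p l - 1"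
        using a(1) by (simp add: right_diff_distrib)
      also have "real k * ?p l - 1 = (\<Sum>i<k. ?p l - ?p i)" by (simp add: sum_subtractf sum)
      also have "\<bar>\<dots>\<bar> \<le> (\<Sum>i<k. \<bar>?p l - ?p i\<bar>)" by (rule sum_abs)
      also have "\<dots> < (\<Sum>i<k. \<eta>)" by (rule sum_strict_mono) (use elim l a(1) in auto)
      also have "\<dots> = real k * \<eta>" by simp
      finally have "real k * \<bar>?p l - 1 / real k\<bar> < real k * \<eta>" .
      then show "\<bar>?p l - 1 / real k\<bar> < \<eta>" using a(1) by (simp only: mult_less_cancel_left_pos of_nat_0_less_iff)
    qed
  qed
qed

text \<open>
  Countably many cosets suffice to separate points: finitely many for each subgroup of a sequence
  that shrinks to \<open>0\<close>.
\<close>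

lemma separating_cosets:
  obtains M :: "nat \<Rightarrow> 'g set" and x :: "nat \<Rightarrow> 'g" where
    "\<And>k. open_normal_subgroup (M k)"
    "\<And>\<epsilon>. 0 < \<epsilon> \<Longrightarrow> \<exists>N. open_normal_subgroup N \<and> (\<forall>y z. z - y \<in> N \<longrightarrow> mdist d y z < \<epsilon>) \<and>
      (\<forall>z. \<exists>k. M k = N \<and> z \<in> right_coset N (x k))"
proof -
  have "\<exists>N. open_normal_subgroup N \<and> (\<forall>y z::'g. z - y \<in> N \<longrightarrow> mdist d y z < inverse (real (Suc j)))" for j
  proof -
    have "0 < inverse (real (Suc j))" by simp
    then obtain N :: "'g set" where "open_normal_subgroup N" "\<forall>x y. y - x \<in> N \<longrightarrow> mdist d x y < inverse (real (Suc j))"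
      by (rule exists_open_normal_subgroup_mball)
    then show ?thesis by blast
  qed
  then have "\<forall>j. \<exists>N. open_normal_subgroup N \<and> (\<forall>y z::'g. z - y \<in> N \<longrightarrow> mdist d y z < inverse (real (Suc j)))" ..
  from choice[OF this] obtain N where N: "\<forall>j. open_normal_subgroup (N j) \<and> (\<forall>y z::'g. z - y \<in> N j \<longrightarrow> mdist d y z < inverse (real (Suc j)))" ..
  have "\<exists>F. finite F \<and> (\<forall>z. \<exists>x\<in>F. z - x \<in> N j)" for j
  proof -
    have "open (N j)" "add_subgroup (N j)" using N by (auto simp: open_normal_subgroup_def)
    then obtain F where "finite F" "\<forall>z. \<exists>x\<in>F. z - x \<in> N j" by (rule finite_cosets)
    then show ?thesis by blast
  qed
  then have "\<forall>j. \<exists>F. finite F \<and> (\<forall>z. \<exists>x\<in>F. z - x \<in> N j)" ..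
  from choice[OF this] obtain F where F: "\<forall>j. finite (F j) \<and> (\<forall>z. \<exists>x\<in>F j. z - x \<in> N j)" ..
  \<comment> \<open>An index encodes a subgroup of the sequence together with one of its finitely many cosets.\<close>
  define M where "M k = N (fst (prod_decode k))" for k
  define x where "x k = from_nat_into (F (fst (prod_decode k))) (snd (prod_decode k))" for k
  show ?thesis
  proof (rule that[of M x])
    show "open_normal_subgroup (M k)" for k using N by (simp add: M_def)
    fix \<epsilon> :: real assume "0 < \<epsilon>"
    then obtain j where j: "inverse (real (Suc j)) < \<epsilon>" using reals_Archimedean by blast
    have "\<exists>k. M k = N j \<and> z \<in> right_coset (N j) (x k)" for z
    proof -
      obtain y where y: "y \<in> F j" "z - y \<in> N j" using F by blast
      obtain l where "from_nat_into (F j) l = y"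
        using from_nat_into_surj[OF countable_finite y(1)] F by blast
      then show ?thesis using y(2)
        by (intro exI[of _ "prod_encode (j, l)"]) (simp add: M_def x_def right_coset_def)
    qed
    moreover have "\<forall>y z. z - y \<in> N j \<longrightarrow> mdist d y z < \<epsilon>" using N j by (meson less_trans)
    ultimately show "\<exists>N. open_normal_subgroup N \<and> (\<forall>y z. z - y \<in> N \<longrightarrow> mdist d y z < \<epsilon>) \<and>
      (\<forall>z. \<exists>k. M k = N \<and> z \<in> right_coset N (x k))" using N by blast
  qed
qed

end

locale bohr_metric = precompact_group d
  for d :: "'g::{topological_group_add, t2_space, second_countable_topology} metric" +
  fixes d\<^sub>\<kappa> :: "(('g \<Rightarrow> complex) \<Rightarrow> complex) metric"
  assumes bohr_metric: "is_bohr_metric d d\<^sub>\<kappa>"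
begin

lemma mtopology_bohr: "mtopology_of d\<^sub>\<kappa> = bohr_topology"
  using bohr_metric by (simp add: is_bohr_metric_def compatible_metric_def)

lemma mspace_bohr: "mspace d\<^sub>\<kappa> = bohr"
  using mtopology_bohr topspace_bohr topspace_mtopology_of by metis

lemma mdist_bohr_map: "mdist d\<^sub>\<kappa> (bohr_map x) (bohr_map y) = mdist d x y"
  using bohr_metric by (simp add: is_bohr_metric_def)

lemma mm_space_bohr:
  assumes "is_normalized_haar bohr_topology bohr_mult \<mu>"
  shows "mm_space (d\<^sub>\<kappa>, \<mu>)"
proof -
  interpret B: Metric_space "mspace d\<^sub>\<kappa>" "mdist d\<^sub>\<kappa>" by (rule Metric_space_mspace_mdist)
  have "compact_space B.mtopology" using compact_bohr mtopology_bohr by (simp add: mtopology_of_def)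
  then have "mcomplete_of d\<^sub>\<kappa>" unfolding mcomplete_of_def by (rule B.compact_space_imp_mcomplete)
  then show ?thesis
    using assms separable_bohr by (simp add: mtopology_bohr is_normalized_haar_def)
qed

text \<open>
  The class is open and the image of the group is dense, so its points are limits of images of
  points of the coset, on which the two metrics agree.
\<close>

lemma bohr_coset_diam:
  assumes N: "open_normal_subgroup N" "\<forall>x y. y - x \<in> N \<longrightarrow> mdist d x y < \<epsilon>"
    and "\<phi> \<in> bohr_coset N a" "\<psi> \<in> bohr_coset N a"
  shows "mdist d\<^sub>\<kappa> \<phi> \<psi> \<le> \<epsilon>"
proof (rule field_le_epsilon)
  fix e :: real assume "0 < e"
  interpret B: Metric_space "mspace d\<^sub>\<kappa>" "mdist d\<^sub>\<kappa>" by (rule Metric_space_mspace_mdist)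
  have top: "B.mtopology = bohr_topology" using mtopology_bohr by (simp add: mtopology_of_def)
  have sub: "add_subgroup N" using N by (simp add: open_normal_subgroup_def)
  have approx: "\<exists>x. x \<in> right_coset N a \<and> mdist d\<^sub>\<kappa> \<theta> (bohr_map x) < e / 2" if "\<theta> \<in> bohr_coset N a" for \<theta>
  proof -
    have \<theta>: "\<theta> \<in> mspace d\<^sub>\<kappa>" using that by (simp add: mspace_bohr bohr_coset_def)
    have "openin bohr_topology (B.mball \<theta> (e / 2) \<inter> bohr_coset N a)"
      using B.openin_mball[of \<theta> "e / 2"] clopen_bohr_coset(1)[OF N(1)] unfolding top by (rule openin_Int)
    moreover have "\<theta> \<in> B.mball \<theta> (e / 2) \<inter> bohr_coset N a" using that \<theta> \<open>0 < e\<close> by (simp add: B.centre_in_mball_iff)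
    ultimately obtain M b where M: "open_normal_subgroup M" "bohr_map ` right_coset M b \<subseteq> B.mball \<theta> (e / 2) \<inter> bohr_coset N a"
      by (rule bohr_map_dense)
    have "b \<in> right_coset M b" using M(1) self_mem_right_coset by (auto simp: open_normal_subgroup_def)
    then have "bohr_map b \<in> B.mball \<theta> (e / 2)" "bohr_map b \<in> bohr_coset N a" using M(2) by blast+
    then show ?thesis using bohr_map_mem_coset[OF N(1)] B.in_mball by blast
  qed
  obtain x where x: "x \<in> right_coset N a" "mdist d\<^sub>\<kappa> \<phi> (bohr_map x) < e / 2" using approx[OF assms(3)] by blast
  obtain y where y: "y \<in> right_coset N a" "mdist d\<^sub>\<kappa> \<psi> (bohr_map y) < e / 2" using approx[OF assms(4)] by blast
  have "y - x \<in> N" using x(1) y(1) right_coset_eqI[OF sub] right_coset_eq_iff[OF sub] by metis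
  then have "mdist d\<^sub>\<kappa> (bohr_map x) (bohr_map y) < \<epsilon>" using N(2) by (simp add: mdist_bohr_map)
  moreover have mem: "\<phi> \<in> mspace d\<^sub>\<kappa>" "\<psi> \<in> mspace d\<^sub>\<kappa>" "bohr_map x \<in> mspace d\<^sub>\<kappa>" "bohr_map y \<in> mspace d\<^sub>\<kappa>"
    using assms(3,4) bohr_map_mem by (auto simp: mspace_bohr bohr_coset_def)
  moreover have "mdist d\<^sub>\<kappa> \<phi> \<psi> \<le> mdist d\<^sub>\<kappa> \<phi> (bohr_map x) + mdist d\<^sub>\<kappa> (bohr_map x) \<psi>"
    by (rule mdist_triangle) (use mem in auto)
  moreover have "mdist d\<^sub>\<kappa> (bohr_map x) \<psi> \<le> mdist d\<^sub>\<kappa> (bohr_map x) (bohr_map y) + mdist d\<^sub>\<kappa> (bohr_map y) \<psi>"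
    by (rule mdist_triangle) (use mem in auto)
  ultimately show "mdist d\<^sub>\<kappa> \<phi> \<psi> \<le> \<epsilon> + e" using x(2) y(2) mdist_commute[of d\<^sub>\<kappa> "bohr_map y" \<psi>] by linarith
qed

lemma mdist_same_coset:
  assumes "open_normal_subgroup N" "\<forall>x y. y - x \<in> N \<longrightarrow> mdist d x y < \<epsilon>"
    and "x \<in> right_coset N a" "y \<in> right_coset N a"
  shows "mdist d x y < \<epsilon>"
proof -
  have sub: "add_subgroup N" using assms(1) by (simp add: open_normal_subgroup_def)
  have "right_coset N y = right_coset N x" using right_coset_eqI[OF sub] assms(3,4) by metis
  then have "y - x \<in> N" using right_coset_eq_iff[OF sub] by metis
  then show ?thesis using assms(2) by blast
qed

text \<open>
  A 1-Lipschitz function \<open>f\<close> on \<open>X\<close> is transferred by prescribing its values at the images of the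
  representatives \<open>b l\<close> and extending; a function on the Bohr compactification is simply restricted.
  At a time when both parametrizations are in corresponding classes, the first transfer costs the
  diameter of a class on each side, the second only once.
\<close>

lemma observable_distance_transfer:
  fixes X :: "'g set" and a b :: "nat \<Rightarrow> 'g"
  assumes \<phi>: "is_parametrization (submetric d X, M) \<phi>" "\<And>t. t \<in> {0..1} \<Longrightarrow> \<phi> t \<in> X"
    and \<psi>: "is_parametrization (d\<^sub>\<kappa>, M') \<psi>" "\<And>t. t \<in> {0..1} \<Longrightarrow> \<psi> t \<in> bohr"
    and N: "open_normal_subgroup N" "\<forall>x y. y - x \<in> N \<longrightarrow> mdist d x y < \<epsilon>" and "0 < \<epsilon>" "0 < k"
    and b: "\<And>l. l < k \<Longrightarrow> b l \<in> X \<inter> right_coset N (a l)"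
    and B: "B \<in> sets unit_lebesgue" "measure unit_lebesgue B \<le> \<epsilon>"
    and aligned: "\<And>t. t \<in> {0..1} - B \<Longrightarrow> \<exists>l<k. \<phi> t \<in> right_coset N (a l) \<and> \<psi> t \<in> bohr_coset N (a l)"
  shows "0 \<le> observable_distance (submetric d X, M) (d\<^sub>\<kappa>, M')"
    "observable_distance (submetric d X, M) (d\<^sub>\<kappa>, M') \<le> 3 * \<epsilon>"
proof -
  have sp: "mspace d = UNIV" using mspace_eq_UNIV[OF d_compatible] .
  have sub: "add_subgroup N" using N(1) by (simp add: open_normal_subgroup_def)
  have B': "measure unit_lebesgue B \<le> 2 * \<epsilon>" using B(2) \<open>0 < \<epsilon>\<close> by simp
  let ?A = "(\<lambda>f. f \<circ> \<phi>) ` Lip1 (submetric d X, M)" and ?B = "(\<lambda>f. f \<circ> \<psi>) ` Lip1 (d\<^sub>\<kappa>, M')"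
  have "hausdorff_distance me ?A ?B \<le> 3 * \<epsilon>"
  proof (rule hausdorff_distance_le)
    show "0 < 3 * \<epsilon>" using \<open>0 < \<epsilon>\<close> by simp
    fix p assume "p \<in> ?A"
    then obtain f where f: "p = f \<circ> \<phi>" "\<And>x y. x \<in> X \<Longrightarrow> y \<in> X \<Longrightarrow> \<bar>f x - f y\<bar> \<le> mdist d x y"
      by (auto simp: sp)
    obtain g where g: "\<forall>x\<in>mspace d\<^sub>\<kappa>. \<forall>y\<in>mspace d\<^sub>\<kappa>. \<bar>g x - g y\<bar> \<le> mdist d\<^sub>\<kappa> x y"
      "\<forall>i<k. g (bohr_map (b i)) = f (b i)"
    proof (rule lipschitz_extension[OF \<open>0 < k\<close>, of "\<lambda>i. bohr_map (b i)" d\<^sub>\<kappa> "\<lambda>i. f (b i)"])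
      show "bohr_map (b i) \<in> mspace d\<^sub>\<kappa>" for i using bohr_map_mem by (simp add: mspace_bohr)
      show "\<bar>f (b i) - f (b j)\<bar> \<le> mdist d\<^sub>\<kappa> (bohr_map (b i)) (bohr_map (b j))" if "i < k" "j < k" for i j
        unfolding mdist_bohr_map by (rule f(2)) (use b that in auto)
    qed
    have "me p (g \<circ> \<psi>) \<le> 2 * \<epsilon>"
    proof (rule me_le[OF B(1) B'])
      fix t assume t: "t \<in> {0..1} - B"
      obtain l where l: "l < k" "\<phi> t \<in> right_coset N (a l)" "\<psi> t \<in> bohr_coset N (a l)" using aligned[OF t] by blast
      have "\<bar>f (\<phi> t) - f (b l)\<bar> \<le> mdist d (\<phi> t) (b l)" by (rule f(2)) (use \<phi>(2) t b[OF l(1)] in auto)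
      moreover have "mdist d (\<phi> t) (b l) < \<epsilon>" by (rule mdist_same_coset[OF N l(2)]) (use b[OF l(1)] in blast)
      moreover have "\<bar>g (\<psi> t) - g (bohr_map (b l))\<bar> \<le> mdist d\<^sub>\<kappa> (\<psi> t) (bohr_map (b l))"
        by (rule g(1)[rule_format]) (use \<psi>(2) t bohr_map_mem in \<open>auto simp: mspace_bohr\<close>)
      moreover have "mdist d\<^sub>\<kappa> (\<psi> t) (bohr_map (b l)) \<le> \<epsilon>"
        by (rule bohr_coset_diam[OF N l(3)]) (use bohr_map_mem_coset[OF N(1)] b[OF l(1)] in blast)
      ultimately show "\<bar>p t - (g \<circ> \<psi>) t\<bar> \<le> 2 * \<epsilon>" using g(2) l(1) by (simp add: f(1))
    qed (use \<open>0 < \<epsilon>\<close> in simp)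
    then have "me p (g \<circ> \<psi>) < 3 * \<epsilon>" using \<open>0 < \<epsilon>\<close> by linarith
    moreover have "g \<in> Lip1 (d\<^sub>\<kappa>, M')" using g(1) by simp
    ultimately show "\<exists>q\<in>?B. me p q < 3 * \<epsilon>" by (intro bexI[OF _ imageI])
  next
    fix q assume "q \<in> ?B"
    then obtain g where g: "q = g \<circ> \<psi>" "\<And>x y. x \<in> bohr \<Longrightarrow> y \<in> bohr \<Longrightarrow> \<bar>g x - g y\<bar> \<le> mdist d\<^sub>\<kappa> x y"
      by (auto simp: mspace_bohr)
    let ?f = "\<lambda>x. g (bohr_map x)"
    have "me (?f \<circ> \<phi>) q \<le> 2 * \<epsilon>"
    proof (rule me_le[OF B(1) B'])
      fix t assume t: "t \<in> {0..1} - B"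
      obtain l where l: "l < k" "\<phi> t \<in> right_coset N (a l)" "\<psi> t \<in> bohr_coset N (a l)" using aligned[OF t] by blast
      have "\<bar>g (bohr_map (\<phi> t)) - g (\<psi> t)\<bar> \<le> mdist d\<^sub>\<kappa> (bohr_map (\<phi> t)) (\<psi> t)"
        by (rule g(2)) (use \<psi>(2) t bohr_map_mem in auto)
      also have "\<dots> \<le> \<epsilon>"
        by (rule bohr_coset_diam[OF N _ l(3)]) (use bohr_map_mem_coset[OF N(1)] l(2) in blast)
      finally show "\<bar>(?f \<circ> \<phi>) t - q t\<bar> \<le> 2 * \<epsilon>" using \<open>0 < \<epsilon>\<close> by (simp add: g(1))
    qed (use \<open>0 < \<epsilon>\<close> in simp)
    then have "me (?f \<circ> \<phi>) q < 3 * \<epsilon>" using \<open>0 < \<epsilon>\<close> by linarith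
    moreover have "?f \<in> Lip1 (submetric d X, M)"
    proof -
      have "\<bar>?f x - ?f y\<bar> \<le> mdist d x y" for x y
        using g(2)[OF bohr_map_mem bohr_map_mem, of x y] by (simp add: mdist_bohr_map)
      then show ?thesis by simp
    qed
    ultimately show "\<exists>p\<in>?A. me p q < 3 * \<epsilon>" by (intro bexI[OF _ imageI])
  qed
  then show "0 \<le> observable_distance (submetric d X, M) (d\<^sub>\<kappa>, M')"
    "observable_distance (submetric d X, M) (d\<^sub>\<kappa>, M') \<le> 3 * \<epsilon>"
    by (rule observable_distance_bounds[OF \<phi>(1) \<psi>(1)])+
qed

text \<open>
  The second part reduces to the diameter bound: a class of diameter below the distance of two
  functionals does not contain both.
\<close>

lemma separating_cosets_bohr:
  assumes M: "\<And>k. open_normal_subgroup (M k)"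
    "\<And>\<epsilon>. 0 < \<epsilon> \<Longrightarrow> \<exists>N. open_normal_subgroup N \<and> (\<forall>y z. z - y \<in> N \<longrightarrow> mdist d y z < \<epsilon>) \<and>
      (\<forall>z. \<exists>k. M k = N \<and> z \<in> right_coset N (x k))"
  shows "y \<noteq> z \<Longrightarrow> \<exists>k. (y \<in> right_coset (M k) (x k)) \<noteq> (z \<in> right_coset (M k) (x k))"
    and "\<phi> \<in> bohr \<Longrightarrow> \<psi> \<in> bohr \<Longrightarrow> \<phi> \<noteq> \<psi> \<Longrightarrow> \<exists>k. (\<phi> \<in> bohr_coset (M k) (x k)) \<noteq> (\<psi> \<in> bohr_coset (M k) (x k))"
proof -
  assume "y \<noteq> z"
  then have "mdist d y z \<noteq> 0" using mdist_zero[of y d z] mspace_eq_UNIV[OF d_compatible] by simp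
  then have pos: "0 < mdist d y z" using mdist_nonneg[of d y z] by linarith
  from M(2)[OF pos] obtain N where N: "open_normal_subgroup N" "\<forall>u v. v - u \<in> N \<longrightarrow> mdist d u v < mdist d y z"
      "\<forall>z. \<exists>k. M k = N \<and> z \<in> right_coset N (x k)" by (elim exE conjE)
  obtain k where k: "M k = N" "y \<in> right_coset N (x k)" using N(3) by blast
  then have "z \<notin> right_coset N (x k)" using mdist_same_coset[OF N(1,2) k(2)] by blast
  then show "\<exists>k. (y \<in> right_coset (M k) (x k)) \<noteq> (z \<in> right_coset (M k) (x k))"
    using k by (intro exI[of _ k]) simp
next
  assume \<phi>: "\<phi> \<in> bohr" and \<psi>: "\<psi> \<in> bohr" and "\<phi> \<noteq> \<psi>"
  then have "mdist d\<^sub>\<kappa> \<phi> \<psi> \<noteq> 0" using mdist_zero[of \<phi> d\<^sub>\<kappa> \<psi>] by (simp add: mspace_bohr)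
  then have pos: "0 < mdist d\<^sub>\<kappa> \<phi> \<psi>" using mdist_nonneg[of d\<^sub>\<kappa> \<phi> \<psi>] by linarith
  then have "0 < mdist d\<^sub>\<kappa> \<phi> \<psi> / 2" by simp
  from M(2)[OF this] obtain N where N: "open_normal_subgroup N" "\<forall>u v. v - u \<in> N \<longrightarrow> mdist d u v < mdist d\<^sub>\<kappa> \<phi> \<psi> / 2"
      "\<forall>z. \<exists>k. M k = N \<and> z \<in> right_coset N (x k)" by (elim exE conjE)
  have sub: "add_subgroup N" using N(1) by (simp add: open_normal_subgroup_def)
  obtain c where c: "\<phi> \<in> bohr_coset N c" using bohr_coset_cover[OF N(1) \<phi>] .
  obtain k where k: "M k = N" "c \<in> right_coset N (x k)" using N(3) by blast
  have "\<phi> \<in> bohr_coset N (x k)" using c right_coset_eqI[OF sub k(2)] by (simp add: bohr_coset_def)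
  moreover from this have "\<psi> \<notin> bohr_coset N (x k)"
    using bohr_coset_diam[OF N(1,2)] pos by fastforce
  ultimately show "\<exists>k. (\<phi> \<in> bohr_coset (M k) (x k)) \<noteq> (\<psi> \<in> bohr_coset (M k) (x k))"
    using k(1) by (intro exI[of _ k]) simp
qed

lemma haar_bohr_coset_value:
  fixes \<mu> :: "(('g \<Rightarrow> complex) \<Rightarrow> complex) measure"
  assumes haar: "is_normalized_haar bohr_topology bohr_mult \<mu>" and N: "open_normal_subgroup N"
    and cover: "\<And>\<phi>. \<phi> \<in> bohr \<Longrightarrow> \<exists>i<k. \<phi> \<in> bohr_coset N (a i)"
    and disj: "\<And>i j. i < k \<Longrightarrow> j < k \<Longrightarrow> i \<noteq> j \<Longrightarrow> bohr_coset N (a i) \<inter> bohr_coset N (a j) = {}"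
    and "0 < k"
  shows "measure \<mu> (bohr_coset N b) = 1 / real k"
proof -
  interpret prob_space \<mu> using haar by (simp add: is_normalized_haar_def)
  have "sets \<mu> = sets (borel_of bohr_topology)" using haar by (simp add: is_normalized_haar_def)
  from sets_eq_imp_space_eq[OF this] have sp: "space \<mu> = bohr" by (simp add: topspace_bohr)
  have "(\<Union>i<k. bohr_coset N (a i)) = space \<mu>"
    using cover unfolding sp by (auto simp: bohr_coset_def)
  then have "1 = prob (\<Union>i<k. bohr_coset N (a i))" by (simp add: prob_space)
  also have "\<dots> = (\<Sum>i<k. prob (bohr_coset N (a i)))"
  proof (rule finite_measure_finite_Union)
    show "disjoint_family_on (\<lambda>i. bohr_coset N (a i)) {..<k}"
      unfolding disjoint_family_on_def using disj by simp
    show "(\<lambda>i. bohr_coset N (a i)) ` {..<k} \<subseteq> events" using haar_bohr_coset(1)[OF haar N] by blast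
  qed simp
  also have "\<dots> = (\<Sum>i<k. prob (bohr_coset N b))"
    by (rule sum.cong[OF refl]) (rule haar_bohr_coset(2)[OF haar N])
  also have "\<dots> = real k * prob (bohr_coset N b)" by simp
  finally show ?thesis using \<open>0 < k\<close> by (simp add: field_simps)
qed

text \<open>
  The jump times of the two ordered parametrizations are partial sums of the masses of the classes.
  Each of the at most \<open>k\<close> summands is off by less than \<open>\<eta>\<close>, and there are \<open>k\<close> jump times, which
  explains the bound \<open>k * k * \<eta> \<le> \<epsilon>\<close>. The bound \<open>\<eta> \<le> 1 / k\<close> makes all masses positive, so that every
  coset meets the support and has a representative there.
\<close>

lemma observable_distance_small:
  fixes \<nu> :: "'g measure" and \<mu> :: "(('g \<Rightarrow> complex) \<Rightarrow> complex) measure"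
  assumes haar: "is_normalized_haar bohr_topology bohr_mult \<mu>"
    and \<nu>: "borel_probability \<nu>" and K: "compact (spt \<nu>)"
    and N: "open_normal_subgroup N" "\<forall>x y. y - x \<in> N \<longrightarrow> mdist d x y < \<epsilon>" and "0 < \<epsilon>"
    and a: "0 < k" "\<forall>z. \<exists>i<k. right_coset N z = right_coset N (a i)"
      "inj_on (\<lambda>i. right_coset N (a i)) {..<k}"
    and close: "\<forall>l<k. \<bar>measure \<nu> (right_coset N (a l)) - 1 / real k\<bar> < \<eta>"
    and \<eta>: "\<eta> \<le> 1 / real k" "real k * real k * \<eta> \<le> \<epsilon>"
  shows "0 \<le> observable_distance (submetric d (spt \<nu>), restrict_space \<nu> (spt \<nu>)) (d\<^sub>\<kappa>, \<mu>)"
    "observable_distance (submetric d (spt \<nu>), restrict_space \<nu> (spt \<nu>)) (d\<^sub>\<kappa>, \<mu>) \<le> 3 * \<epsilon>"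
proof -
  let ?K = "spt \<nu>"
  let ?M = "restrict_space \<nu> ?K" and ?T = "subtopology euclidean ?K"
  have sub: "open N" "add_subgroup N" using N(1) by (auto simp: open_normal_subgroup_def)
  have st: "sets \<nu> = sets borel" and sp: "space \<nu> = UNIV"
    using \<nu> sets_eq_imp_space_eq[of \<nu> borel] by (auto simp: borel_probability_def)
  have mmX: "mm_space (submetric d ?K, ?M)" using mm_space_support[OF \<nu> K d_compatible] .
  have topX: "mtopology_of (submetric d ?K) = ?T"
    using d_compatible by (simp add: mtopology_of_submetric compatible_metric_def)
  have M: "prob_space ?M" "sets ?M = sets (borel_of ?T)" using mmX topX by auto
  have spM: "space ?M = ?K" using sp by (simp add: space_restrict_space)
  have \<mu>: "prob_space \<mu>" "sets \<mu> = sets (borel_of bohr_topology)"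
    using haar by (auto simp: is_normalized_haar_def)
  have sp\<mu>: "space \<mu> = bohr" using sets_eq_imp_space_eq[OF \<mu>(2)] by (simp add: topspace_bohr)
  interpret M: prob_space ?M by fact
  interpret \<mu>: prob_space \<mu> by fact

  obtain Ms :: "nat \<Rightarrow> 'g set" and xs where Ms: "\<And>k. open_normal_subgroup (Ms k)"
    "\<And>\<epsilon>. 0 < \<epsilon> \<Longrightarrow> \<exists>N. open_normal_subgroup N \<and> (\<forall>y z. z - y \<in> N \<longrightarrow> mdist d y z < \<epsilon>) \<and>
      (\<forall>z. \<exists>k. Ms k = N \<and> z \<in> right_coset N (xs k))"
    by (rule separating_cosets) blast
  have Ms': "open (Ms j)" "add_subgroup (Ms j)" for j using Ms(1) by (auto simp: open_normal_subgroup_def)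

  let ?P = "\<lambda>i. right_coset N (a i) \<inter> ?K" and ?Q = "\<lambda>i. bohr_coset N (a i)"
  have a_ne: "right_coset N (a i) \<noteq> right_coset N (a j)" if "i < k" "j < k" "i \<noteq> j" for i j
    using that by (auto dest: inj_onD[OF a(3)])
  have P_disj: "?P i \<inter> ?P j = {}" if "i < k" "j < k" "i \<noteq> j" for i j
    using right_cosets_disjoint[OF sub(2) a_ne[OF that]] by blast
  have P_cover: "\<exists>i<k. x \<in> ?P i" if "x \<in> ?K" for x
    using a(2) self_mem_right_coset[OF sub(2), of x] that by blast
  have Q_disj: "?Q i \<inter> ?Q j = {}" if "i < k" "j < k" "i \<noteq> j" for i j
    using bohr_coset_disjoint[OF N(1)] a_ne[OF that] by blast
  have Q_cover: "\<exists>i<k. \<phi> \<in> ?Q i" if \<phi>: "\<phi> \<in> bohr" for \<phi>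
  proof -
    obtain c where c: "\<phi> \<in> bohr_coset N c" using bohr_coset_cover[OF N(1) \<phi>] .
    obtain i where "i < k" "right_coset N c = right_coset N (a i)" using a(2) by blast
    then show ?thesis using c by (intro exI[of _ i]) (simp add: bohr_coset_def)
  qed
  obtain idx where "\<forall>x\<in>?K. idx x < k" "\<forall>x\<in>?K. \<forall>i<k. idx x = i \<longleftrightarrow> x \<in> ?P i"
    by (rule partition_index[of ?K k ?P, OF P_cover P_disj])
  note idx = this(1)[rule_format] this(2)[rule_format]
  obtain jdx where "\<forall>x\<in>bohr. jdx x < k" "\<forall>x\<in>bohr. \<forall>i<k. jdx x = i \<longleftrightarrow> x \<in> ?Q i"
    by (rule partition_index[of bohr k ?Q, OF Q_cover Q_disj])
  note jdx = this(1)[rule_format] this(2)[rule_format]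

  have P_open: "openin ?T (?P i)" for i
    by (subst Int_commute) (rule openin_open_Int[OF open_right_coset[OF sub(1)]])
  have idx_open: "openin ?T {x \<in> topspace ?T. idx x = i}" for i
  proof (cases "i < k")
    case True
    then have "{x \<in> topspace ?T. idx x = i} = ?P i" using idx(2) by auto
    then show ?thesis using P_open by simp
  next
    case False
    then have "{x \<in> topspace ?T. idx x = i} = {}" using idx(1) by auto
    then show ?thesis by (metis openin_empty)
  qed
  have jdx_open: "openin bohr_topology {x \<in> topspace bohr_topology. jdx x = i}" for i
  proof (cases "i < k")
    case True
    then have "{x \<in> topspace bohr_topology. jdx x = i} = ?Q i"
      using jdx(2) by (auto simp: topspace_bohr bohr_coset_def)
    then show ?thesis using clopen_bohr_coset(1)[OF N(1)] by simp
  next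
    case False
    then have "{x \<in> topspace bohr_topology. jdx x = i} = {}" using jdx(1) by (auto simp: topspace_bohr)
    then show ?thesis by (metis openin_empty)
  qed

  obtain \<phi> where \<phi>: "is_parametrization (submetric d ?K, ?M) \<phi>"
    "AE t in unit_lebesgue. \<forall>i. idx (\<phi> t) < i \<longleftrightarrow> t \<le> measure ?M {x \<in> space ?M. idx x < i}"
  proof (rule exists_ordered_parametrization[of ?T "\<lambda>j. right_coset (Ms j) (xs j) \<inter> ?K" idx ?M "submetric d ?K"])
    show "compact_space ?T" using K by (simp add: compact_space_subtopology)
    show "openin ?T (right_coset (Ms j) (xs j) \<inter> ?K)" for j
      by (subst Int_commute) (rule openin_open_Int[OF open_right_coset[OF Ms'(1)]])
    show "closedin ?T (right_coset (Ms j) (xs j) \<inter> ?K)" for j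
      by (subst Int_commute) (rule closedin_closed_Int[OF closed_right_coset[OF Ms']])
    show "\<exists>j. (x \<in> right_coset (Ms j) (xs j) \<inter> ?K) \<noteq> (y \<in> right_coset (Ms j) (xs j) \<inter> ?K)"
      if "x \<in> topspace ?T" "y \<in> topspace ?T" "x \<noteq> y" for x y
      using separating_cosets_bohr(1)[OF Ms that(3)] that(1,2) by auto
    show "openin ?T {x \<in> topspace ?T. idx x = i}" for i by (rule idx_open)
    show "prob_space ?M" "sets ?M = sets (borel_of ?T)" by (rule M)+
  qed (rule that)
  obtain \<psi> where \<psi>: "is_parametrization (d\<^sub>\<kappa>, \<mu>) \<psi>"
    "AE t in unit_lebesgue. \<forall>i. jdx (\<psi> t) < i \<longleftrightarrow> t \<le> measure \<mu> {x \<in> space \<mu>. jdx x < i}"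
  proof (rule exists_ordered_parametrization[of bohr_topology "\<lambda>j. bohr_coset (Ms j) (xs j)" jdx \<mu> d\<^sub>\<kappa>])
    show "compact_space (bohr_topology :: (('g \<Rightarrow> complex) \<Rightarrow> complex) topology)" by (rule compact_bohr)
    show "openin bohr_topology (bohr_coset (Ms j) (xs j))" "closedin bohr_topology (bohr_coset (Ms j) (xs j))" for j
      using clopen_bohr_coset[OF Ms(1)] by auto
    show "\<exists>j. (x \<in> bohr_coset (Ms j) (xs j)) \<noteq> (y \<in> bohr_coset (Ms j) (xs j))"
      if "x \<in> topspace bohr_topology" "y \<in> topspace bohr_topology" "x \<noteq> y" for x y
      using separating_cosets_bohr(2)[OF Ms _ _ that(3)] that(1,2) by (simp add: topspace_bohr)
    show "openin bohr_topology {x \<in> topspace bohr_topology. jdx x = i}" for i by (rule jdx_open)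
    show "prob_space \<mu>" "sets \<mu> = sets (borel_of bohr_topology)" by (rule \<mu>)+
  qed (rule that)
  have \<phi>_mem: "\<phi> t \<in> ?K" if "t \<in> {0..1}" for t
  proof -
    have "\<phi> \<in> measurable unit_lebesgue ?M" using \<phi>(1) by simp
    then have "\<phi> t \<in> space ?M" by (rule measurable_space) (use that in \<open>simp add: space_restrict_space\<close>)
    then show ?thesis using spM by simp
  qed
  have \<psi>_mem: "\<psi> t \<in> bohr" if "t \<in> {0..1}" for t
  proof -
    have "\<psi> \<in> measurable unit_lebesgue \<mu>" using \<psi>(1) by simp
    then have "\<psi> t \<in> space \<mu>" by (rule measurable_space) (use that in \<open>simp add: space_restrict_space\<close>)
    then show ?thesis using sp\<mu> by simp
  qed

  have P_meas: "?P l \<in> sets ?M" "measure ?M (?P l) = measure \<nu> (right_coset N (a l))" for l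
    using measure_restrict_spt[OF \<nu>, of "right_coset N (a l)"] open_right_coset[OF sub(1)] by (auto simp: st)
  have Q_val: "measure \<mu> (?Q l) = 1 / real k" for l
    by (rule haar_bohr_coset_value[OF haar N(1) Q_cover Q_disj a(1)])
  have F: "\<bar>measure ?M {x \<in> space ?M. idx x < l} - measure \<mu> {x \<in> space \<mu>. jdx x < l}\<bar> \<le> real k * \<eta>"
    if l: "l < k" for l
  proof -
    have "measure ?M {x \<in> space ?M. idx x < l} = (\<Sum>i<l. measure ?M (?P i))"
      by (rule measure_index_less[OF M.finite_measure_axioms less_imp_le[OF l] P_meas(1) P_disj])
        (use idx(2) spM in auto)
    moreover have "measure \<mu> {x \<in> space \<mu>. jdx x < l} = (\<Sum>i<l. measure \<mu> (?Q i))"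
      by (rule measure_index_less[OF \<mu>.finite_measure_axioms less_imp_le[OF l] haar_bohr_coset(1)[OF haar N(1)] Q_disj])
        (use jdx(2) sp\<mu> in auto)
    ultimately have "\<bar>measure ?M {x \<in> space ?M. idx x < l} - measure \<mu> {x \<in> space \<mu>. jdx x < l}\<bar>
        = \<bar>\<Sum>i<l. measure \<nu> (right_coset N (a i)) - 1 / real k\<bar>"
      by (simp only: P_meas(2) Q_val sum_subtractf)
    also have "\<dots> \<le> (\<Sum>i<l. \<bar>measure \<nu> (right_coset N (a i)) - 1 / real k\<bar>)" by (rule sum_abs)
    also have "\<dots> \<le> (\<Sum>i<l. \<eta>)" by (rule sum_mono) (use close l in \<open>auto intro: less_imp_le\<close>)
    also have "\<dots> \<le> real k * \<eta>"
    proof -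
      have "0 \<le> \<eta>" using close a(1) by (meson abs_ge_zero less_imp_le order.trans)
      then show ?thesis using l by (simp add: mult_right_mono)
    qed
    finally show ?thesis .
  qed
  obtain B where B: "B \<in> sets unit_lebesgue"
    "measure unit_lebesgue B \<le> (\<Sum>l<k. \<bar>measure ?M {x \<in> space ?M. idx x < l} - measure \<mu> {x \<in> space \<mu>. jdx x < l}\<bar>)"
    "\<forall>t\<in>{0..1} - B. idx (\<phi> t) = jdx (\<psi> t)"
    by (rule misaligned_set_small[OF \<phi>(2) \<psi>(2) idx(1)[OF \<phi>_mem] jdx(1)[OF \<psi>_mem]])
  have "(\<Sum>l<k. \<bar>measure ?M {x \<in> space ?M. idx x < l} - measure \<mu> {x \<in> space \<mu>. jdx x < l}\<bar>) \<le> (\<Sum>l<k. real k * \<eta>)"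
    by (rule sum_mono) (rule F, simp)
  also have "\<dots> \<le> \<epsilon>" using \<eta>(2) by (simp add: mult.assoc)
  finally have B_le: "measure unit_lebesgue B \<le> \<epsilon>" using B(2) by linarith

  have "\<exists>b. b \<in> ?K \<inter> right_coset N (a l)" if l: "l < k" for l
  proof (rule ccontr)
    assume "\<nexists>b. b \<in> ?K \<inter> right_coset N (a l)"
    then have "?P l = {}" by blast
    then have "measure \<nu> (right_coset N (a l)) = 0" using P_meas(2)[of l] by simp
    then have "1 / real k < \<eta>" using close l by fastforce
    then show False using \<eta>(1) by simp
  qed
  then have "\<forall>l. \<exists>b. l < k \<longrightarrow> b \<in> ?K \<inter> right_coset N (a l)" by blast
  from choice[OF this] obtain b where b: "\<forall>l. l < k \<longrightarrow> b l \<in> ?K \<inter> right_coset N (a l)" ..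
  have aligned: "\<exists>l<k. \<phi> t \<in> right_coset N (a l) \<and> \<psi> t \<in> bohr_coset N (a l)" if t: "t \<in> {0..1} - B" for t
  proof (intro exI conjI)
    have t': "t \<in> {0..1}" using t by blast
    show "idx (\<phi> t) < k" by (rule idx(1)[OF \<phi>_mem[OF t']])
    show "\<phi> t \<in> right_coset N (a (idx (\<phi> t)))"
      using idx(2)[OF \<phi>_mem[OF t'] idx(1)[OF \<phi>_mem[OF t']]] by blast
    show "\<psi> t \<in> bohr_coset N (a (idx (\<phi> t)))"
      using jdx(2)[OF \<psi>_mem[OF t'] jdx(1)[OF \<psi>_mem[OF t']]] unfolding bspec[OF B(3) t] by blast
  qed
  note transfer = observable_distance_transfer[OF \<phi>(1) \<phi>_mem \<psi>(1) \<psi>_mem N \<open>0 < \<epsilon>\<close> a(1) b[rule_format] B(1) B_le aligned]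
  show "0 \<le> observable_distance (submetric d ?K, ?M) (d\<^sub>\<kappa>, \<mu>)" by (rule transfer(1))
  show "observable_distance (submetric d ?K, ?M) (d\<^sub>\<kappa>, \<mu>) \<le> 3 * \<epsilon>" by (rule transfer(2))
qed

theorem concentrates_if_precompact:
  fixes \<mu> :: "nat \<Rightarrow> 'g measure" and \<mu>\<^sub>\<kappa> :: "(('g \<Rightarrow> complex) \<Rightarrow> complex) measure"
  assumes haar: "is_normalized_haar bohr_topology bohr_mult \<mu>\<^sub>\<kappa>"
    and \<mu>: "\<And>n. borel_probability (\<mu> n)" and K: "\<And>n. compact (spt (\<mu> n))"
    and UEB: "UEB_converges_to_invariance \<mu> sequentially"
  shows "concentrates (\<lambda>n. (submetric d (spt (\<mu> n)), restrict_space (\<mu> n) (spt (\<mu> n)))) (d\<^sub>\<kappa>, \<mu>\<^sub>\<kappa>)"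
  unfolding concentrates_def
proof (intro conjI allI)
  show "mm_space (submetric d (spt (\<mu> n)), restrict_space (\<mu> n) (spt (\<mu> n)))" for n
    using mm_space_support[OF \<mu> K d_compatible] .
  show "mm_space (d\<^sub>\<kappa>, \<mu>\<^sub>\<kappa>)" using mm_space_bohr[OF haar] .
  show "(\<lambda>n. observable_distance (submetric d (spt (\<mu> n)), restrict_space (\<mu> n) (spt (\<mu> n))) (d\<^sub>\<kappa>, \<mu>\<^sub>\<kappa>)) \<longlonglongrightarrow> 0"
  proof (rule tendstoI)
    fix e :: real assume "0 < e"
    \<comment> \<open>The estimate yields \<open>3 * \<epsilon>\<close>, which has to be strictly below \<open>e\<close>.\<close>
    define \<epsilon> where "\<epsilon> = e / 4"
    have "0 < \<epsilon>" using \<open>0 < e\<close> by (simp add: \<epsilon>_def)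
    obtain N :: "'g set" where N: "open_normal_subgroup N" "\<forall>x y. y - x \<in> N \<longrightarrow> mdist d x y < \<epsilon>"
      using exists_open_normal_subgroup_mball[OF \<open>0 < \<epsilon>\<close>] .
    obtain k and a :: "nat \<Rightarrow> 'g" where a: "0 < k" "\<forall>z. \<exists>i<k. right_coset N z = right_coset N (a i)"
      "inj_on (\<lambda>i. right_coset N (a i)) {..<k}"
      by (rule enumerate_cosets[OF N(1)])
    define \<eta> where "\<eta> = min (1 / real k) (\<epsilon> / (real k * real k))"
    have "0 < \<eta>" using a(1) \<open>0 < \<epsilon>\<close> by (simp add: \<eta>_def)
    have \<eta>1: "\<eta> \<le> 1 / real k" by (simp add: \<eta>_def)
    have "real k * real k * \<eta> \<le> real k * real k * (\<epsilon> / (real k * real k))"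
      by (rule mult_left_mono) (simp_all add: \<eta>_def)
    then have \<eta>2: "real k * real k * \<eta> \<le> \<epsilon>" using a(1) by simp
    show "\<forall>\<^sub>F n in sequentially. dist (observable_distance
        (submetric d (spt (\<mu> n)), restrict_space (\<mu> n) (spt (\<mu> n))) (d\<^sub>\<kappa>, \<mu>\<^sub>\<kappa>)) 0 < e"
      using equidistributed_cosets[OF N(1) a \<mu> UEB \<open>0 < \<eta>\<close>]
    proof eventually_elim
      case (elim n)
      note small = observable_distance_small[OF haar \<mu> K N \<open>0 < \<epsilon>\<close> a elim \<eta>1 \<eta>2]
      show ?case using small \<open>0 < e\<close> by (simp add: \<epsilon>_def)
    qed
  qed
qed

end

theorem corollary5p7:
  fixes d :: "'g::{topological_group_add, t2_space, second_countable_topology} metric"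
    and \<mu> :: "nat \<Rightarrow> 'g measure"
    and K :: "nat \<Rightarrow> 'g set"
  assumes nonarch: "non_archimedean TYPE('g)"
    and d_compatible: "compatible_metric euclidean d"
    and d_invariant: "right_invariant d"
    and \<mu>_prob: "\<And>n. borel_probability (\<mu> n)"
    and K_def: "\<And>n. K n = spt (\<mu> n)"
    and K_compact: "\<And>n. compact (K n)"
    and UEB: "UEB_converges_to_invariance \<mu> sequentially"
  shows "(precompact TYPE('g) \<and>
            (\<forall>d\<^sub>\<kappa> \<mu>\<^sub>\<kappa>. is_bohr_metric d d\<^sub>\<kappa> \<and>
               is_normalized_haar (bohr_topology :: (('g \<Rightarrow> complex) \<Rightarrow> complex) topology) bohr_mult \<mu>\<^sub>\<kappa> \<longrightarrow>
               concentrates (\<lambda>n. (submetric d (K n), restrict_space (\<mu> n) (K n))) (d\<^sub>\<kappa>, \<mu>\<^sub>\<kappa>)))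
       \<or> (\<not> precompact TYPE('g) \<and>
            dissipates (\<lambda>n. (submetric d (K n), restrict_space (\<mu> n) (K n))))"
proof (cases "precompact TYPE('g)")
  case True
  have "concentrates (\<lambda>n. (submetric d (K n), restrict_space (\<mu> n) (K n))) (d\<^sub>\<kappa>, \<mu>\<^sub>\<kappa>)"
    if "is_bohr_metric d d\<^sub>\<kappa>" "is_normalized_haar bohr_topology bohr_mult \<mu>\<^sub>\<kappa>" for d\<^sub>\<kappa> \<mu>\<^sub>\<kappa>
  proof -
    interpret bohr_metric d d\<^sub>\<kappa> by unfold_locales fact+
    show ?thesis
      unfolding K_def by (rule concentrates_if_precompact[OF that(2) \<mu>_prob K_compact[unfolded K_def] UEB])
  qed
  with True show ?thesis by blast
next
  case False
  then show ?thesis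
    unfolding K_def
    using dissipates_if_not_precompact[OF nonarch False d_compatible d_invariant \<mu>_prob K_compact[unfolded K_def] UEB]
    by blast
qed

end
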